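(* Let $M\subset\mathbb C^{n+1}$ be a real-analytic holomorphically nondegenerate hypersurface with $p\in M$, let $M'\subset\mathbb C^N$ be a real-analytic submanifold with $p'\in M'$, and let $H\colon(\mathbb C^{n+1},p)\to(\mathbb C^N,p')$ be a germ at $p$ of a holomorphic mapping. If there exists a complex subvariety $X\subset\mathbb C^N$ of dimension $\le n$, with $p'\in X$, such that $H(M)\subset X\cap M'$ (as germs at $p$, $p'$), then $H(\mathbb C^{n+1})\subset M'$ (as germs, i.e. $H$ sends a full neighborhood of $p$ in $\mathbb C^{n+1}$ into $M'$).
   Context: Hypersurface means real hypersurface; holomorphically nondegenerate hypersurfaces are connected by definition: a connected real-analytic hypersurface $M\subset \mathbb C^{n+1}$ is holomorphically nondegenerate if there is no point of $M$ at which there is a germ of a nontrivial (not identically zero) holomorphic $(1,0)$-vector field $\sum_j a_j(Z)\,\partial/\partial Z_j$ ($a_j$ holomorphic) tangent to $M$. *)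

theory Defs
  imports "HOL-Analysis.Analysis"
begin

text \<open>
  Real-analyticity in several real variables: local expansion in an absolutely convergent power
  series. Multi-indices are extensional functions on the standard basis.
\<close>

definition real_analytic_on :: "('a::euclidean_space \<Rightarrow> real) \<Rightarrow> 'a set \<Rightarrow> bool" where
  "real_analytic_on f U \<longleftrightarrow>
     (\<forall>x\<in>U. \<exists>c r. r > 0 \<and>
        (\<forall>y\<in>ball x r.
           ((\<lambda>\<alpha>. c \<alpha> * (\<Prod>b\<in>Basis. ((y - x) \<bullet> b) ^ \<alpha> b)) has_sum f y)
             (Basis \<rightarrow>\<^sub>E (UNIV :: nat set))))"

definition real_analytic_defining ::
    "nat \<Rightarrow> (nat \<Rightarrow> 'a::euclidean_space \<Rightarrow> real) \<Rightarrow> 'a set \<Rightarrow> 'a set \<Rightarrow> bool" where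
  "real_analytic_defining d \<rho> U M \<longleftrightarrow>
     open U \<and>
     (\<forall>i<d. real_analytic_on (\<rho> i) U) \<and>
     M \<inter> U = {x\<in>U. \<forall>i<d. \<rho> i x = 0} \<and>
     (\<forall>x\<in>U. \<forall>c::nat \<Rightarrow> real.
        (\<forall>v. (\<Sum>i<d. c i * frechet_derivative (\<rho> i) (at x) v) = 0) \<longrightarrow> (\<forall>i<d. c i = 0))"

text \<open>Submanifolds are embedded, but need not be closed; \<open>d\<close> is the real codimension.\<close>

definition real_analytic_submanifold :: "nat \<Rightarrow> 'a::euclidean_space set \<Rightarrow> bool" where
  "real_analytic_submanifold d M \<longleftrightarrow>
     (\<forall>q\<in>M. \<exists>U \<rho>. q \<in> U \<and> real_analytic_defining d \<rho> U M)"

abbreviation real_analytic_hypersurface :: "'a::euclidean_space set \<Rightarrow> bool" where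
  "real_analytic_hypersurface M \<equiv> real_analytic_submanifold 1 M"

text \<open>Holomorphy in several variables, to be used on open sets: the Frechet derivative exists and
  is complex-linear.\<close>

definition holomorphic_fun_on :: "(complex^'m \<Rightarrow> complex) \<Rightarrow> (complex^'m) set \<Rightarrow> bool" where
  "holomorphic_fun_on f U \<longleftrightarrow>
     (\<forall>z\<in>U. \<exists>f'. (f has_derivative f') (at z) \<and> (\<forall>c v. f' (c *s v) = c * f' v))"

definition holomorphic_map_on ::
    "(complex^'m \<Rightarrow> complex^'k) \<Rightarrow> (complex^'m) set \<Rightarrow> bool" where
  "holomorphic_map_on f U \<longleftrightarrow> (\<forall>i. holomorphic_fun_on (\<lambda>z. f z $ i) U)"

text \<open>\<open>\<partial>\<rho>/\<partial>Z\<^sub>j = (\<partial>\<rho>/\<partial>x\<^sub>j - \<i> \<partial>\<rho>/\<partial>y\<^sub>j) / 2\<close>, where \<open>Z\<^sub>j = x\<^sub>j + \<i> y\<^sub>j\<close>.\<close>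

definition wirtinger :: "'m \<Rightarrow> (complex^'m \<Rightarrow> real) \<Rightarrow> complex^'m \<Rightarrow> complex" where
  "wirtinger j \<rho> z =
     (of_real (frechet_derivative \<rho> (at z) (axis j 1))
       - \<i> * of_real (frechet_derivative \<rho> (at z) (axis j \<i>))) / 2"

text \<open>
  There is a germ at \<open>q\<close> of a nontrivial holomorphic (1,0)-vector field
  \<open>\<Sum>\<^sub>j a\<^sub>j \<partial>/\<partial>Z\<^sub>j\<close> tangent to the hypersurface \<open>M\<close>, i.e. annihilating a local defining function at
  the points of \<open>M\<close>; this does not depend on the choice of the defining function.
  Nontriviality of the germ means that \<open>a\<close> does not vanish identically near \<open>q\<close>.
\<close>

definition tangent_holomorphic_field_at :: "(complex^'m) set \<Rightarrow> complex^'m \<Rightarrow> bool" where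
  "tangent_holomorphic_field_at M q \<longleftrightarrow>
     (\<exists>U \<rho> a. q \<in> U \<and> real_analytic_defining 1 (\<lambda>_. \<rho>) U M \<and>
        holomorphic_map_on a U \<and>
        \<not> (\<forall>\<^sub>F z in nhds q. a z = 0) \<and>
        (\<forall>z\<in>M \<inter> U. (\<Sum>j\<in>UNIV. a z $ j * wirtinger j \<rho> z) = 0))"

definition holomorphically_nondegenerate :: "(complex^'m) set \<Rightarrow> bool" where
  "holomorphically_nondegenerate M \<longleftrightarrow>
     real_analytic_hypersurface M \<and> connected M \<and>
     \<not> (\<exists>q\<in>M. tangent_holomorphic_field_at M q)"

text \<open>
  Subvarieties may be local: every point \<^emph>\<open>of\<close> \<open>X\<close> has a neighbourhood in which \<open>X\<close> is the
  common zero set of finitely many holomorphic functions. Analytic subsets of the whole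
  space, or of an open set, are special cases.
\<close>

definition complex_subvariety :: "(complex^'k) set \<Rightarrow> bool" where
  "complex_subvariety X \<longleftrightarrow>
     (\<forall>q\<in>X. \<exists>U k f. open U \<and> q \<in> U \<and>
        (\<forall>i<(k::nat). holomorphic_fun_on (f i) U) \<and>
        X \<inter> U = {z\<in>U. \<forall>i<k. f i z = 0})"

text \<open>\<open>q\<close> is a regular point of \<open>X\<close> of dimension \<open>d\<close>: near \<open>q\<close>, \<open>X\<close> is a complex submanifold of
  complex dimension \<open>d\<close>, given by as many independent equations as its codimension.\<close>

definition regular_point_of_dim :: "nat \<Rightarrow> (complex^'k) set \<Rightarrow> complex^'k \<Rightarrow> bool" where
  "regular_point_of_dim d X q \<longleftrightarrow>
     q \<in> X \<and> d \<le> CARD('k) \<and>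
     (\<exists>U f. open U \<and> q \<in> U \<and>
        (\<forall>i<CARD('k) - d. holomorphic_fun_on (f i) U) \<and>
        X \<inter> U = {z\<in>U. \<forall>i<CARD('k) - d. f i z = 0} \<and>
        (\<forall>z\<in>U. \<forall>c::nat \<Rightarrow> complex.
           (\<forall>v. (\<Sum>i<CARD('k) - d. c i * frechet_derivative (f i) (at z) v) = 0)
             \<longrightarrow> (\<forall>i<CARD('k) - d. c i = 0)))"

text \<open>The set is bounded by \<open>CARD('k)\<close>, and nonempty for a nonempty subvariety, so the supremum is
  a maximum.\<close>

definition complex_dim :: "(complex^'k) set \<Rightarrow> nat" where
  "complex_dim X = Sup {d. \<exists>q. regular_point_of_dim d X q}"

end

theory Submission
  imports Defs "HOL-Complex_Analysis.Complex_Analysis"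
begin

text \<open>
  A hypersurface is a uniqueness set for holomorphic functions, so \<open>H\<close> maps a full neighbourhood of \<open>p\<close>
  into \<open>X\<close>. As \<open>dim X \<le> n\<close>, the differential of \<open>H\<close> is nowhere injective, and where its rank is maximal
  its kernel contains a holomorphic vector field \<open>a\<close> along whose flow \<open>H\<close> is constant. By holomorphic
  nondegeneracy \<open>a\<close> is transverse to \<open>M\<close> at some point of \<open>M\<close>; flowing along \<open>a\<close> onto \<open>M\<close> shows that \<open>H\<close> maps
  an open set into \<open>M'\<close>, and the identity theorem for real-analytic functions finishes the proof.

  The only other ingredient is that \<open>dim X\<close>, defined by regular points, bounds the rank of maps into
  \<open>X\<close>: an analytic set containing an immersed manifold of dimension \<open>m\<close> has regular points of dimension
  at least \<open>m\<close>. This is proved by induction on the ambient dimension: \<open>X\<close> is projected along a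
  line on which one of its equations does not vanish identically, the image is again analytic by
  elimination, and over a regular point of the image \<open>X\<close> is generically a union of disjoint graphs.
\<close>

text \<open>Dimensions are types here, so the induction on the ambient dimension stays inside one
  space \<open>complex^'k\<close>: the current ambient space is the range, of real dimension
  \<open>2 * c\<close>, of an idempotent complex-linear map \<open>P\<close>, and equations and
  neighbourhoods are \<open>P\<close>-invariant. Projecting an immersion along a line may destroy
  its immersivity. What survives is discreteness of the fibres, because the lost coordinate is an
  isolated root of one equation. Discreteness is therefore the hypothesis carried along, and the
  flow lemma that serves \<open>H\<close> in the theorem also turns it back into an inequality of
  dimensions. The regular point found need not lie on the immersed manifold, which is harmless since
  only a maximal dimension is compared. The field \<open>a\<close> exists only off the zeros of a
  determinant \<open>D\<close>, which may vanish at \<open>p\<close>. As \<open>D\<close> cannot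
  vanish on all of \<open>M\<close> near \<open>p\<close>, nondegeneracy is applied at a point of
  \<open>M\<close> that may differ from \<open>p\<close>. Holomorphic functions of several variables
  are handled by restriction to complex lines, with parameters entering through integrals over
  circles.\<close>

no_notation fps_nth (infixl \<open>$\<close> 75)

section \<open>Holomorphic functions of several variables\<close>

lemma holomorphic_fun_on_frechet:
  fixes f :: "complex^'m \<Rightarrow> complex"
  assumes "holomorphic_fun_on f U" "z \<in> U"
  shows "(f has_derivative frechet_derivative f (at z)) (at z)"
    and "frechet_derivative f (at z) (c *s v) = c * frechet_derivative f (at z) v"
    and "linear (frechet_derivative f (at z))"
proof -
  obtain f' where f': "(f has_derivative f') (at z)" "\<forall>c v. f' (c *s v) = c * f' v"
    using assms unfolding holomorphic_fun_on_def by blast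
  have eq: "f' = frechet_derivative f (at z)"
    by (rule frechet_derivative_at[OF f'(1)])
  show "(f has_derivative frechet_derivative f (at z)) (at z)"
    "frechet_derivative f (at z) (c *s v) = c * frechet_derivative f (at z) v"
    "linear (frechet_derivative f (at z))"
    using f' eq has_derivative_linear by auto
qed

lemma holomorphic_fun_onI:
  assumes "\<And>z. z \<in> U \<Longrightarrow> (f has_derivative f' z) (at z)"
    and "\<And>z c v. z \<in> U \<Longrightarrow> f' z (c *s v) = c * f' z v"
  shows "holomorphic_fun_on f U"
  using assms unfolding holomorphic_fun_on_def by blast

lemma holomorphic_fun_on_subset: "holomorphic_fun_on f U \<Longrightarrow> V \<subseteq> U \<Longrightarrow> holomorphic_fun_on f V"
  unfolding holomorphic_fun_on_def by blast

lemma holomorphic_map_on_subset: "holomorphic_map_on f U \<Longrightarrow> V \<subseteq> U \<Longrightarrow> holomorphic_map_on f V"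
  unfolding holomorphic_map_on_def using holomorphic_fun_on_subset by blast

lemma holomorphic_fun_on_imp_continuous_on:
  "holomorphic_fun_on f U \<Longrightarrow> continuous_on U f"
  by (meson holomorphic_fun_on_frechet(1) has_derivative_continuous continuous_at_imp_continuous_on)

lemma holomorphic_map_on_imp_continuous_on:
  assumes "holomorphic_map_on f U"
  shows "continuous_on U f"
proof -
  have "continuous_on U (\<lambda>z. \<chi> i. f z $ i)"
    by (intro continuous_on_vec_lambda holomorphic_fun_on_imp_continuous_on)
      (use assms in \<open>simp add: holomorphic_map_on_def\<close>)
  then show ?thesis by simp
qed

lemma holomorphic_fun_on_cong:
  assumes "holomorphic_fun_on f U" "open U" "\<And>z. z \<in> U \<Longrightarrow> g z = f z"
  shows "holomorphic_fun_on g U"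
proof (rule holomorphic_fun_onI[where f' = "\<lambda>z. frechet_derivative f (at z)"])
  fix z assume z: "z \<in> U"
  show "(g has_derivative frechet_derivative f (at z)) (at z)"
    by (rule has_derivative_transform_within_open[OF holomorphic_fun_on_frechet(1)[OF assms(1) z]])
      (use assms z in auto)
qed (use assms holomorphic_fun_on_frechet in blast)

lemma holomorphic_fun_on_const: "holomorphic_fun_on (\<lambda>z. c) U"
  by (rule holomorphic_fun_onI[where f' = "\<lambda>z v. 0"]) auto

lemma holomorphic_fun_on_nth: "holomorphic_fun_on (\<lambda>z. z $ i) U"
  by (rule holomorphic_fun_onI[where f' = "\<lambda>z v. v $ i"])
    (auto intro!: bounded_linear_imp_has_derivative bounded_linear_vec_nth)

lemma holomorphic_fun_on_add:
  assumes "holomorphic_fun_on f U" "holomorphic_fun_on g U"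
  shows "holomorphic_fun_on (\<lambda>z. f z + g z) U"
  by (rule holomorphic_fun_onI[where f' = "\<lambda>z v. frechet_derivative f (at z) v + frechet_derivative g (at z) v"])
    (auto intro!: derivative_eq_intros holomorphic_fun_on_frechet(1)[OF assms(1)] holomorphic_fun_on_frechet(1)[OF assms(2)]
      simp: holomorphic_fun_on_frechet(2)[OF assms(1)] holomorphic_fun_on_frechet(2)[OF assms(2)] algebra_simps)

lemma holomorphic_fun_on_mult:
  assumes "holomorphic_fun_on f U" "holomorphic_fun_on g U"
  shows "holomorphic_fun_on (\<lambda>z. f z * g z) U"
  by (rule holomorphic_fun_onI[where f' = "\<lambda>z v. f z * frechet_derivative g (at z) v + frechet_derivative f (at z) v * g z"])
    (auto intro!: derivative_eq_intros holomorphic_fun_on_frechet(1)[OF assms(1)] holomorphic_fun_on_frechet(1)[OF assms(2)]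
      simp: holomorphic_fun_on_frechet(2)[OF assms(1)] holomorphic_fun_on_frechet(2)[OF assms(2)] algebra_simps)

lemma holomorphic_fun_on_minus:
  assumes "holomorphic_fun_on f U"
  shows "holomorphic_fun_on (\<lambda>z. - f z) U"
  using holomorphic_fun_on_mult[OF holomorphic_fun_on_const[of "-1"] assms] by simp

lemma holomorphic_fun_on_diff:
  assumes "holomorphic_fun_on f U" "holomorphic_fun_on g U"
  shows "holomorphic_fun_on (\<lambda>z. f z - g z) U"
  using holomorphic_fun_on_add[OF assms(1) holomorphic_fun_on_minus[OF assms(2)]] by simp

lemma holomorphic_fun_on_sum:
  "(\<And>i. i \<in> I \<Longrightarrow> holomorphic_fun_on (f i) U) \<Longrightarrow> holomorphic_fun_on (\<lambda>z. \<Sum>i\<in>I. f i z) U"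
  by (induction I rule: infinite_finite_induct)
    (auto intro: holomorphic_fun_on_const holomorphic_fun_on_add)

lemma holomorphic_fun_on_prod:
  "(\<And>i. i \<in> I \<Longrightarrow> holomorphic_fun_on (f i) U) \<Longrightarrow> holomorphic_fun_on (\<lambda>z. \<Prod>i\<in>I. f i z) U"
  by (induction I rule: infinite_finite_induct)
    (auto intro: holomorphic_fun_on_const holomorphic_fun_on_mult)

lemma holomorphic_fun_on_power:
  "holomorphic_fun_on f U \<Longrightarrow> holomorphic_fun_on (\<lambda>z. f z ^ n) U"
  by (induction n) (auto intro: holomorphic_fun_on_const holomorphic_fun_on_mult)

lemma holomorphic_fun_on_inverse:
  fixes f :: "complex^'m \<Rightarrow> complex"
  assumes f: "holomorphic_fun_on f U" and "\<And>z. z \<in> U \<Longrightarrow> f z \<noteq> 0"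
  shows "holomorphic_fun_on (\<lambda>z. inverse (f z)) U"
proof (rule holomorphic_fun_onI[where f' = "\<lambda>z v. - (inverse (f z) * frechet_derivative f (at z) v * inverse (f z))"])
  fix z assume z: "z \<in> U"
  show "((\<lambda>z. inverse (f z)) has_derivative
      (\<lambda>v. - (inverse (f z) * frechet_derivative f (at z) v * inverse (f z)))) (at z)"
    by (rule Deriv.has_derivative_inverse[OF _ holomorphic_fun_on_frechet(1)[OF f z]]) (use assms z in auto)
qed (simp add: holomorphic_fun_on_frechet(2)[OF f])

lemma holomorphic_fun_on_divide:
  assumes "holomorphic_fun_on f U" "holomorphic_fun_on g U" "\<And>z. z \<in> U \<Longrightarrow> g z \<noteq> 0"
  shows "holomorphic_fun_on (\<lambda>z. f z / g z) U"
  using holomorphic_fun_on_mult[OF assms(1) holomorphic_fun_on_inverse[OF assms(2,3)]]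
  by (simp add: divide_inverse)

lemma has_derivative_vec_lambda:
  fixes f :: "'k::finite \<Rightarrow> 'a::euclidean_space \<Rightarrow> 'b::euclidean_space"
  assumes "\<And>k. (f k has_derivative f' k) (at x within S)"
  shows "((\<lambda>x. \<chi> k. f k x) has_derivative (\<lambda>v. \<chi> k. f' k v)) (at x within S)"
proof (subst has_derivative_componentwise_within, rule ballI)
  fix b :: "'b^'k" assume "b \<in> Basis"
  then obtain i u where b: "b = axis i u" by (auto simp: Basis_vec_def)
  show "((\<lambda>x. (\<chi> k. f k x) \<bullet> b) has_derivative (\<lambda>v. (\<chi> k. f' k v) \<bullet> b)) (at x within S)"
    unfolding b inner_axis by (simp add: has_derivative_inner_left assms)
qed

definition map_deriv :: "(complex^'m \<Rightarrow> complex^'k) \<Rightarrow> complex^'m \<Rightarrow> complex^'m \<Rightarrow> complex^'k" where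
  "map_deriv H z v = (\<chi> k. frechet_derivative (\<lambda>z. H z $ k) (at z) v)"

lemma holomorphic_map_on_map_deriv:
  fixes H :: "complex^'m \<Rightarrow> complex^'k"
  assumes "holomorphic_map_on H U" "z \<in> U"
  shows "(H has_derivative map_deriv H z) (at z)"
    and "map_deriv H z (c *s v) = c *s map_deriv H z v"
    and "linear (map_deriv H z)"
proof -
  have c: "holomorphic_fun_on (\<lambda>z. H z $ k) U" for k
    using assms unfolding holomorphic_map_on_def by blast
  have "((\<lambda>x. \<chi> k. H x $ k) has_derivative (\<lambda>v. \<chi> k. frechet_derivative (\<lambda>z. H z $ k) (at z) v)) (at z)"
    by (intro has_derivative_vec_lambda holomorphic_fun_on_frechet(1)[OF c assms(2)])
  then show "(H has_derivative map_deriv H z) (at z)"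
    by (simp add: map_deriv_def[abs_def])
  then show "linear (map_deriv H z)"
    by (rule has_derivative_linear)
  show "map_deriv H z (c *s v) = c *s map_deriv H z v"
    by (simp add: vec_eq_iff map_deriv_def holomorphic_fun_on_frechet(2)[OF assms(1)[unfolded holomorphic_map_on_def, rule_format] assms(2)])
qed

lemma holomorphic_map_onI:
  assumes "\<And>z. z \<in> U \<Longrightarrow> (H has_derivative H' z) (at z)"
    and "\<And>z c v. z \<in> U \<Longrightarrow> H' z (c *s v) = c *s H' z v"
  shows "holomorphic_map_on H U"
  unfolding holomorphic_map_on_def
proof
  fix i
  show "holomorphic_fun_on (\<lambda>z. H z $ i) U"
  proof (rule holomorphic_fun_onI[where f' = "\<lambda>z v. H' z v $ i"])
    show "((\<lambda>z. H z $ i) has_derivative (\<lambda>v. H' z v $ i)) (at z)" if "z \<in> U" for z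
      using has_derivative_compose[OF assms(1)[OF that] bounded_linear_imp_has_derivative[OF bounded_linear_vec_nth]] .
  qed (simp add: assms)
qed

lemma holomorphic_fun_on_compose:
  fixes G :: "complex^'m \<Rightarrow> complex^'k"
  assumes "holomorphic_map_on G U" "holomorphic_fun_on f V" "G ` U \<subseteq> V"
  shows "holomorphic_fun_on (\<lambda>z. f (G z)) U"
proof (rule holomorphic_fun_onI[where f' = "\<lambda>z v. frechet_derivative f (at (G z)) (map_deriv G z v)"])
  fix z assume z: "z \<in> U"
  show "((\<lambda>z. f (G z)) has_derivative (\<lambda>v. frechet_derivative f (at (G z)) (map_deriv G z v))) (at z)"
    using has_derivative_compose[OF holomorphic_map_on_map_deriv(1)[OF assms(1) z]
        holomorphic_fun_on_frechet(1)[OF assms(2)]] assms(3) z by auto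
  show "frechet_derivative f (at (G z)) (map_deriv G z (c *s v)) =
     c * frechet_derivative f (at (G z)) (map_deriv G z v)" for c v
    using holomorphic_map_on_map_deriv(2)[OF assms(1) z] holomorphic_fun_on_frechet(2)[OF assms(2)] assms(3) z
    by (metis image_subset_iff)
qed

lemma holomorphic_map_on_compose:
  assumes "holomorphic_map_on G U" "holomorphic_map_on F V" "G ` U \<subseteq> V"
  shows "holomorphic_map_on (\<lambda>z. F (G z)) U"
  using assms holomorphic_fun_on_compose unfolding holomorphic_map_on_def by blast

section \<open>Complex-linear maps and restriction to complex lines\<close>

definition clinear_map :: "(complex^'m \<Rightarrow> complex^'k) \<Rightarrow> bool" where
  "clinear_map A \<longleftrightarrow> linear A \<and> (\<forall>c v. A (c *s v) = c *s A v)"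

lemma clinear_mapD:
  assumes "clinear_map A"
  shows "linear A" "A (c *s v) = c *s A v" "A (u + v) = A u + A v" "A (u - v) = A u - A v" "A 0 = 0"
    "bounded_linear A" "continuous_on S A"
  using assms linear_add linear_diff linear_0 linear_conv_bounded_linear linear_continuous_on
  unfolding clinear_map_def by blast+

lemma clinear_map_holomorphic: "clinear_map A \<Longrightarrow> holomorphic_map_on A U"
  by (rule holomorphic_map_onI[where H' = "\<lambda>z. A"])
    (auto simp: clinear_mapD intro!: bounded_linear_imp_has_derivative)

lemma linear_scale_vec: "linear (\<lambda>\<zeta>::complex. \<zeta> *s (v::complex^'m))"
  by (rule linearI) (auto simp: vec_eq_iff algebra_simps)

lemma bounded_linear_scale_vec: "bounded_linear (\<lambda>\<zeta>::complex. \<zeta> *s (v::complex^'m))"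
  using linear_scale_vec linear_conv_bounded_linear by blast

lemma has_derivative_scale_vec [derivative_intros]:
  assumes "(g has_derivative g') F"
  shows "((\<lambda>x. g x *s (v::complex^'m)) has_derivative (\<lambda>h. g' h *s v)) F"
  using bounded_linear.has_derivative[OF bounded_linear_scale_vec assms] .

lemma continuous_on_scale_vec [continuous_intros]:
  fixes v :: "complex^'m"
  assumes "continuous_on S g"
  shows "continuous_on S (\<lambda>x. g x *s v)"
  using bounded_linear.continuous_on[OF bounded_linear_scale_vec assms] .

lemma norm_scale_vec: "norm (\<zeta> *s (v::complex^'m)) = norm \<zeta> * norm v"
  by (simp add: norm_vec_def norm_mult L2_set_right_distrib)

lemma scaleR_eq_scale_vec: "t *\<^sub>R (v::complex^'m) = complex_of_real t *s v"
  by (subst vec_eq_iff) (auto simp: scaleR_conv_of_real[where 'a=complex])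

lemma holomorphic_fun_on_line_deriv:
  fixes f :: "complex^'m \<Rightarrow> complex"
  assumes f: "holomorphic_fun_on f U" and "a + \<zeta> *s v \<in> U"
  shows "((\<lambda>\<zeta>. f (a + \<zeta> *s v)) has_field_derivative frechet_derivative f (at (a + \<zeta> *s v)) v) (at \<zeta>)"
proof -
  have "((\<lambda>\<zeta>. f (a + \<zeta> *s v)) has_derivative (\<lambda>h. frechet_derivative f (at (a + \<zeta> *s v)) (h *s v))) (at \<zeta>)"
    by (rule has_derivative_compose[of "\<lambda>\<zeta>. a + \<zeta> *s v" "\<lambda>h. h *s v" \<zeta> UNIV f,
          OF _ holomorphic_fun_on_frechet(1)[OF assms]])
      (auto intro!: derivative_eq_intros)
  moreover have "(\<lambda>h. frechet_derivative f (at (a + \<zeta> *s v)) (h *s v)) = (*) (frechet_derivative f (at (a + \<zeta> *s v)) v)"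
    by (rule ext) (simp add: holomorphic_fun_on_frechet(2)[OF assms])
  ultimately show ?thesis
    by (simp add: has_field_derivative_def)
qed

lemma holomorphic_fun_on_line:
  fixes f :: "complex^'m \<Rightarrow> complex"
  assumes "holomorphic_fun_on f U" "\<And>\<zeta>. \<zeta> \<in> T \<Longrightarrow> a + \<zeta> *s v \<in> U"
  shows "(\<lambda>\<zeta>. f (a + \<zeta> *s v)) holomorphic_on T"
  unfolding holomorphic_on_def field_differentiable_def
  using holomorphic_fun_on_line_deriv[OF assms(1)] assms(2)
  by (metis DERIV_subset subset_UNIV)

lemma convex_line_preimage:
  fixes U :: "(complex^'m) set"
  assumes "convex U"
  shows "convex {\<zeta>::complex. a + \<zeta> *s v \<in> U}"
proof -
  have "convex ((\<lambda>\<zeta>::complex. \<zeta> *s v) -` ((\<lambda>x. x - a) ` U))"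
    by (intro convex_linear_vimage linear_scale_vec) (use assms in \<open>simp add: convex_translation_subtract\<close>)
  moreover have "(\<lambda>\<zeta>::complex. \<zeta> *s v) -` ((\<lambda>x. x - a) ` U) = {\<zeta>. a + \<zeta> *s v \<in> U}"
    by (auto simp: image_iff algebra_simps)
  ultimately show ?thesis by simp
qed

lemma open_line_preimage:
  fixes U :: "(complex^'m) set"
  assumes "open U"
  shows "open {\<zeta>::complex. a + \<zeta> *s v \<in> U}"
proof -
  have "open ((\<lambda>\<zeta>::complex. a + \<zeta> *s v) -` U)"
    by (intro open_vimage assms continuous_intros)
  then show ?thesis by (simp add: vimage_def)
qed

text \<open>The complex line through a point of \<open>V\<close> and \<open>z\<close> meets the
  convex set \<open>U\<close> in a connected plane set, where the one-variable identity theorem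
  applies.\<close>

lemma holomorphic_fun_identity:
  fixes f :: "complex^'m \<Rightarrow> complex"
  assumes f: "holomorphic_fun_on f U" and U: "open U" "convex U"
    and V: "open V" "V \<subseteq> U" "V \<noteq> {}" and 0: "\<And>z. z \<in> V \<Longrightarrow> f z = 0" and z: "z \<in> U"
  shows "f z = 0"
proof -
  obtain a where a: "a \<in> V" using V by auto
  let ?T = "{\<zeta>::complex. a + \<zeta> *s (z - a) \<in> U}"
  let ?T' = "{\<zeta>::complex. a + \<zeta> *s (z - a) \<in> V}"
  have "f (a + 1 *s (z - a)) = 0"
  proof (rule analytic_continuation_open[where s = ?T' and s' = ?T and f = "\<lambda>\<zeta>. f (a + \<zeta> *s (z - a))" and g = "\<lambda>_. 0"])
    show "open ?T'" "open ?T" using U V open_line_preimage by blast+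
    show "connected ?T" using convex_line_preimage[OF U(2)] convex_connected by blast
    show "?T' \<noteq> {}" using a by (auto intro!: exI[of _ 0])
    show "(\<lambda>\<zeta>. f (a + \<zeta> *s (z - a))) holomorphic_on ?T"
      by (rule holomorphic_fun_on_line[OF f]) auto
  qed (use V z 0 in auto)
  then show ?thesis by simp
qed

text \<open>The density of du / (2 pi i u^2) on the circle of radius \<open>r\<close> about 0 in the
  parameter \<open>t\<close>: the kernel of Cauchy's formula for a first derivative.\<close>

definition Cauchy_kernel :: "real \<Rightarrow> real \<Rightarrow> complex" where
  "Cauchy_kernel r t =
     2 * pi * \<i> * r * exp (2 * of_real pi * \<i> * t) / (2 * of_real pi * \<i> * (circlepath 0 r t)\<^sup>2)"

text \<open>Holomorphy only means complex differentiability at each point. An integral of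
  \<open>f\<close> itself in place of the derivative turns regularity of the derivative into a
  question about parameter integrals.\<close>

lemma Cauchy_directional_derivative:
  fixes f :: "complex^'m \<Rightarrow> complex"
  assumes f: "holomorphic_fun_on f U" and r: "r > 0" and sub: "\<And>\<zeta>. norm \<zeta> \<le> r \<Longrightarrow> z + \<zeta> *s v \<in> U"
  shows "frechet_derivative f (at z) v =
    integral {0..1} (\<lambda>t. f (z + circlepath 0 r t *s v) * Cauchy_kernel r t)"
proof -
  let ?g = "\<lambda>\<zeta>. f (z + \<zeta> *s v)"
  have hol: "?g holomorphic_on cball 0 r"
    by (rule holomorphic_fun_on_line[OF f]) (use sub in auto)
  have D: "(?g has_field_derivative (1 / (2 * of_real pi * \<i>) * contour_integral (circlepath 0 r) (\<lambda>u. ?g u / (u-0)^2))) (at 0)"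
    by (rule Cauchy_derivative_integral_circlepath)
      (use hol r in \<open>auto intro: holomorphic_on_imp_continuous_on holomorphic_on_subset\<close>)
  have "z + 0 *s v \<in> U" using sub[of 0] r by simp
  from holomorphic_fun_on_line_deriv[OF f this]
  have "frechet_derivative f (at z) v = 1 / (2 * of_real pi * \<i>) * contour_integral (circlepath 0 r) (\<lambda>u. ?g u / (u-0)^2)"
    using DERIV_unique[OF _ D] by simp
  also have "\<dots> = integral {0..1} (\<lambda>t. f (z + circlepath 0 r t *s v) * Cauchy_kernel r t)"
    unfolding contour_integral_integral integral_mult_right[symmetric] vector_derivative_circlepath
    by (intro integral_cong) (simp add: Cauchy_kernel_def field_simps)
  finally show ?thesis .
qed

lemma continuous_on_Cauchy_kernel:
  assumes "r > 0"
  shows "continuous_on {0..1} (Cauchy_kernel r)"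
proof -
  have "continuous_on {0..1} (circlepath 0 r)" using path_circlepath[of 0 r] by (simp add: path_def)
  moreover have "circlepath 0 r t \<noteq> 0" for t using assms by (auto simp: circlepath)
  ultimately show ?thesis unfolding Cauchy_kernel_def[abs_def] by (auto intro!: continuous_intros)
qed

lemma continuous_on_circlepath: "continuous_on S (circlepath c r)"
  unfolding circlepath by (auto intro!: continuous_intros)

lemma small_complex_discs:
  fixes z v :: "complex^'m"
  assumes "open U" "z \<in> U"
  obtains e r where "e > 0" "r > 0" "ball z e \<subseteq> U" "\<And>w \<zeta>. w \<in> ball z e \<Longrightarrow> norm \<zeta> \<le> r \<Longrightarrow> w + \<zeta> *s v \<in> U"
proof -
  obtain e where e: "e > 0" "ball z e \<subseteq> U" using assms open_contains_ball by blast
  \<comment> \<open>Adding 1 to \<open>norm v\<close> covers \<open>v = 0\<close>; a disc of this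
    radius moves a point by at most \<open>e / 2\<close>.\<close>
  let ?r = "e / (2 * (norm v + 1))"
  show ?thesis
  proof (rule that[of "e/2" ?r])
    show "e / 2 > 0" "?r > 0" using e by (auto intro!: divide_pos_pos add_nonneg_pos)
    show "ball z (e/2) \<subseteq> U" using e by auto
    fix w \<zeta> assume w: "w \<in> ball z (e/2)" and \<zeta>: "norm (\<zeta>::complex) \<le> ?r"
    have "norm (\<zeta> *s v) \<le> ?r * norm v"
      unfolding norm_scale_vec by (intro mult_right_mono \<zeta>) simp
    also have "\<dots> \<le> e/2"
    proof -
      have "norm v / (norm v + 1) \<le> 1" by (simp add: divide_le_eq_1 add_nonneg_pos)
      then have "e / 2 * (norm v / (norm v + 1)) \<le> e / 2 * 1" using e by (intro mult_left_mono) auto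
      then show ?thesis by (simp add: field_simps)
    qed
    finally have "norm (\<zeta> *s v) \<le> e/2" .
    moreover have "dist z (w + \<zeta> *s v) \<le> dist z w + norm (\<zeta> *s v)"
      using dist_triangle[of z "w + \<zeta> *s v" w] by (simp add: dist_norm)
    ultimately have "dist z (w + \<zeta> *s v) < e" using w by (simp add: algebra_simps)
    then show "w + \<zeta> *s v \<in> U" using e by auto
  qed
qed

text \<open>Continuity comes before holomorphy of the derivative: the latter rests on
  differentiation under the integral sign, which asks for a jointly continuous derivative of the
  integrand.\<close>

lemma holomorphic_fun_continuous_derivative:
  fixes f :: "complex^'m \<Rightarrow> complex"
  assumes f: "holomorphic_fun_on f U" and U: "open U"
  shows "continuous_on U (\<lambda>z. frechet_derivative f (at z) v)"
proof -
  have "isCont (\<lambda>z. frechet_derivative f (at z) v) z" if z: "z \<in> U" for z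
  proof -
    obtain e r where er: "e > 0" "r > 0" "ball z e \<subseteq> U" "\<And>w \<zeta>. w \<in> ball z e \<Longrightarrow> norm \<zeta> \<le> r \<Longrightarrow> w + \<zeta> *s v \<in> U"
      using small_complex_discs[OF U z] by metis
    define \<kappa> where "\<kappa> = Cauchy_kernel r"
    have eq: "frechet_derivative f (at w) v = integral (cbox 0 1) (\<lambda>t. f (w + circlepath 0 r t *s v) * \<kappa> t)"
      if "w \<in> ball z e" for w
      using Cauchy_directional_derivative[OF f er(2) er(4)[OF that]] by (simp add: \<kappa>_def)
    have "continuous_on (ball z e) (\<lambda>w. integral (cbox 0 1) (\<lambda>t. f (w + circlepath 0 r t *s v) * \<kappa> t))"
    proof (rule integral_continuous_on_param)
      have 1: "continuous_on (ball z e \<times> cbox 0 1) (\<lambda>x. f (fst x + circlepath 0 r (snd x) *s v))"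
      proof (rule continuous_on_compose2[OF holomorphic_fun_on_imp_continuous_on[OF f]])
        show "continuous_on (ball z e \<times> cbox 0 1) (\<lambda>x. fst x + circlepath 0 r (snd x) *s v)"
          by (intro continuous_intros continuous_on_compose2[OF continuous_on_circlepath[of UNIV]]) auto
        show "(\<lambda>x. fst x + circlepath 0 r (snd x) *s v) ` (ball z e \<times> cbox 0 1) \<subseteq> U"
          using er(4) \<open>r > 0\<close> by (auto simp: circlepath norm_mult)
      qed
      have 2: "continuous_on (ball z e \<times> cbox 0 1) (\<lambda>x. \<kappa> (snd x))"
        by (rule continuous_on_compose2[OF continuous_on_Cauchy_kernel[OF er(2), folded \<kappa>_def]])
          (auto intro!: continuous_intros)
      show "continuous_on (ball z e \<times> cbox 0 1) (\<lambda>(w, t). f (w + circlepath 0 r t *s v) * \<kappa> t)"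
        using continuous_on_mult[OF 1 2] by (simp add: case_prod_unfold)
    qed
    then have "continuous_on (ball z e) (\<lambda>z. frechet_derivative f (at z) v)"
      by (rule continuous_on_eq) (simp add: eq)
    then show ?thesis using er(1) by (simp add: continuous_on_eq_continuous_at)
  qed
  then show ?thesis by (simp add: continuous_at_imp_continuous_on)
qed

text \<open>Differentiation under the integral sign preserves complex-linearity. With
  \<open>A\<close> the identity this serves Cauchy's formula, with \<open>A\<close> a projection the
  sums over roots in a fibre.\<close>

lemma holomorphic_fun_on_integral:
  fixes G :: "complex^'k \<Rightarrow> complex" and A :: "complex^'m \<Rightarrow> complex^'k"
  assumes A: "clinear_map A" and G: "holomorphic_fun_on G \<Omega>" "open \<Omega>" and U: "open U"
    and sub: "\<And>x t. x \<in> U \<Longrightarrow> t \<in> {0..1} \<Longrightarrow> A x + \<gamma> t *s v \<in> \<Omega>"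
    and \<gamma>: "continuous_on {0..1} \<gamma>" and \<kappa>: "continuous_on {0..1} \<kappa>"
  shows "holomorphic_fun_on (\<lambda>x. integral {0..1::real} (\<lambda>t. G (A x + \<gamma> t *s v) * \<kappa> t)) U"
  unfolding holomorphic_fun_on_def
proof
  fix z assume z: "z \<in> U"
  obtain e where e: "e > 0" "ball z e \<subseteq> U" using U z open_contains_ball by blast
  let ?D = "\<lambda>x t u. frechet_derivative G (at (A x + \<gamma> t *s v)) (A u) * \<kappa> t"
  define fx where "fx x t = Blinfun (?D x t)" for x t
  have blin: "bounded_linear (?D x t)" if "x \<in> U" "t \<in> {0..1}" for x t
    by (intro bounded_linear_mult_const bounded_linear_compose[OF _ clinear_mapD(6)[OF A], of "frechet_derivative G (at (A x + \<gamma> t *s v))"]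
        has_derivative_bounded_linear[OF holomorphic_fun_on_frechet(1)[OF G(1)]] sub that)
  have app: "blinfun_apply (fx x t) u = ?D x t u" if "x \<in> U" "t \<in> {0..1}" for x t u
    unfolding fx_def using bounded_linear_Blinfun_apply[OF blin[OF that]] by simp
  have contAx: "continuous_on (U \<times> {0..1}) (\<lambda>x. A (fst x) + \<gamma> (snd x) *s v)"
    by (intro continuous_intros continuous_on_compose2[OF clinear_mapD(7)[OF A, of UNIV]] continuous_on_compose2[OF \<gamma>]) auto
  have cont\<kappa>: "continuous_on (U \<times> {0..1}) (\<lambda>x. \<kappa> (snd x))"
    by (intro continuous_intros continuous_on_compose2[OF \<kappa>]) auto
  have contD: "continuous_on (U \<times> {0..1}) (\<lambda>x. ?D (fst x) (snd x) u)" for u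
    by (intro continuous_intros cont\<kappa> continuous_on_compose2[OF holomorphic_fun_continuous_derivative[OF G] contAx]) (use sub in auto)
  \<comment> \<open>\<open>leibniz_rule\<close> wants continuity of the derivative as an operator;
    in finite dimension continuity on each fixed vector suffices.\<close>
  have contfx: "continuous_on (U \<times> {0..1}) (\<lambda>(x,t). fx x t)"
  proof (rule continuous_on_blinfun_componentwise)
    fix u :: "complex^'m"
    show "continuous_on (U \<times> {0..1}) (\<lambda>x. blinfun_apply (case x of (x, t) \<Rightarrow> fx x t) u)"
      by (rule continuous_on_eq[OF contD[of u]]) (auto simp: app)
  qed
  have der: "((\<lambda>x. integral (cbox 0 1) (\<lambda>t. G (A x + \<gamma> t *s v) * \<kappa> t)) has_derivative integral (cbox 0 1) (fx z)) (at z within ball z e)"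
  proof (rule leibniz_rule)
    fix x t assume x: "x \<in> ball z e" and t: "t \<in> cbox (0::real) 1"
    then have xt: "x \<in> U" "t \<in> {0..1}" using e by auto
    have "((\<lambda>x. A x + \<gamma> t *s v) has_derivative A) (at x)"
      by (auto intro!: derivative_eq_intros bounded_linear_imp_has_derivative clinear_mapD(6)[OF A])
    from has_derivative_compose[OF this holomorphic_fun_on_frechet(1)[OF G(1) sub[OF xt]]]
    have "((\<lambda>x. G (A x + \<gamma> t *s v) * \<kappa> t) has_derivative ?D x t) (at x)"
      by (intro has_derivative_mult_left)
    moreover have "?D x t = blinfun_apply (fx x t)" using app[OF xt] by auto
    ultimately show "((\<lambda>x. G (A x + \<gamma> t *s v) * \<kappa> t) has_derivative blinfun_apply (fx x t)) (at x within ball z e)"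
      using has_derivative_at_withinI by metis
  next
    fix x assume "x \<in> ball z e"
    then have x: "x \<in> U" using e by auto
    have "continuous_on {0..1} (\<lambda>t. G (A x + \<gamma> t *s v) * \<kappa> t)"
      by (intro continuous_intros \<kappa> \<gamma> continuous_on_compose2[OF holomorphic_fun_on_imp_continuous_on[OF G(1)]]) (use sub x in auto)
    then show "(\<lambda>t. G (A x + \<gamma> t *s v) * \<kappa> t) integrable_on cbox 0 1"
      by (simp add: integrable_continuous_real)
  next
    show "continuous_on (ball z e \<times> cbox 0 1) (\<lambda>(x, t). fx x t)"
      using continuous_on_subset[OF contfx, of "ball z e \<times> cbox 0 1"] e by auto
  qed (use e in auto)
  then have der': "((\<lambda>x. integral {0..1} (\<lambda>t. G (A x + \<gamma> t *s v) * \<kappa> t)) has_derivative integral {0..1} (fx z)) (at z)"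
    using e by (simp add: at_within_open[of z "ball z e"])
  have int: "fx z integrable_on {0..1}"
    using continuous_on_compose2[OF contfx continuous_on_Pair[OF continuous_on_const continuous_on_id], of z "{0..1}"] z
    by (intro integrable_continuous_real) auto
  have "blinfun_apply (integral {0..1} (fx z)) (c *s u) = c * blinfun_apply (integral {0..1} (fx z)) u" for c u
  proof -
    have "blinfun_apply (integral {0..1} (fx z)) (c *s u) = integral {0..1} (\<lambda>t. ?D z t (c *s u))"
      unfolding blinfun_apply_integral[OF int] by (intro integral_cong) (simp add: app[OF z])
    also have "\<dots> = integral {0..1} (\<lambda>t. c * ?D z t u)"
      by (intro integral_cong) (simp add: clinear_mapD(2)[OF A] holomorphic_fun_on_frechet(2)[OF G(1) sub[OF z]])
    also have "\<dots> = c * integral {0..1} (\<lambda>t. ?D z t u)" by simp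
    also have "integral {0..1} (\<lambda>t. ?D z t u) = blinfun_apply (integral {0..1} (fx z)) u"
      unfolding blinfun_apply_integral[OF int] by (intro integral_cong) (simp add: app[OF z])
    finally show ?thesis .
  qed
  then show "\<exists>f'. ((\<lambda>x. integral {0..1} (\<lambda>t. G (A x + \<gamma> t *s v) * \<kappa> t)) has_derivative f') (at z) \<and> (\<forall>c v. f' (c *s v) = c * f' v)"
    using der' by blast
qed

lemma holomorphic_fun_on_directional_derivative:
  fixes f :: "complex^'m \<Rightarrow> complex"
  assumes f: "holomorphic_fun_on f U" and U: "open U"
  shows "holomorphic_fun_on (\<lambda>z. frechet_derivative f (at z) v) U"
  unfolding holomorphic_fun_on_def
proof
  fix z assume z: "z \<in> U"
  obtain e r where er: "e > 0" "r > 0" "ball z e \<subseteq> U" "\<And>w \<zeta>. w \<in> ball z e \<Longrightarrow> norm \<zeta> \<le> r \<Longrightarrow> w + \<zeta> *s v \<in> U"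
    using small_complex_discs[OF U z] by metis
  define \<kappa> where "\<kappa> = Cauchy_kernel r"
  have "holomorphic_fun_on (\<lambda>w. integral {0..1} (\<lambda>t. f (w + circlepath 0 r t *s v) * \<kappa> t)) (ball z e)"
  proof (rule holomorphic_fun_on_integral[where A = "\<lambda>x. x", OF _ f U])
    show "clinear_map (\<lambda>x::complex^'m. x)" by (simp add: clinear_map_def linear_iff)
    show "x + circlepath 0 r t *s v \<in> U" if "x \<in> ball z e" for x t
      by (rule er(4)[OF that]) (use er(2) in \<open>simp add: circlepath norm_mult\<close>)
    show "continuous_on {0..1} \<kappa>" unfolding \<kappa>_def by (rule continuous_on_Cauchy_kernel[OF er(2)])
  qed (auto intro: continuous_on_circlepath)
  then have "holomorphic_fun_on (\<lambda>z. frechet_derivative f (at z) v) (ball z e)"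
    by (rule holomorphic_fun_on_cong)
      (use Cauchy_directional_derivative[OF f er(2) er(4)] in \<open>auto simp: \<kappa>_def\<close>)
  then show "\<exists>f'. ((\<lambda>z. frechet_derivative f (at z) v) has_derivative f') (at z) \<and> (\<forall>c v. f' (c *s v) = c * f' v)"
    unfolding holomorphic_fun_on_def using er(1) by auto
qed

section \<open>Real-analytic functions and uniqueness on hypersurfaces\<close>

text \<open>Unconditional convergence of a real series is absolute. Applied at the corner
  \<open>y\<close> of a cube, where every increment equals \<rho>, it yields one summable majorant
  for the whole cube.\<close>

lemma real_analytic_on_expansion:
  fixes f :: "'a::euclidean_space \<Rightarrow> real"
  assumes "real_analytic_on f U" "x \<in> U"
  obtains c :: "('a \<Rightarrow> nat) \<Rightarrow> real" and \<rho> where "\<rho> > 0"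
    and "(\<lambda>\<alpha>. \<bar>c \<alpha>\<bar> * (\<Prod>b\<in>Basis. \<rho> ^ \<alpha> b)) summable_on (Basis \<rightarrow>\<^sub>E UNIV)"
    and "\<And>y. (\<forall>b\<in>Basis. \<bar>(y - x) \<bullet> b\<bar> \<le> \<rho>) \<Longrightarrow>
      ((\<lambda>\<alpha>. c \<alpha> * (\<Prod>b\<in>Basis. ((y - x) \<bullet> b) ^ \<alpha> b)) has_sum f y) (Basis \<rightarrow>\<^sub>E UNIV)"
proof -
  obtain c r where r: "r > 0" and sum: "\<And>y. y \<in> ball x r \<Longrightarrow>
      ((\<lambda>\<alpha>. c \<alpha> * (\<Prod>b\<in>Basis. ((y - x) \<bullet> b) ^ \<alpha> b)) has_sum f y) (Basis \<rightarrow>\<^sub>E (UNIV :: nat set))"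
    using assms unfolding real_analytic_on_def by blast
  \<comment> \<open>The 1-norm dominates the Euclidean norm, so points of the cube are within
    \<open>DIM('a) * \<rho> = r / 2\<close> of its centre.\<close>
  define \<rho> where "\<rho> = r / (2 * DIM('a))"
  have \<rho>: "\<rho> > 0" using r by (simp add: \<rho>_def)
  have in_ball: "y \<in> ball x r" if "\<forall>b\<in>Basis. \<bar>(y - x) \<bullet> b\<bar> \<le> \<rho>" for y
  proof -
    have "norm (y - x) \<le> (\<Sum>b\<in>Basis. \<bar>(y - x) \<bullet> b\<bar>)" by (rule norm_le_l1)
    also have "\<dots> \<le> DIM('a) * \<rho>" using that sum_bounded_above[of Basis "\<lambda>b. \<bar>(y - x) \<bullet> b\<bar>" \<rho>] by auto
    also have "\<dots> < r" using r by (simp add: \<rho>_def)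
    finally show ?thesis by (simp add: dist_norm norm_minus_commute)
  qed
  define y where "y = x + (\<Sum>b\<in>Basis. \<rho> *\<^sub>R b)"
  have y: "(y - x) \<bullet> b = \<rho>" if "b \<in> Basis" for b
    using that by (simp add: y_def inner_sum_left_Basis)
  have yb: "y \<in> ball x r" by (rule in_ball) (simp add: y less_imp_le[OF \<rho>])
  have "(\<lambda>\<alpha>. c \<alpha> * (\<Prod>b\<in>Basis. ((y - x) \<bullet> b) ^ \<alpha> b)) summable_on (Basis \<rightarrow>\<^sub>E UNIV)"
    by (rule has_sum_imp_summable[OF sum[OF yb]])
  from iffD1[OF summable_on_iff_abs_summable_on_real this]
  have "(\<lambda>\<alpha>. \<bar>c \<alpha> * (\<Prod>b\<in>Basis. ((y - x) \<bullet> b) ^ \<alpha> b)\<bar>) summable_on (Basis \<rightarrow>\<^sub>E UNIV)"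
    by (simp only: real_norm_def)
  moreover have "\<bar>c \<alpha> * (\<Prod>b\<in>Basis. ((y - x) \<bullet> b) ^ \<alpha> b)\<bar> = \<bar>c \<alpha>\<bar> * (\<Prod>b\<in>(Basis::'a set). \<rho> ^ \<alpha> b)" for \<alpha> :: "'a \<Rightarrow> nat"
  proof -
    have "(\<Prod>b\<in>(Basis::'a set). ((y - x) \<bullet> b) ^ \<alpha> b) = (\<Prod>b\<in>(Basis::'a set). \<rho> ^ \<alpha> b)"
      by (rule prod.cong) (auto simp only: y)
    moreover have "(\<Prod>b\<in>(Basis::'a set). \<rho> ^ \<alpha> b) \<ge> 0" using \<rho> by (intro prod_nonneg) simp
    ultimately show ?thesis by (simp only: abs_mult abs_of_nonneg)
  qed
  ultimately have "(\<lambda>\<alpha>. \<bar>c \<alpha>\<bar> * (\<Prod>b\<in>Basis. \<rho> ^ \<alpha> b)) summable_on (Basis \<rightarrow>\<^sub>E UNIV)"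
    by (simp only:)
  moreover have "((\<lambda>\<alpha>. c \<alpha> * (\<Prod>b\<in>Basis. ((y - x) \<bullet> b) ^ \<alpha> b)) has_sum f y) (Basis \<rightarrow>\<^sub>E UNIV)"
    if "\<forall>b\<in>Basis. \<bar>(y - x) \<bullet> b\<bar> \<le> \<rho>" for y
    by (rule sum[OF in_ball[OF that]])
  ultimately show ?thesis by (rule that[of \<rho> c, OF \<rho>])
qed

lemma differentiable_prod_real:
  fixes f :: "'b \<Rightarrow> 'a::real_normed_vector \<Rightarrow> real"
  assumes "\<And>b. b \<in> B \<Longrightarrow> f b differentiable (at x within S)"
  shows "(\<lambda>x. \<Prod>b\<in>B. f b x) differentiable (at x within S)"
  using assms
proof (induction B rule: infinite_finite_induct)
  case (insert b B)
  then have "(\<lambda>x. f b x * (\<Prod>b\<in>B. f b x)) differentiable (at x within S)"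
    by (intro differentiable_mult) simp_all
  then show ?case by (simp only: prod.insert[OF insert(1,2)])
qed simp_all

text \<open>The finitely many terms of degree at most 1 form a polynomial \<open>P\<close>; all
  others have degree at least 2, so the majorant bounds the remainder by a multiple of the squared
  distance.\<close>

lemma real_analytic_on_differentiable:
  fixes f :: "'a::euclidean_space \<Rightarrow> real"
  assumes "real_analytic_on f U" "x \<in> U"
  shows "f differentiable (at x)"
proof -
  obtain c \<rho> where \<rho>: "\<rho> > 0"
    and sumc: "(\<lambda>\<alpha>. \<bar>c \<alpha>\<bar> * (\<Prod>b\<in>Basis. \<rho> ^ \<alpha> b)) summable_on ((Basis::'a set) \<rightarrow>\<^sub>E UNIV)"
    and exp: "\<And>y. (\<forall>b\<in>Basis. \<bar>(y - x) \<bullet> b\<bar> \<le> \<rho>) \<Longrightarrow>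
      ((\<lambda>\<alpha>. c \<alpha> * (\<Prod>b\<in>Basis. ((y - x) \<bullet> b) ^ \<alpha> b)) has_sum f y) (Basis \<rightarrow>\<^sub>E UNIV)"
    by (rule real_analytic_on_expansion[OF assms]) blast
  let ?I = "(Basis::'a set) \<rightarrow>\<^sub>E (UNIV::nat set)"
  define K where "K = (\<Sum>\<^sub>\<infinity>\<alpha>\<in>?I. \<bar>c \<alpha>\<bar> * (\<Prod>b\<in>Basis. \<rho> ^ \<alpha> b))"
  define deg where "deg \<alpha> = (\<Sum>b\<in>Basis. \<alpha> b)" for \<alpha> :: "'a \<Rightarrow> nat"
  define J where "J = {\<alpha> \<in> ?I. deg \<alpha> \<le> 1}"
  have "finite J"
  proof (rule finite_subset)
    show "J \<subseteq> Basis \<rightarrow>\<^sub>E {..1}"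
    proof
      fix \<alpha> assume "\<alpha> \<in> J"
      then have \<alpha>: "\<alpha> \<in> ?I" "deg \<alpha> \<le> 1" by (auto simp: J_def)
      have "\<alpha> b \<le> 1" if "b \<in> Basis" for b
        using member_le_sum[of b Basis \<alpha>] that \<alpha>(2) by (simp add: deg_def)
      then show "\<alpha> \<in> Basis \<rightarrow>\<^sub>E {..1}" using \<alpha>(1) by (auto simp: PiE_iff)
    qed
  qed (auto intro: finite_PiE)
  define T where "T h = (\<Sum>\<alpha>\<in>J. c \<alpha> * (\<Prod>b\<in>Basis. (h \<bullet> b) ^ \<alpha> b))" for h :: 'a
  define P where "P y = T (y - x)" for y
  have "P differentiable (at x)"
    unfolding P_def T_def
    by (intro differentiable_sum \<open>finite J\<close> differentiable_mult differentiable_const ballI differentiable_prod_real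
        differentiable_power differentiable_inner differentiable_diff differentiable_ident)
  have est: "\<bar>f y - P y\<bar> \<le> K / \<rho>\<^sup>2 * (norm (y - x))\<^sup>2" if y: "norm (y - x) \<le> \<rho>" for y
  proof -
    \<comment> \<open>Compared with its majorant on the cube, a term of degree k gains a factor
      \<open>?s ^ k\<close>, which is at most \<open>?s\<^sup>2\<close> as soon as k is at least
      2.\<close>
    let ?s = "norm (y - x) / \<rho>"
    have s: "0 \<le> ?s" "?s \<le> 1" using y \<rho> by auto
    have b: "\<bar>(y - x) \<bullet> b\<bar> \<le> norm (y - x)" if "b \<in> Basis" for b using that by (rule Basis_le_norm)
    have "((\<lambda>\<alpha>. c \<alpha> * (\<Prod>b\<in>Basis. ((y - x) \<bullet> b) ^ \<alpha> b)) has_sum (f y - P y)) (?I - J)"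
      unfolding P_def T_def
      by (intro has_sum_Diff exp has_sum_finite \<open>finite J\<close>) (use b y in \<open>auto simp: J_def intro: order_trans\<close>)
    moreover have "((\<lambda>\<alpha>. \<bar>c \<alpha>\<bar> * (\<Prod>b\<in>Basis. \<rho> ^ \<alpha> b) * ?s\<^sup>2) has_sum (K * ?s\<^sup>2)) ?I"
      unfolding K_def by (intro has_sum_cmult_left has_sum_infsum sumc)
    moreover have "norm (c \<alpha> * (\<Prod>b\<in>Basis. ((y - x) \<bullet> b) ^ \<alpha> b)) \<le> \<bar>c \<alpha>\<bar> * (\<Prod>b\<in>Basis. \<rho> ^ \<alpha> b) * ?s\<^sup>2"
      if "\<alpha> \<in> ?I - J" for \<alpha>
    proof -
      have deg: "deg \<alpha> \<ge> 2" using that by (auto simp: J_def)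
      have "\<bar>\<Prod>b\<in>Basis. ((y - x) \<bullet> b) ^ \<alpha> b\<bar> \<le> (\<Prod>b\<in>(Basis::'a set). norm (y - x) ^ \<alpha> b)"
        unfolding abs_prod power_abs by (intro prod_mono) (auto intro!: power_mono b)
      also have "\<dots> = (\<Prod>b\<in>(Basis::'a set). \<rho> ^ \<alpha> b * ?s ^ \<alpha> b)"
        using \<rho> by (simp add: power_mult_distrib[symmetric])
      also have "\<dots> = (\<Prod>b\<in>Basis. \<rho> ^ \<alpha> b) * ?s ^ deg \<alpha>"
        by (simp add: prod.distrib deg_def power_sum)
      also have "\<dots> \<le> (\<Prod>b\<in>Basis. \<rho> ^ \<alpha> b) * ?s\<^sup>2"
        using s deg \<rho> by (intro mult_left_mono power_decreasing prod_nonneg) auto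
      finally show ?thesis
        by (simp add: abs_mult mult_left_mono mult.assoc)
    qed
    ultimately have "norm (f y - P y) \<le> K * ?s\<^sup>2"
    proof -
      assume 1: "((\<lambda>\<alpha>. c \<alpha> * (\<Prod>b\<in>Basis. ((y - x) \<bullet> b) ^ \<alpha> b)) has_sum (f y - P y)) (?I - J)"
        and 2: "((\<lambda>\<alpha>. \<bar>c \<alpha>\<bar> * (\<Prod>b\<in>Basis. \<rho> ^ \<alpha> b) * ?s\<^sup>2) has_sum (K * ?s\<^sup>2)) ?I"
        and 3: "\<And>\<alpha>. \<alpha> \<in> ?I - J \<Longrightarrow> norm (c \<alpha> * (\<Prod>b\<in>Basis. ((y - x) \<bullet> b) ^ \<alpha> b)) \<le> \<bar>c \<alpha>\<bar> * (\<Prod>b\<in>Basis. \<rho> ^ \<alpha> b) * ?s\<^sup>2"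
      let ?m = "\<lambda>\<alpha>. \<bar>c \<alpha>\<bar> * (\<Prod>b\<in>Basis. \<rho> ^ \<alpha> b) * ?s\<^sup>2"
      have sm: "?m summable_on (?I - J)"
        by (rule summable_on_subset_banach[OF has_sum_imp_summable[OF 2]]) auto
      have up: "f y - P y \<le> infsum ?m (?I - J)"
        by (rule has_sum_mono[OF 1 has_sum_infsum[OF sm]]) (use 3 in fastforce)
      have minus1: "((\<lambda>\<alpha>. - (c \<alpha> * (\<Prod>b\<in>Basis. ((y - x) \<bullet> b) ^ \<alpha> b))) has_sum - (f y - P y)) (?I - J)"
        unfolding has_sum_uminus using 1 by simp
      have lo: "- (f y - P y) \<le> infsum ?m (?I - J)"
        by (rule has_sum_mono[OF minus1 has_sum_infsum[OF sm]]) (use 3 in fastforce)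
      have "norm (f y - P y) \<le> infsum ?m (?I - J)" using up lo by simp
      also have "\<dots> \<le> infsum ?m ?I"
        by (rule infsum_mono_neutral[OF sm has_sum_imp_summable[OF 2]])
          (use \<rho> in \<open>auto intro!: mult_nonneg_nonneg prod_nonneg\<close>)
      also have "\<dots> = K * ?s\<^sup>2" using 2 by (rule infsumI)
      finally show ?thesis .
    qed
    then show ?thesis by (simp add: power_divide)
  qed
  have "((\<lambda>y. f y - P y) has_derivative (\<lambda>h. 0)) (at x)"
    unfolding has_derivative_at_alt
  proof (intro conjI allI impI)
    show "bounded_linear (\<lambda>h::'a. 0::real)" by simp
    have fP: "f x = P x" using est[of x] \<rho> by simp
    have K: "K \<ge> 0" unfolding K_def using \<rho> by (intro infsum_nonneg mult_nonneg_nonneg prod_nonneg) auto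
    fix e :: real assume e: "e > 0"
    \<comment> \<open>\<open>K + 1\<close> instead of \<open>K\<close> excludes a zero denominator;
      below this distance the quadratic bound is at most \<open>e * norm (y - x)\<close>.\<close>
    define d where "d = min \<rho> (e * \<rho>\<^sup>2 / (K + 1))"
    have d: "d > 0" using \<rho> e K by (simp add: d_def)
    show "\<exists>d>0. \<forall>y. norm (y - x) < d \<longrightarrow> norm (f y - P y - (f x - P x) - 0) \<le> e * norm (y - x)"
    proof (intro exI[of _ d] conjI allI impI d)
      fix y assume y: "norm (y - x) < d"
      have "\<bar>f y - P y\<bar> \<le> K / \<rho>\<^sup>2 * (norm (y - x))\<^sup>2" using y by (intro est) (simp add: d_def)
      also have "\<dots> = (K / \<rho>\<^sup>2 * norm (y - x)) * norm (y - x)" by (simp add: power2_eq_square)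
      also have "\<dots> \<le> e * norm (y - x)"
      proof (rule mult_right_mono)
        have "K / \<rho>\<^sup>2 * norm (y - x) \<le> (K + 1) / \<rho>\<^sup>2 * (e * \<rho>\<^sup>2 / (K + 1))"
          using y K \<rho> by (intro mult_mono divide_right_mono) (auto simp: d_def)
        also have "\<dots> = e" using K \<rho> by simp
        finally show "K / \<rho>\<^sup>2 * norm (y - x) \<le> e" .
      qed simp
      finally show "norm (f y - P y - (f x - P x) - 0) \<le> e * norm (y - x)" using fP by simp
    qed
  qed
  then have "(\<lambda>y. f y - P y) differentiable (at x)" unfolding differentiable_def by blast
  from differentiable_add[OF this \<open>P differentiable (at x)\<close>] show ?thesis by simp
qed

lemma real_analytic_on_continuous_on: "real_analytic_on f U \<Longrightarrow> continuous_on U f"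
  by (intro continuous_at_imp_continuous_on ballI differentiable_imp_continuous_within real_analytic_on_differentiable)

text \<open>For real \<open>t\<close> the real-linear coordinate \<open>(H (a + t w) - H a) \<bullet> b\<close> is the restriction of the
  holomorphic function \<open>(g \<zeta> + cnj (g (cnj \<zeta>))) / 2\<close>, where \<open>g\<close> is the Hermitian product with \<open>b\<close>;
  substituting these extensions into the power series extends \<open>\<rho> \<circ> H\<close> holomorphically.\<close>

lemma real_analytic_compose_extension:
  fixes H :: "complex^'m \<Rightarrow> complex^'k" and \<rho> :: "complex^'k \<Rightarrow> real"
  assumes \<rho>: "real_analytic_on \<rho> U" and H: "holomorphic_map_on H B" "open B" and a: "a \<in> B" "H a \<in> U"
  obtains \<eta> F where "\<eta> > 0" "F holomorphic_on ball 0 \<eta>"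
    "\<And>t::real. \<bar>t\<bar> < \<eta> \<Longrightarrow> F (of_real t) = of_real (\<rho> (H (a + of_real t *s w)))"
proof -
  obtain c s where s: "s > 0"
    and sumc: "(\<lambda>\<alpha>. \<bar>c \<alpha>\<bar> * (\<Prod>b\<in>Basis. s ^ \<alpha> b)) summable_on ((Basis::(complex^'k) set) \<rightarrow>\<^sub>E UNIV)"
    and exp: "\<And>y. (\<forall>b\<in>Basis. \<bar>(y - H a) \<bullet> b\<bar> \<le> s) \<Longrightarrow>
      ((\<lambda>\<alpha>. c \<alpha> * (\<Prod>b\<in>Basis. ((y - H a) \<bullet> b) ^ \<alpha> b)) has_sum \<rho> y) (Basis \<rightarrow>\<^sub>E UNIV)"
    by (rule real_analytic_on_expansion[OF \<rho> a(2)]) blast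
  let ?I = "(Basis::(complex^'k) set) \<rightarrow>\<^sub>E (UNIV::nat set)"
  have "open {\<zeta>::complex. a + \<zeta> *s w \<in> B}" by (rule open_line_preimage[OF H(2)])
  moreover have "0 \<in> {\<zeta>::complex. a + \<zeta> *s w \<in> B}" using a by simp
  ultimately obtain \<eta>1 where \<eta>1: "\<eta>1 > 0" "ball 0 \<eta>1 \<subseteq> {\<zeta>::complex. a + \<zeta> *s w \<in> B}"
    using open_contains_ball by blast
  define g where "g b \<zeta> = (\<Sum>k\<in>UNIV. (H (a + \<zeta> *s w) $ k - H a $ k) * cnj (b $ k))" for b :: "complex^'k" and \<zeta> :: complex
  define u where "u b \<zeta> = (g b \<zeta> + (cnj \<circ> g b \<circ> cnj) \<zeta>) / 2" for b \<zeta>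
  have holg: "g b holomorphic_on ball 0 \<eta>1" for b
    unfolding g_def
    by (intro holomorphic_intros holomorphic_fun_on_line[where U = B])
      (use H \<eta>1 in \<open>auto simp: holomorphic_map_on_def\<close>)
  have cnj_ball: "cnj ` ball 0 \<eta>1 = ball 0 \<eta>1"
    by (auto simp: image_iff intro!: bexI[of _ "cnj x" for x])
  have holu: "u b holomorphic_on ball 0 \<eta>1" for b
    unfolding u_def by (intro holomorphic_intros holg holomorphic_on_compose_cnj_cnj) (simp_all add: cnj_ball holg)
  have u0: "u b 0 = 0" for b by (simp add: u_def g_def)
  have ureal: "u b (of_real t) = of_real ((H (a + of_real t *s w) - H a) \<bullet> b)" for b and t :: real
  proof (rule complex_eqI)
    show "Re (u b (of_real t)) = Re (of_real ((H (a + of_real t *s w) - H a) \<bullet> b))"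
      by (simp add: u_def g_def inner_vec_def inner_complex_def) (rule sum.cong, simp_all add: algebra_simps)
    show "Im (u b (of_real t)) = Im (of_real ((H (a + of_real t *s w) - H a) \<bullet> b))"
      by (simp add: u_def g_def inner_vec_def inner_complex_def sum.distrib[symmetric]) (simp add: algebra_simps)
  qed
  have "\<forall>b\<in>(Basis::(complex^'k) set). \<forall>\<^sub>F \<zeta> in nhds 0. norm (u b \<zeta>) < s"
  proof
    fix b :: "complex^'k"
    have "isCont (u b) 0" using holomorphic_on_imp_continuous_on[OF holu[of b]] \<eta>1(1)
      by (simp add: continuous_on_eq_continuous_at)
    then have "(u b \<longlongrightarrow> u b 0) (nhds 0)" by (simp add: isCont_def tendsto_at_iff_tendsto_nhds)
    then have "((\<lambda>\<zeta>. norm (u b \<zeta>)) \<longlongrightarrow> 0) (nhds 0)" using tendsto_norm_zero u0 by metis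
    then show "\<forall>\<^sub>F \<zeta> in nhds 0. norm (u b \<zeta>) < s" using s by (rule order_tendstoD(2))
  qed
  then have "\<forall>\<^sub>F \<zeta> in nhds 0. \<forall>b\<in>(Basis::(complex^'k) set). norm (u b \<zeta>) < s"
    by (intro eventually_ball_finite) auto
  then obtain \<eta>2 where \<eta>2: "\<eta>2 > 0" "\<And>\<zeta> b. dist \<zeta> 0 < \<eta>2 \<Longrightarrow> b \<in> (Basis::(complex^'k) set) \<Longrightarrow> norm (u b \<zeta>) < s"
    unfolding eventually_nhds_metric by blast
  \<comment> \<open>Halving puts the closed disc of radius \<eta> inside both neighbourhoods; the
    uniform limit is taken on a closed disc.\<close>
  define \<eta> where "\<eta> = min \<eta>1 \<eta>2 / 2"
  have \<eta>: "\<eta> > 0" "\<eta> < \<eta>1" "\<eta> < \<eta>2" using \<eta>1 \<eta>2 by (auto simp: \<eta>_def)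
  define t where "t \<alpha> \<zeta> = complex_of_real (c \<alpha>) * (\<Prod>b\<in>Basis. u b \<zeta> ^ \<alpha> b)" for \<alpha> \<zeta>
  have bound: "norm (t \<alpha> \<zeta>) \<le> \<bar>c \<alpha>\<bar> * (\<Prod>b\<in>Basis. s ^ \<alpha> b)" if "\<zeta> \<in> cball 0 \<eta>" for \<alpha> \<zeta>
  proof -
    have "norm (u b \<zeta>) \<le> s" if "b \<in> Basis" for b
      using \<eta>2(2)[of \<zeta> b] \<open>\<zeta> \<in> cball 0 \<eta>\<close> \<eta> that by simp
    then have "(\<Prod>b\<in>Basis. norm (u b \<zeta>) ^ \<alpha> b) \<le> (\<Prod>b\<in>Basis. s ^ \<alpha> b)"
      by (intro prod_mono) (auto intro: power_mono)
    then show ?thesis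
      unfolding t_def norm_mult norm_of_real prod_norm[symmetric] norm_power by (intro mult_left_mono) auto
  qed
  define F where "F \<zeta> = (\<Sum>\<^sub>\<infinity>\<alpha>\<in>?I. t \<alpha> \<zeta>)" for \<zeta>
  have ul: "uniform_limit (cball 0 \<eta>) (\<lambda>X \<zeta>. \<Sum>\<alpha>\<in>X. t \<alpha> \<zeta>) F (finite_subsets_at_top ?I)"
    unfolding F_def by (rule Weierstrass_m_test_general[OF bound sumc])
  have holt: "t \<alpha> holomorphic_on ball 0 \<eta>1" for \<alpha>
    unfolding t_def by (intro holomorphic_intros holu)
  have holS: "(\<lambda>\<zeta>. \<Sum>\<alpha>\<in>X. t \<alpha> \<zeta>) holomorphic_on ball 0 \<eta>1" for X
    by (intro holomorphic_intros holt)
  have sub: "cball 0 \<eta> \<subseteq> ball 0 \<eta>1" "ball 0 \<eta> \<subseteq> ball 0 \<eta>1" using \<eta> by auto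
  have "F holomorphic_on ball 0 \<eta>"
  proof (rule holomorphic_uniform_limit[OF _ ul])
    show "\<forall>\<^sub>F X in finite_subsets_at_top ?I. continuous_on (cball 0 \<eta>) (\<lambda>\<zeta>. \<Sum>\<alpha>\<in>X. t \<alpha> \<zeta>) \<and>
        (\<lambda>\<zeta>. \<Sum>\<alpha>\<in>X. t \<alpha> \<zeta>) holomorphic_on ball 0 \<eta>"
      by (intro always_eventually allI conjI holomorphic_on_imp_continuous_on
          holomorphic_on_subset[OF holS sub(1)] holomorphic_on_subset[OF holS sub(2)])
  qed auto
  moreover have "F (of_real x) = of_real (\<rho> (H (a + of_real x *s w)))" if x: "\<bar>x\<bar> < \<eta>" for x :: real
  proof -
    have "\<forall>b\<in>Basis. \<bar>(H (a + of_real x *s w) - H a) \<bullet> b\<bar> \<le> s"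
    proof
      fix b :: "complex^'k" assume "b \<in> Basis"
      then have "norm (u b (of_real x)) < s" using \<eta>2(2)[of "of_real x" b] x \<eta> by simp
      then show "\<bar>(H (a + of_real x *s w) - H a) \<bullet> b\<bar> \<le> s" unfolding ureal norm_of_real by simp
    qed
    from exp[OF this]
    have "((\<lambda>\<alpha>. complex_of_real (c \<alpha> * (\<Prod>b\<in>Basis. ((H (a + of_real x *s w) - H a) \<bullet> b) ^ \<alpha> b)))
        has_sum complex_of_real (\<rho> (H (a + of_real x *s w)))) ?I"
      by (rule has_sum_of_real)
    then have "((\<lambda>\<alpha>. t \<alpha> (of_real x)) has_sum complex_of_real (\<rho> (H (a + of_real x *s w)))) ?I"
      by (simp add: t_def ureal)
    then show ?thesis unfolding F_def by (rule infsumI)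
  qed
  ultimately show ?thesis using that \<eta>(1) by blast
qed

text \<open>On the real segment from a point of \<open>V\<close> to \<open>z\<close>, the interior
  \<open>Z\<close> of the zero set of \<phi> is open, and relatively closed because local
  holomorphic extensions propagate zeros. Connectedness carries it to the end point.\<close>

lemma real_analytic_compose_identity:
  fixes H :: "complex^'m \<Rightarrow> complex^'k" and \<rho> :: "complex^'k \<Rightarrow> real"
  assumes \<rho>: "real_analytic_on \<rho> U" and H: "holomorphic_map_on H B" and B: "open B" "convex B" "H ` B \<subseteq> U"
    and V: "open V" "V \<subseteq> B" "V \<noteq> {}" "\<And>z. z \<in> V \<Longrightarrow> \<rho> (H z) = 0" and z: "z \<in> B"
  shows "\<rho> (H z) = 0"
proof -
  obtain a where a: "a \<in> V" using V by auto
  define w where "w = z - a"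
  define \<phi> where "\<phi> t = \<rho> (H (a + of_real t *s w))" for t :: real
  define L where "L = {t::real. a + of_real t *s w \<in> B}"
  have L_eq: "L = of_real -` {\<zeta>::complex. a + \<zeta> *s w \<in> B}" by (auto simp: L_def)
  have "convex L" unfolding L_eq
    by (intro convex_linear_vimage convex_line_preimage B bounded_linear.linear bounded_linear_of_real)
  then have conL: "connected L" by (rule convex_connected)
  have L01: "0 \<in> L" "1 \<in> L" using a V z by (auto simp: L_def w_def)
  define Z where "Z = interior {t. \<phi> t = 0}"
  have openZ: "open Z" by (simp add: Z_def)
  have "0 \<in> Z"
  proof -
    have "open (of_real -` {\<zeta>::complex. a + \<zeta> *s w \<in> V} :: real set)"
      by (intro open_vimage open_line_preimage V continuous_intros)
    moreover have "of_real -` {\<zeta>::complex. a + \<zeta> *s w \<in> V} \<subseteq> {t. \<phi> t = 0}"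
      using V(4) by (auto simp: \<phi>_def)
    ultimately have "of_real -` {\<zeta>::complex. a + \<zeta> *s w \<in> V} \<subseteq> Z"
      unfolding Z_def by (intro interior_maximal)
    then show ?thesis using a by auto
  qed
  \<comment> \<open>The radius belongs to \<open>t0\<close>, not to \<open>t1\<close>: an extension
    centred at \<open>t0\<close> that vanishes on a real interval around \<open>t1\<close> vanishes
    on its whole disc, hence also near \<open>t0\<close>.\<close>
  have key: "\<exists>\<eta>>0. \<forall>t1\<in>Z. \<bar>t1 - t0\<bar> < \<eta> \<longrightarrow> t0 \<in> Z" if t0: "t0 \<in> L" for t0
  proof -
    have "a + of_real t0 *s w \<in> B" using t0 by (simp add: L_def)
    then obtain \<eta> F where \<eta>: "\<eta> > 0" and F: "F holomorphic_on ball 0 \<eta>"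
      and eq: "\<And>t::real. \<bar>t\<bar> < \<eta> \<Longrightarrow> F (of_real t) = of_real (\<rho> (H (a + of_real t0 *s w + of_real t *s w)))"
      using real_analytic_compose_extension[OF \<rho> H B(1), of "a + of_real t0 *s w" w] B(3) by blast
    have eq': "F (of_real t) = of_real (\<phi> (t0 + t))" if "\<bar>t\<bar> < \<eta>" for t
      using eq[OF that] by (simp add: \<phi>_def vector_sadd_rdistrib add.assoc)
    have "t0 \<in> Z" if t1: "t1 \<in> Z" "\<bar>t1 - t0\<bar> < \<eta>" for t1
    proof -
      obtain e where e: "e > 0" "\<And>t. dist t t1 < e \<Longrightarrow> \<phi> t = 0"
        using t1(1) unfolding Z_def mem_interior subset_iff mem_ball mem_Collect_eq by (metis dist_commute)
      define e' where "e' = min e (\<eta> - \<bar>t1 - t0\<bar>)"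
      have e': "e' > 0" using e t1 by (simp add: e'_def)
      let ?S = "complex_of_real ` {t. dist t (t1 - t0) < e'}"
      have F0: "F \<zeta> = 0" if "\<zeta> \<in> ball 0 \<eta>" for \<zeta>
      proof (rule analytic_continuation[OF F, where U = ?S and \<xi> = "of_real (t1 - t0)"])
        show "?S \<subseteq> ball 0 \<eta>" by (auto simp: e'_def dist_real_def)
        show "complex_of_real (t1 - t0) \<in> ball 0 \<eta>" using t1 by (simp del: of_real_diff)
        show "complex_of_real (t1 - t0) islimpt ?S"
          unfolding islimpt_approachable
        proof (intro allI impI)
          fix d :: real assume d: "d > 0"
          let ?x = "t1 - t0 + min d e' / 2"
          have "dist (complex_of_real ?x) (of_real (t1 - t0)) = min d e' / 2"
            using d e' unfolding dist_of_real by (simp add: dist_real_def)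
          moreover have "of_real ?x \<in> ?S" using d e' by (intro imageI) (simp add: dist_real_def)
          ultimately show "\<exists>x'\<in>?S. x' \<noteq> complex_of_real (t1 - t0) \<and> dist x' (complex_of_real (t1 - t0)) < d"
            using d e' by (intro bexI[of _ "of_real ?x"]) (auto simp del: of_real_add of_real_diff)
        qed
        fix \<xi> assume "\<xi> \<in> ?S"
        then obtain t where t: "\<xi> = of_real t" "dist t (t1 - t0) < e'" by auto
        have "\<bar>t\<bar> < \<eta>" using t(2) by (auto simp: e'_def dist_real_def)
        moreover have "dist (t0 + t) t1 < e" using t(2) by (auto simp: e'_def dist_real_def)
        ultimately show "F \<xi> = 0" using eq'[of t] e(2)[of "t0 + t"] t by simp
      qed (use that in auto)
      show ?thesis unfolding Z_def mem_interior subset_iff mem_ball mem_Collect_eq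
      proof (intro exI[of _ \<eta>] conjI allI impI \<eta>)
        fix t assume "dist t0 t < \<eta>"
        then have "\<bar>t - t0\<bar> < \<eta>" by (simp add: dist_real_def)
        then show "\<phi> t = 0" using eq'[of "t - t0"] F0[of "of_real (t - t0)"] by (simp del: of_real_diff)
      qed
    qed
    then show ?thesis using \<eta> by blast
  qed
  have "1 \<in> Z"
  proof (rule ccontr)
    assume "1 \<notin> Z"
    \<comment> \<open>By \<open>key\<close>, every point of \<open>L\<close> outside
      \<open>Z\<close> has a neighbourhood free of \<open>Z\<close>, so \<open>1 \<notin> Z\<close>
      would disconnect \<open>L\<close>.\<close>
    define W where "W = {t. \<exists>e>0. \<forall>t1. \<bar>t1 - t\<bar> < e \<longrightarrow> t1 \<notin> Z}"
    have "open W" unfolding open_dist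
    proof
      fix t assume "t \<in> W"
      then obtain e where e: "e > 0" "\<And>t1. \<bar>t1 - t\<bar> < e \<Longrightarrow> t1 \<notin> Z" by (auto simp: W_def)
      show "\<exists>e>0. \<forall>y. dist y t < e \<longrightarrow> y \<in> W"
      proof (intro exI[of _ "e/2"] conjI allI impI)
        fix y assume y: "dist y t < e / 2"
        have "t1 \<notin> Z" if "\<bar>t1 - y\<bar> < e / 2" for t1
          by (rule e(2)) (use that y in \<open>unfold dist_real_def, linarith\<close>)
        then show "y \<in> W" unfolding W_def using e(1) by (auto intro!: exI[of _ "e/2"])
      qed (use e in auto)
    qed
    moreover have "t \<in> Z \<or> t \<in> W" if "t \<in> L" for t using key[OF that] by (auto simp: W_def)
    moreover have "Z \<inter> W = {}" by (force simp: W_def)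
    ultimately show False
      using connectedD[OF conL openZ \<open>open W\<close>] L01 \<open>0 \<in> Z\<close> \<open>1 \<notin> Z\<close> by blast
  qed
  then have "\<phi> 1 = 0" unfolding Z_def using interior_subset by blast
  then show ?thesis by (simp add: \<phi>_def w_def)
qed

lemma real_analytic_defining_hypersurfaceD:
  assumes "real_analytic_defining 1 \<rho> U M"
  shows "open U" "M \<inter> U = {x\<in>U. \<rho> 0 x = 0}" "real_analytic_on (\<rho> 0) U"
    and "x \<in> U \<Longrightarrow> (\<rho> 0 has_derivative frechet_derivative (\<rho> 0) (at x)) (at x)"
    and "x \<in> U \<Longrightarrow> \<exists>v. frechet_derivative (\<rho> 0) (at x) v \<noteq> 0"
    and "continuous_on U (\<rho> 0)"
proof -
  show 1: "open U" "M \<inter> U = {x\<in>U. \<rho> 0 x = 0}" "real_analytic_on (\<rho> 0) U"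
    using assms unfolding real_analytic_defining_def by auto
  show "(\<rho> 0 has_derivative frechet_derivative (\<rho> 0) (at x)) (at x)" if "x \<in> U"
    using real_analytic_on_differentiable[OF 1(3) that] frechet_derivative_works by blast
  show "continuous_on U (\<rho> 0)" by (rule real_analytic_on_continuous_on[OF 1(3)])
  show "\<exists>v. frechet_derivative (\<rho> 0) (at x) v \<noteq> 0" if "x \<in> U"
  proof (rule ccontr)
    assume "\<not> ?thesis"
    moreover have "\<forall>c::nat \<Rightarrow> real.
        (\<forall>v. (\<Sum>i<1. c i * frechet_derivative (\<rho> i) (at x) v) = 0) \<longrightarrow> (\<forall>i<1. c i = 0)"
      using assms that unfolding real_analytic_defining_def by blast
    from this[rule_format, of "\<lambda>_. 1" 0] calculation show False by simp
  qed
qed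

lemma IVT_sign_change:
  fixes f :: "real \<Rightarrow> real"
  assumes "a \<le> b" "continuous_on {a..b} f" "f a * f b < 0"
  obtains x where "a \<le> x" "x \<le> b" "f x = 0"
proof (cases "f a < 0")
  case True
  then have "f b > 0" using assms(3) by (simp add: mult_less_0_iff)
  then show ?thesis using IVT'[of f a 0 b] assms True that by auto
next
  case False
  then have "f a > 0" "f b < 0" using assms(3) by (auto simp: mult_less_0_iff)
  then show ?thesis using IVT2'[of f b 0 a] assms that by auto
qed

text \<open>A complex line through \<open>p\<close> that is transverse to \<open>M\<close> meets \<open>M\<close> in a real curve, on which
  a holomorphic function of one variable cannot vanish without vanishing identically; and the
  transverse lines fill an open set.\<close>

lemma hypersurface_uniqueness:
  fixes M :: "(complex^'m) set"
  assumes M: "real_analytic_hypersurface M" "p \<in> M" and r: "r > 0"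
    and g: "holomorphic_fun_on g (ball p r)" "\<And>z. z \<in> M \<Longrightarrow> z \<in> ball p r \<Longrightarrow> g z = 0"
    and z: "z \<in> ball p r"
  shows "g z = 0"
proof -
  obtain U \<rho> where pU: "p \<in> U" and def: "real_analytic_defining 1 \<rho> U M"
    using M unfolding real_analytic_submanifold_def by blast
  note D = real_analytic_defining_hypersurfaceD[OF def]
  let ?D = "frechet_derivative (\<rho> 0) (at p)"
  have lin: "linear ?D" using D(4)[OF pU] has_derivative_linear by blast
  have \<rho>p: "\<rho> 0 p = 0" using D(2) pU M(2) by blast
  have line: "g (p + v) = 0" if v: "norm v < r" "?D v \<noteq> 0" for v
  proof -
    let ?T = "{\<zeta>. p + \<zeta> *s v \<in> ball p r}"
    let ?T' = "{\<zeta>. p + \<zeta> *s v \<in> ball p r \<inter> U}"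
    have "open ?T'" using D(1) by (intro open_line_preimage) auto
    moreover have "0 \<in> ?T'" using pU r by simp
    ultimately obtain e0 where e0: "e0 > 0" "ball 0 e0 \<subseteq> ?T'" using open_contains_ball by blast
    define A where "A = ?D v"
    define B where "B = ?D (\<i> *s v)"
    \<comment> \<open>Large enough for the linear part \<open>s * A + \<tau> * B\<close> to have
      opposite signs and modulus at least \<tau> at the two ends \<open>s = C * \<tau>\<close> and
      \<open>s = - (C * \<tau>)\<close>.\<close>
    define C where "C = (\<bar>B\<bar> + 1) / \<bar>A\<bar>"
    have A: "A \<noteq> 0" using v by (simp add: A_def)
    have C: "C > 0" unfolding C_def using A by (intro divide_pos_pos) auto
    define \<psi> where "\<psi> \<zeta> = \<rho> 0 (p + \<zeta> *s v)" for \<zeta>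
    have "((\<lambda>\<zeta>. p + \<zeta> *s v) has_derivative (\<lambda>h. h *s v)) (at 0)"
      by (auto intro!: derivative_eq_intros)
    from has_derivative_compose[OF this, of "\<rho> 0" ?D] D(4)[OF pU]
    have "(\<psi> has_derivative (\<lambda>h. ?D (h *s v))) (at 0)" by (simp add: \<psi>_def[abs_def])
    \<comment> \<open>Points \<open>Complex s \<tau>\<close> with
      \<open>\<bar>s\<bar> \<le> C * \<tau>\<close> have norm at most
      \<open>(C + 1) * \<tau>\<close>, so this tolerance leaves an error of at most
      \<open>\<tau> / 2\<close>, too small to change the signs.\<close>
    then obtain \<delta> where \<delta>: "\<delta> > 0" "\<And>h. norm h < \<delta> \<Longrightarrow> \<bar>\<psi> h - ?D (h *s v)\<bar> \<le> 1 / (2 * (C + 1)) * norm h"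
      unfolding has_derivative_at_alt using C \<rho>p
      by (auto simp: \<psi>_def dest!: spec[of _ "1 / (2 * (C + 1))"])
    have Dlin: "?D (Complex s \<tau> *s v) = s * A + \<tau> * B" for s \<tau>
    proof -
      have "Complex s \<tau> *s v = s *\<^sub>R v + \<tau> *\<^sub>R (\<i> *s v)"
        unfolding scaleR_eq_scale_vec by (simp add: vec_eq_iff complex_eq_iff)
      then show ?thesis using lin by (simp add: linear_add linear_scale A_def B_def)
    qed
    \<comment> \<open>The zero is sought with fixed imaginary part \<tau> > 0, which keeps it away
      from the trivial zero at 0; the intermediate value theorem supplies its real part.\<close>
    have zero: "\<exists>\<zeta>. \<zeta> \<noteq> 0 \<and> norm \<zeta> < e \<and> g (p + \<zeta> *s v) = 0" if e: "e > 0" for e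
    proof -
      define \<tau> where "\<tau> = min (min \<delta> e0) e / 2 / (C + 1)"
      have \<tau>: "\<tau> > 0" using \<delta> e0 e C by (simp add: \<tau>_def)
      have small: "(C + 1) * \<tau> < min (min \<delta> e0) e"
      proof -
        have "(C + 1) * (y / (C + 1)) = y" for y using C by simp
        then have "(C + 1) * \<tau> = min (min \<delta> e0) e / 2" unfolding \<tau>_def .
        then show ?thesis using \<delta> e0 e by linarith
      qed
      have nrm: "norm (Complex s \<tau>) \<le> (C + 1) * \<tau>" if "\<bar>s\<bar> \<le> C * \<tau>" for s
        using cmod_le[of "Complex s \<tau>"] that \<tau> by (simp add: algebra_simps)
      have val: "\<bar>\<psi> (Complex s \<tau>) - (s * A + \<tau> * B)\<bar> \<le> \<tau> / 2" if "\<bar>s\<bar> \<le> C * \<tau>" for s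
      proof -
        have "\<bar>\<psi> (Complex s \<tau>) - (s * A + \<tau> * B)\<bar> \<le> 1 / (2 * (C + 1)) * norm (Complex s \<tau>)"
          using \<delta>(2)[of "Complex s \<tau>"] nrm[OF that] small Dlin by auto
        also have "\<dots> \<le> 1 / (2 * (C + 1)) * ((C + 1) * \<tau>)"
          using C nrm[OF that] by (intro mult_left_mono) auto
        also have "\<dots> = \<tau> / 2"
        proof -
          have "1 / (2 * k) * (k * \<tau>) = \<tau> / 2" if "k \<noteq> 0" for k using that by simp
          from this[of "C + 1"] show ?thesis using C by linarith
        qed
        finally show ?thesis .
      qed
      have CA: "C * \<bar>A\<bar> = \<bar>B\<bar> + 1" using A by (simp add: C_def)
      have sgn1: "C * \<tau> * \<bar>A\<bar> + \<tau> * B \<ge> \<tau>" "- (C * \<tau> * \<bar>A\<bar>) + \<tau> * B \<le> - \<tau>"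
      proof -
        have "C * \<tau> * \<bar>A\<bar> = \<tau> * (\<bar>B\<bar> + 1)" using CA by (metis mult.assoc mult.commute)
        moreover have "\<tau> * B \<ge> - (\<tau> * \<bar>B\<bar>)" "\<tau> * B \<le> \<tau> * \<bar>B\<bar>"
          using \<tau> mult_left_mono[of B "\<bar>B\<bar>" \<tau>] mult_left_mono[of "-\<bar>B\<bar>" B \<tau>] by auto
        ultimately show "C * \<tau> * \<bar>A\<bar> + \<tau> * B \<ge> \<tau>" "- (C * \<tau> * \<bar>A\<bar>) + \<tau> * B \<le> - \<tau>"
          by (auto simp: algebra_simps)
      qed
      have Ct: "C * \<tau> > 0" using C \<tau> by simp
      have "\<psi> (Complex (- (C * \<tau>)) \<tau>) * \<psi> (Complex (C * \<tau>) \<tau>) < 0"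
      proof (cases "A > 0")
        case True
        then have "\<psi> (Complex (C * \<tau>) \<tau>) > 0" "\<psi> (Complex (- (C * \<tau>)) \<tau>) < 0"
          using val[of "C * \<tau>"] val[of "- (C * \<tau>)"] sgn1 Ct \<tau>
          unfolding abs_le_iff abs_of_pos[OF True] abs_minus_cancel abs_of_pos[OF Ct] mult_minus_left by linarith+
        then show ?thesis by (simp add: mult_neg_pos)
      next
        case False
        then have An: "A < 0" using A by simp
        then have "\<psi> (Complex (C * \<tau>) \<tau>) < 0" "\<psi> (Complex (- (C * \<tau>)) \<tau>) > 0"
          using val[of "C * \<tau>"] val[of "- (C * \<tau>)"] sgn1 Ct \<tau>
          unfolding abs_le_iff abs_of_neg[OF An] abs_minus_cancel abs_of_pos[OF Ct] mult_minus_left mult_minus_right by linarith+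
        then show ?thesis by (simp add: mult_pos_neg)
      qed
      moreover have "continuous_on {- (C * \<tau>)..C * \<tau>} (\<lambda>s. \<psi> (Complex s \<tau>))"
        unfolding \<psi>_def
      proof (rule continuous_on_compose2[OF D(6)])
        show "continuous_on {- (C * \<tau>)..C * \<tau>} (\<lambda>s. p + Complex s \<tau> *s v)"
          unfolding Complex_eq by (intro continuous_intros)
        show "(\<lambda>s. p + Complex s \<tau> *s v) ` {- (C * \<tau>)..C * \<tau>} \<subseteq> U"
        proof
          fix y assume "y \<in> (\<lambda>s. p + Complex s \<tau> *s v) ` {- (C * \<tau>)..C * \<tau>}"
          then obtain s where "s \<in> {- (C * \<tau>)..C * \<tau>}" "y = p + Complex s \<tau> *s v" by blast
          then have s: "\<bar>s\<bar> \<le> C * \<tau>" "y = p + Complex s \<tau> *s v" by (auto simp: abs_le_iff)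
          have "Complex s \<tau> \<in> ball 0 e0" using nrm[OF s(1)] small by simp
          then show "y \<in> U" using e0 s(2) by auto
        qed
      qed
      ultimately obtain s where s: "- (C * \<tau>) \<le> s" "s \<le> C * \<tau>" "\<psi> (Complex s \<tau>) = 0"
        using IVT_sign_change[of "- (C * \<tau>)" "C * \<tau>" "\<lambda>s. \<psi> (Complex s \<tau>)"] Ct by auto
      have "\<bar>s\<bar> \<le> C * \<tau>" using s by linarith
      then have ns: "norm (Complex s \<tau>) < min (min \<delta> e0) e" using nrm[of s] small by linarith
      then have "Complex s \<tau> \<in> ball 0 e0" by simp
      then have in1: "p + Complex s \<tau> *s v \<in> ball p r \<inter> U" using e0 by auto
      then have "p + Complex s \<tau> *s v \<in> M" using D(2) s(3) by (auto simp: \<psi>_def)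
      then have "g (p + Complex s \<tau> *s v) = 0" using g(2) in1 by blast
      moreover have "Complex s \<tau> \<noteq> 0" using \<tau> by (simp add: complex_eq_iff)
      ultimately show ?thesis using ns by auto
    qed
    have "g (p + 1 *s v) = 0"
    proof (rule analytic_continuation[where f = "\<lambda>\<zeta>. g (p + \<zeta> *s v)" and S = ?T and U = "{\<zeta>\<in>?T. g (p + \<zeta> *s v) = 0}" and \<xi> = 0])
      show "(\<lambda>\<zeta>. g (p + \<zeta> *s v)) holomorphic_on ?T" by (rule holomorphic_fun_on_line[OF g(1)]) auto
      show "open ?T" by (intro open_line_preimage) auto
      show "connected ?T" by (intro convex_connected convex_line_preimage) auto
      show "0 \<in> ?T" using r by simp
      show "1 \<in> ?T" using v by (simp add: dist_norm)
      show "0 islimpt {\<zeta>\<in>?T. g (p + \<zeta> *s v) = 0}"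
        unfolding islimpt_approachable
      proof (intro allI impI)
        fix e :: real assume "e > 0"
        then obtain \<zeta> where \<zeta>: "\<zeta> \<noteq> 0" "norm \<zeta> < min e e0" "g (p + \<zeta> *s v) = 0"
          using zero[of "min e e0"] e0 by auto
        then have "\<zeta> \<in> ?T" using e0 by auto
        then show "\<exists>x'\<in>{\<zeta>\<in>?T. g (p + \<zeta> *s v) = 0}. x' \<noteq> 0 \<and> dist x' 0 < e"
          using \<zeta> by (intro bexI[of _ \<zeta>]) auto
      qed
    qed auto
    then show ?thesis by simp
  qed
  define V where "V = {z \<in> ball p r. ?D (z - p) \<noteq> 0}"
  have "V = ball p r \<inter> (\<lambda>z. ?D (z - p)) -` (- {0})" by (auto simp: V_def)
  moreover have "open ((\<lambda>z. ?D (z - p)) -` (- {0}))"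
    by (intro open_vimage continuous_on_compose2[OF linear_continuous_on[OF linear_conv_bounded_linear[THEN iffD1, OF lin], of UNIV]] continuous_intros) auto
  ultimately have "open V" by auto
  moreover have "V \<noteq> {}"
  proof -
    obtain v where v: "?D v \<noteq> 0" using D(5)[OF pU] by blast
    then have v0: "v \<noteq> 0" using lin linear_0 by metis
    let ?v = "(r / (2 * norm v)) *\<^sub>R v"
    have "?D ?v \<noteq> 0" using v v0 r lin by (simp add: linear_scale)
    moreover have "norm ?v < r" using v0 r by simp
    ultimately have "p + ?v \<in> V" by (simp add: V_def dist_norm)
    then show ?thesis by blast
  qed
  moreover have "g x = 0" if "x \<in> V" for x
    using line[of "x - p"] that by (simp add: V_def dist_norm norm_minus_commute)
  moreover have "V \<subseteq> ball p r" by (auto simp: V_def)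
  ultimately show ?thesis
    using holomorphic_fun_identity[OF g(1) open_ball convex_ball _ _ _ _ z, of V] by blast
qed

section \<open>Maps of nowhere maximal rank\<close>

definition complex_jacobian :: "(complex^'m \<Rightarrow> complex^'k) \<Rightarrow> complex^'m \<Rightarrow> complex^'m^'k" where
  "complex_jacobian F z = (\<chi> i j. frechet_derivative (\<lambda>z. F z $ i) (at z) (axis j 1))"

lemma vec_expand_axis: "(v::complex^'m) = (\<Sum>j\<in>UNIV. v $ j *s axis j 1)"
  by (simp add: vec_eq_iff axis_def if_distrib[of "(*) _"] cong: if_cong)

lemma map_deriv_jacobian:
  fixes F :: "complex^'m \<Rightarrow> complex^'k"
  assumes "holomorphic_map_on F U" "z \<in> U"
  shows "map_deriv F z v = complex_jacobian F z *v v"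
proof -
  note D = holomorphic_map_on_map_deriv[OF assms]
  have "map_deriv F z v = map_deriv F z (\<Sum>j\<in>UNIV. v $ j *s axis j 1)"
    by (subst vec_expand_axis) (rule refl)
  also have "\<dots> = (\<Sum>j\<in>UNIV. v $ j *s map_deriv F z (axis j 1))"
    unfolding linear_sum[OF D(3)] D(2) ..
  also have "\<dots> = complex_jacobian F z *v v"
    by (simp add: vec_eq_iff matrix_vector_mult_def complex_jacobian_def map_deriv_def mult.commute)
  finally show ?thesis .
qed

lemma holomorphic_fun_on_det:
  fixes A :: "complex^'m \<Rightarrow> complex^'k^'k"
  assumes "\<And>i j. holomorphic_fun_on (\<lambda>z. A z $ i $ j) U"
  shows "holomorphic_fun_on (\<lambda>z. det (A z)) U"
  unfolding det_def
  by (intro holomorphic_fun_on_sum holomorphic_fun_on_mult holomorphic_fun_on_const holomorphic_fun_on_prod assms)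

lemma holomorphic_fun_on_jacobian:
  assumes "holomorphic_map_on F U" "open U"
  shows "holomorphic_fun_on (\<lambda>z. complex_jacobian F z $ i $ j) U"
  using assms holomorphic_fun_on_directional_derivative[of "\<lambda>z. F z $ i" U "axis j 1"]
  unfolding holomorphic_map_on_def complex_jacobian_def by simp

lemma det_nonzero_inj:
  fixes A :: "complex^'k^'k"
  assumes "det A \<noteq> 0" "A *v u = A *v v"
  shows "u = v"
  using iffD1[OF cramer[OF assms(1)] assms(2)] iffD1[OF cramer[OF assms(1)] refl, of v] by (rule trans[OF _ sym])

text \<open>This is the real inverse function theorem: Cauchy's formula supplies a continuous
  derivative, and the nonzero determinant its invertibility.\<close>

lemma local_inverse_of_jacobian:
  fixes F :: "complex^'m \<Rightarrow> complex^'m"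
  assumes F: "holomorphic_map_on F U" and U: "open U" and det: "\<And>z. z \<in> U \<Longrightarrow> det (complex_jacobian F z) \<noteq> 0" and q: "q \<in> U"
  obtains U' V g where "open U'" "U' \<subseteq> U" "q \<in> U'" "open V" "F q \<in> V" "homeomorphism U' V F g"
    "\<And>y. y \<in> V \<Longrightarrow> (g has_derivative inv (map_deriv F (g y))) (at y)"
proof -
  have bl: "bounded_linear (map_deriv F z)" if "z \<in> U" for z
    using holomorphic_map_on_map_deriv(1)[OF F that] has_derivative_bounded_linear by blast
  define F' where "F' z = Blinfun (map_deriv F z)" for z
  have app: "blinfun_apply (F' z) = map_deriv F z" if "z \<in> U" for z
    unfolding F'_def by (rule bounded_linear_Blinfun_apply[OF bl[OF that]])
  have inj: "inj (map_deriv F z)" if "z \<in> U" for z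
    by (rule injI, rule det_nonzero_inj[OF det[OF that]]) (simp add: map_deriv_jacobian[OF F that])
  have contF': "continuous_on U F'"
  proof (rule continuous_on_blinfun_componentwise)
    fix u :: "complex^'m"
    have "continuous_on U (\<lambda>z. map_deriv F z u)"
      unfolding map_deriv_def
      by (intro continuous_on_vec_lambda holomorphic_fun_continuous_derivative U)
        (use F in \<open>auto simp: holomorphic_map_on_def\<close>)
    then show "continuous_on U (\<lambda>z. blinfun_apply (F' z) u)"
      by (rule continuous_on_eq) (simp add: app)
  qed
  obtain G where G: "linear G" "\<And>x. G (map_deriv F q x) = x"
    using linear_injective_left_inverse[OF holomorphic_map_on_map_deriv(3)[OF F q] inj[OF q]]
    by (auto simp: fun_eq_iff)
  have "bounded_linear G" using G(1) linear_conv_bounded_linear by blast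
  then have invF: "Blinfun G o\<^sub>L F' q = id_blinfun"
    by (intro blinfun_eqI) (simp add: bounded_linear_Blinfun_apply app[OF q] G)
  have derF: "(F has_derivative blinfun_apply (F' x)) (at x)" if "x \<in> U" for x
    unfolding app[OF that] by (rule holomorphic_map_on_map_deriv(1)[OF F that])
  show ?thesis
  proof (rule inverse_function_theorem[OF U derF contF' q invF])
    fix U' V g g'
    assume *: "open U'" "U' \<subseteq> U" "q \<in> U'" "open V" "F q \<in> V" "homeomorphism U' V F g"
      "\<And>y. y \<in> V \<Longrightarrow> (g has_derivative (g' y)) (at y)" "\<And>y. y \<in> V \<Longrightarrow> g' y = inv (blinfun_apply (F' (g y)))"
    have "(g has_derivative inv (map_deriv F (g y))) (at y)" if "y \<in> V" for y
    proof -
      have "g y \<in> U" using *(2,6) that by (auto simp: homeomorphism_def)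
      then have "g' y = inv (map_deriv F (g y))" using *(8)[OF that] app by simp
      then show ?thesis using *(7)[OF that] by simp
    qed
    then show ?thesis by (rule that[OF *(1-6)])
  qed
qed

text \<open>A complex-time flow inside the fibres of \<open>H\<close>, reduced to what is used.
  Joint continuity lets points near \<open>q\<close> be carried to a hypersurface, the velocity
  \<open>a\<close> at \<open>q\<close> decides transversality, and
  \<open>\<gamma> q t \<noteq> q\<close> contradicts discreteness of a fibre.\<close>

definition flow_box ::
    "(complex^'m \<Rightarrow> complex^'k) \<Rightarrow> (complex^'m) set \<Rightarrow> complex^'m \<Rightarrow> complex^'m \<Rightarrow> (complex^'m) set \<Rightarrow>
      (complex^'m \<Rightarrow> complex \<Rightarrow> complex^'m) \<Rightarrow> real \<Rightarrow> bool" where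
  "flow_box H B a q V \<gamma> \<epsilon> \<longleftrightarrow> open V \<and> q \<in> V \<and> \<epsilon> > 0 \<and>
     continuous_on (V \<times> ball 0 \<epsilon>) (\<lambda>(z, t). \<gamma> z t) \<and>
     (\<forall>z\<in>V. \<forall>t\<in>ball 0 \<epsilon>. \<gamma> z t \<in> B \<and> H (\<gamma> z t) = H z) \<and>
     \<gamma> q 0 = q \<and> (\<forall>t\<in>ball 0 \<epsilon>. t \<noteq> 0 \<longrightarrow> \<gamma> q t \<noteq> q) \<and>
     ((\<gamma> q) has_derivative (\<lambda>t. t *s a)) (at 0)"

text \<open>Among the charts obtained by replacing some coordinates by components of \<open>H\<close>, take one
  replacing as many as possible with a Jacobian determinant that is not identically zero. Replacing a
  further coordinate \<open>i\<^sub>0\<close> by any component of \<open>H\<close> makes the determinant vanish, so \<open>H\<close> does not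
  depend on the coordinate \<open>i\<^sub>0\<close> of this chart.\<close>

lemma constant_rank_flow:
  fixes H :: "complex^'m \<Rightarrow> complex^'k"
  assumes H: "holomorphic_map_on H B" and B: "open B" "B \<noteq> {}"
    and sing: "\<And>z. z \<in> B \<Longrightarrow> \<exists>u. u \<noteq> 0 \<and> map_deriv H z u = 0"
  obtains D a where "holomorphic_fun_on D B" "\<exists>z\<in>B. D z \<noteq> 0" "holomorphic_map_on a {z \<in> B. D z \<noteq> 0}"
    "\<And>q. q \<in> B \<Longrightarrow> D q \<noteq> 0 \<Longrightarrow> a q \<noteq> 0"
    "\<And>q. q \<in> B \<Longrightarrow> D q \<noteq> 0 \<Longrightarrow> \<exists>V \<gamma> \<epsilon>. flow_box H B (a q) q V \<gamma> \<epsilon>"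
proof -
  define \<Psi> where "\<Psi> J \<sigma> z = (\<chi> i. if i \<in> J then H z $ \<sigma> i else z $ i)" for J :: "'m set" and \<sigma> :: "'m \<Rightarrow> 'k" and z
  define good where "good J \<longleftrightarrow> (\<exists>\<sigma>. \<exists>z\<in>B. det (complex_jacobian (\<Psi> J \<sigma>) z) \<noteq> 0)" for J
  have Hk: "holomorphic_fun_on (\<lambda>z. H z $ k) B" for k using H by (simp add: holomorphic_map_on_def)
  have hol\<Psi>: "holomorphic_map_on (\<Psi> J \<sigma>) B" for J \<sigma>
    unfolding holomorphic_map_on_def
  proof
    fix i show "holomorphic_fun_on (\<lambda>z. \<Psi> J \<sigma> z $ i) B"
      by (cases "i \<in> J") (simp_all add: \<Psi>_def Hk holomorphic_fun_on_nth)
  qed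
  have nth_deriv: "frechet_derivative (\<lambda>z. z $ i) (at z) = (\<lambda>v. v $ i)" for i and z :: "complex^'m"
    by (rule frechet_derivative_at[symmetric]) (auto intro!: bounded_linear_imp_has_derivative bounded_linear_vec_nth)
  have jac: "complex_jacobian (\<Psi> J \<sigma>) z $ i = (if i \<in> J then complex_jacobian H z $ \<sigma> i else axis i 1)" for J \<sigma> z i
  proof (cases "i \<in> J")
    case False
    then have "complex_jacobian (\<Psi> J \<sigma>) z $ i = (\<chi> j. axis j 1 $ i)"
      by (simp add: complex_jacobian_def \<Psi>_def nth_deriv)
    then show ?thesis using False by (simp add: vec_eq_iff axis_def)
  qed (simp add: complex_jacobian_def \<Psi>_def)
  obtain z0 where z0: "z0 \<in> B" using B by blast
  have "complex_jacobian (\<Psi> {} \<sigma>) z = mat 1" for \<sigma> z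
    using jac[of "{}" \<sigma> z] by (simp add: vec_eq_iff mat_def axis_def)
  then have good0: "good {}" unfolding good_def using z0 by (auto intro!: bexI[of _ z0])
  have bound: "card J \<le> CARD('m)" for J :: "'m set" by (rule card_mono) auto
  obtain J where J: "good J" and max: "\<And>J'. good J' \<Longrightarrow> card J' \<le> card J"
    using ex_has_greatest_nat[of good "{}" card "Suc CARD('m)"] good0 bound by (metis le_imp_less_Suc)
  obtain \<sigma> z1 where z1: "z1 \<in> B" "det (complex_jacobian (\<Psi> J \<sigma>) z1) \<noteq> 0" using J by (auto simp: good_def)
  \<comment> \<open>With every coordinate replaced, the Jacobian would consist of rows of the
    Jacobian of \<open>H\<close> and would share its kernel vector.\<close>
  have "J \<noteq> UNIV"
  proof
    assume J: "J = UNIV"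
    obtain u where u: "u \<noteq> 0" "map_deriv H z1 u = 0" using sing[OF z1(1)] by blast
    have "complex_jacobian H z1 *v u = 0" using u map_deriv_jacobian[OF H z1(1)] by simp
    then have "complex_jacobian (\<Psi> J \<sigma>) z1 *v u = complex_jacobian (\<Psi> J \<sigma>) z1 *v 0"
      using J by (simp add: vec_eq_iff matrix_vector_mult_def jac)
    then show False using det_nonzero_inj[OF z1(2)] u(1) by blast
  qed
  then obtain i0 where i0: "i0 \<notin> J" by blast
  define A where "A = complex_jacobian (\<Psi> J \<sigma>)"
  define D where "D z = det (A z)" for z
  \<comment> \<open>Cramer's rule for \<open>A z *v a z = axis i0 1\<close>. This is the coordinate
    field of the chart in direction \<open>i0\<close>, and the quotients of determinants show it to
    be holomorphic where \<open>D\<close> does not vanish.\<close>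
  define a where "a z = (\<chi> k. det (\<chi> i j. if j = k then axis i0 1 $ i else A z $ i $ j) / D z)" for z
  have Aa: "A z *v a z = axis i0 1" if "D z \<noteq> 0" for z
    using cramer[of "A z" "a z" "axis i0 1"] that by (simp add: a_def D_def)
  have entry: "holomorphic_fun_on (\<lambda>z. A z $ i $ j) B" for i j
    unfolding A_def by (rule holomorphic_fun_on_jacobian[OF hol\<Psi> B(1)])
  have holD: "holomorphic_fun_on D B" unfolding D_def by (rule holomorphic_fun_on_det[OF entry])
  have hola: "holomorphic_map_on a {z \<in> B. D z \<noteq> 0}"
    unfolding holomorphic_map_on_def
  proof
    fix k
    have "holomorphic_fun_on (\<lambda>z. (\<chi> i j. if j = k then axis i0 1 $ i else A z $ i $ j) $ i $ j) {z \<in> B. D z \<noteq> 0}" for i j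
    proof (cases "j = k")
      case False
      then show ?thesis using holomorphic_fun_on_subset[OF entry] by simp
    qed (simp add: holomorphic_fun_on_const)
    then show "holomorphic_fun_on (\<lambda>z. a z $ k) {z \<in> B. D z \<noteq> 0}"
        unfolding a_def vec_lambda_beta
      by (intro holomorphic_fun_on_divide holomorphic_fun_on_det holomorphic_fun_on_subset[OF holD]) auto
  qed
  have a0: "a z \<noteq> 0" if "D z \<noteq> 0" for z
    using Aa[OF that] by (metis axis_eq_0_iff matrix_vector_mult_0_right one_neq_zero)
  have Ha: "complex_jacobian H z *v a z = 0" if z: "z \<in> B" "D z \<noteq> 0" for z
  proof -
    have "(complex_jacobian H z *v a z) $ k = 0" for k
    proof -
      let ?\<sigma> = "\<sigma>(i0 := k)"
      let ?c = "complex_jacobian H z $ k"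
      have "\<not> good (insert i0 J)" using max[of "insert i0 J"] i0 by auto
      then have "det (complex_jacobian (\<Psi> (insert i0 J) ?\<sigma>) z) = 0" using z(1) unfolding good_def by blast
      moreover have "complex_jacobian (\<Psi> (insert i0 J) ?\<sigma>) z = (\<chi> i. if i = i0 then ?c else A z $ i)"
        using i0 by (auto simp: vec_eq_iff[of "complex_jacobian (\<Psi> (insert i0 J) ?\<sigma>) z"] jac A_def)
      ultimately have det0: "det (\<chi> i. if i = i0 then ?c else A z $ i) = 0" by simp
      have "det (transpose (A z)) \<noteq> 0" using z(2) by (simp add: D_def det_transpose)
      then obtain l where l: "transpose (A z) *v l = ?c" using cramer by blast
      \<comment> \<open>Row \<open>?c\<close> is a combination of the rows of \<open>A z\<close>.
        The vanishing determinant kills its coefficient at \<open>i0\<close>, and all other rows of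
        \<open>A z\<close> annihilate \<open>a z\<close>.\<close>
      have c: "?c = (\<Sum>i\<in>UNIV. l $ i *s row i (A z))"
        using l by (auto simp: vec_eq_iff matrix_vector_mult_def transpose_def row_def mult.commute)
      have "(\<chi> i. if i = i0 then ?c else A z $ i) = (\<chi> i. if i = i0 then \<Sum>i\<in>UNIV. l $ i *s row i (A z) else row i (A z))"
        unfolding c[symmetric] by (simp add: vec_eq_iff row_def)
      then have "det (\<chi> i. if i = i0 then ?c else A z $ i) = l $ i0 * det (A z)"
        using cramer_lemma_transpose[of i0 l "A z"] by (simp only:)
      then have "l $ i0 = 0" using det0 z(2) by (simp add: D_def)
      have "(complex_jacobian H z *v a z) $ k = (\<Sum>j\<in>UNIV. ?c $ j * a z $ j)" by (simp add: matrix_vector_mult_def)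
      also have "\<dots> = (\<Sum>j\<in>UNIV. \<Sum>i\<in>UNIV. l $ i * (A z $ i $ j * a z $ j))"
        by (subst c) (simp add: row_def sum_distrib_right mult.assoc)
      also have "\<dots> = (\<Sum>i\<in>UNIV. l $ i * (A z *v a z) $ i)"
        by (subst sum.swap) (simp add: matrix_vector_mult_def sum_distrib_left)
      also have "\<dots> = l $ i0" unfolding Aa[OF z(2)] by (simp add: axis_def if_distrib[of "(*) _"] cong: if_cong)
      finally show ?thesis using \<open>l $ i0 = 0\<close> by simp
    qed
    then show ?thesis by (simp add: vec_eq_iff)
  qed
  have flow: "\<exists>V \<gamma> \<epsilon>. flow_box H B (a q) q V \<gamma> \<epsilon>" if q: "q \<in> B" "D q \<noteq> 0" for q
  proof -
    let ?U = "{z \<in> B. D z \<noteq> 0}"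
    let ?F = "\<Psi> J \<sigma>"
    let ?e = "axis i0 1 :: complex^'m"
    have "?U = B \<inter> D -` (- {0})" by auto
    then have U: "open ?U"
      using continuous_open_preimage[OF holomorphic_fun_on_imp_continuous_on[OF holD] B(1), of "- {0}"] by auto
    have holF: "holomorphic_map_on ?F ?U" by (rule holomorphic_map_on_subset[OF hol\<Psi>]) auto
    obtain U' V g where loc: "open U'" "U' \<subseteq> ?U" "q \<in> U'" "open V" "?F q \<in> V" "homeomorphism U' V ?F g"
      "\<And>y. y \<in> V \<Longrightarrow> (g has_derivative inv (map_deriv ?F (g y))) (at y)"
      using local_inverse_of_jacobian[OF holF U, of q] q unfolding D_def A_def by blast
    have hom: "\<And>x. x \<in> U' \<Longrightarrow> g (?F x) = x" "\<And>y. y \<in> V \<Longrightarrow> ?F (g y) = y" "\<And>y. y \<in> V \<Longrightarrow> g y \<in> U'"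
      "continuous_on V g" "continuous_on U' ?F"
      using loc(6) by (auto simp: homeomorphism_def)
    have inve: "inv (map_deriv ?F z) (t *s ?e) = t *s a z" if "z \<in> ?U" for z t
    proof (rule inv_f_eq)
      have eq: "map_deriv ?F z = (*v) (A z)"
        using map_deriv_jacobian[OF holF that] by (auto simp: A_def)
      show "inj (map_deriv ?F z)" unfolding eq by (rule injI, rule det_nonzero_inj) (use that in \<open>auto simp: D_def\<close>)
      show "map_deriv ?F z (t *s a z) = t *s ?e"
        using holomorphic_map_on_map_deriv(2)[OF holF that] Aa that by (auto simp: eq)
    qed
    obtain e where e: "e > 0" "ball (?F q) e \<subseteq> V" using loc(4,5) open_contains_ball by blast
    define \<epsilon> where "\<epsilon> = e / 2"
    define W where "W = U' \<inter> ?F -` ball (?F q) \<epsilon>"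
    \<comment> \<open>The flow shifts the coordinate \<open>i0\<close> of the chart by
      \<open>t\<close>. With \<open>\<epsilon> = e / 2\<close>, the displacement of the base point
      and the time together stay below \<open>e\<close>.\<close>
    define \<gamma> where "\<gamma> z t = g (?F z + t *s ?e)" for z t
    have eps: "\<epsilon> > 0" using e by (simp add: \<epsilon>_def)
    have W: "open W" "q \<in> W" "W \<subseteq> U'"
      unfolding W_def using continuous_open_preimage[OF hom(5) loc(1) open_ball] loc(3) eps by auto
    have inV: "?F z + t *s ?e \<in> V" if "z \<in> W" "t \<in> ball 0 \<epsilon>" for z t
    proof -
      have "dist (?F q) (?F z + t *s ?e) \<le> dist (?F q) (?F z) + norm (t *s ?e)"
        using dist_triangle[of "?F q" "?F z + t *s ?e" "?F z"] by (simp add: dist_norm)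
      also have "norm (t *s ?e) = norm t" by (simp add: norm_scale_vec)
      finally have "dist (?F q) (?F z + t *s ?e) < e" using that by (simp add: W_def \<epsilon>_def)
      then show ?thesis using e by auto
    qed
    have cont: "continuous_on (W \<times> ball 0 \<epsilon>) (\<lambda>(z, t). \<gamma> z t)"
      unfolding \<gamma>_def case_prod_unfold
      by (intro continuous_on_compose2[OF hom(4)] continuous_intros continuous_on_compose2[OF hom(5)])
        (use W inV in auto)
    have const: "H (\<gamma> z t) = H z" if z: "z \<in> W" and t: "t \<in> ball 0 \<epsilon>" for z t
    proof -
      have "H (\<gamma> z t) $ k = H z $ k" for k
      proof -
        have "\<exists>c. \<forall>t\<in>ball 0 \<epsilon>. H (\<gamma> z t) $ k = c"
        proof (rule has_derivative_zero_constant[OF convex_ball])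
          fix t :: complex assume t: "t \<in> ball 0 \<epsilon>"
          let ?y = "?F z + t *s ?e"
          have y: "?y \<in> V" by (rule inV[OF z t])
          have gy: "g ?y \<in> ?U" using hom(3)[OF y] loc(2) by auto
          have "((\<lambda>t. ?F z + t *s ?e) has_derivative (\<lambda>h. h *s ?e)) (at t)"
            by (auto intro!: derivative_eq_intros)
          from has_derivative_compose[OF this loc(7)[OF y]]
          have "(\<gamma> z has_derivative (\<lambda>h. h *s a (g ?y))) (at t)"
            unfolding inve[OF gy] by (simp add: \<gamma>_def[abs_def])
          moreover have "((\<lambda>z. H z $ k) has_derivative frechet_derivative (\<lambda>z. H z $ k) (at (\<gamma> z t))) (at (\<gamma> z t))"
            using holomorphic_fun_on_frechet(1)[OF Hk] gy by (simp add: \<gamma>_def)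
          ultimately have "((\<lambda>t. H (\<gamma> z t) $ k) has_derivative (\<lambda>h. frechet_derivative (\<lambda>z. H z $ k) (at (\<gamma> z t)) (h *s a (g ?y)))) (at t)"
            by (rule has_derivative_compose)
          moreover have "frechet_derivative (\<lambda>z. H z $ k) (at (\<gamma> z t)) (h *s a (g ?y)) = 0" for h
          proof -
            have "map_deriv H (g ?y) (h *s a (g ?y)) = 0"
              using gy Ha[of "g ?y"] map_deriv_jacobian[OF H, of "g ?y"] holomorphic_map_on_map_deriv(2)[OF H, of "g ?y"] by auto
            then show ?thesis by (simp add: map_deriv_def \<gamma>_def vec_eq_iff)
          qed
          ultimately show "((\<lambda>t. H (\<gamma> z t) $ k) has_derivative (\<lambda>h. 0)) (at t within ball 0 \<epsilon>)"
            using has_derivative_at_withinI by simp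
        qed
        then have "H (\<gamma> z t) $ k = H (\<gamma> z 0) $ k" using t eps by auto
        also have "\<gamma> z 0 = z" using z W(3) hom(1) by (auto simp: \<gamma>_def)
        finally show ?thesis .
      qed
      then show ?thesis by (simp add: vec_eq_iff)
    qed
    have inB: "\<gamma> z t \<in> B" if "z \<in> W" "t \<in> ball 0 \<epsilon>" for z t
      using hom(3)[OF inV[OF that]] loc(2) by (auto simp: \<gamma>_def)
    have q0: "\<gamma> q 0 = q" using hom(1) loc(3) by (simp add: \<gamma>_def)
    have moves: "\<gamma> q t \<noteq> q" if "t \<in> ball 0 \<epsilon>" "t \<noteq> 0" for t
    proof
      assume "\<gamma> q t = q"
      then have "?F q + t *s ?e = ?F q" using hom(2)[OF inV[OF W(2) that(1)]] by (simp add: \<gamma>_def)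
      then have "norm (t *s ?e) = 0" by simp
      then show False using that(2) by (simp add: norm_scale_vec)
    qed
    have der: "(\<gamma> q has_derivative (\<lambda>t. t *s a q)) (at 0)"
    proof -
      have "((\<lambda>t. ?F q + t *s ?e) has_derivative (\<lambda>h. h *s ?e)) (at 0)"
        by (auto intro!: derivative_eq_intros)
      from has_derivative_compose[OF this, of g "inv (map_deriv ?F (g (?F q)))"] loc(5,7)
      have "(\<gamma> q has_derivative (\<lambda>h. inv (map_deriv ?F (g (?F q))) (h *s ?e))) (at 0)"
        by (simp add: \<gamma>_def[abs_def])
      then show ?thesis using hom(1)[OF loc(3)] inve[of q] q by simp
    qed
    show ?thesis
      unfolding flow_box_def
      by (intro exI[of _ W] exI[of _ \<gamma>] exI[of _ \<epsilon>] conjI ballI impI W eps cont const inB q0 moves der)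
  qed
  have "\<exists>z\<in>B. D z \<noteq> 0" using z1 by (auto simp: D_def A_def)
  then show ?thesis by (rule that[OF holD _ hola a0 flow])
qed

section \<open>Roots depending on parameters\<close>

text \<open>The elementary symmetric function e_n in terms of the power sums p_1, ..., p_n, from
  Newton's identity: (n+1) e_(n+1) is the sum over i from 0 to n of (-1)^(n-i) e_i
  p_(n-i+1).\<close>

fun newton :: "(nat \<Rightarrow> complex) \<Rightarrow> nat \<Rightarrow> complex" where
  "newton p 0 = 1"
| "newton p (Suc n) = (\<Sum>i\<le>n. newton p i * ((-1) ^ (n - i) * p (Suc (n - i)))) / of_nat (Suc n)"

lemma holomorphic_fun_on_newton:
  assumes "\<And>k. holomorphic_fun_on (\<lambda>x. p x k) U"
  shows "holomorphic_fun_on (\<lambda>x. newton (p x) n) U"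
proof (induction n rule: less_induct)
  case (less n)
  show ?case
  proof (cases n)
    case (Suc k)
    then show ?thesis using less
      by (auto intro!: holomorphic_fun_on_divide holomorphic_fun_on_sum holomorphic_fun_on_mult
          holomorphic_fun_on_const assms simp del: of_nat_Suc)
  qed (simp add: holomorphic_fun_on_const)
qed

lemma fps_mult_top_coeff:
  fixes f g :: "'a::comm_ring_1 fps"
  assumes "\<And>n. n > d \<Longrightarrow> fps_nth f n = 0" "\<And>n. n > e \<Longrightarrow> fps_nth g n = 0"
  shows "fps_nth (f * g) (d + e) = fps_nth f d * fps_nth g e"
    and "n > d + e \<Longrightarrow> fps_nth (f * g) n = 0"
proof -
  have "fps_nth (f * g) (d + e) = (\<Sum>i\<in>{d}. fps_nth f i * fps_nth g (d + e - i))"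
    unfolding fps_mult_nth
  proof (rule sum.mono_neutral_right)
    show "\<forall>i\<in>{0..d + e} - {d}. fps_nth f i * fps_nth g (d + e - i) = 0"
    proof
      fix i assume "i \<in> {0..d + e} - {d}"
      then have "i > d \<or> d + e - i > e" by auto
      then show "fps_nth f i * fps_nth g (d + e - i) = 0" using assms by auto
    qed
  qed auto
  then show "fps_nth (f * g) (d + e) = fps_nth f d * fps_nth g e" by simp
  show "fps_nth (f * g) n = 0" if "n > d + e"
    unfolding fps_mult_nth
  proof (rule sum.neutral, rule ballI)
    fix i assume "i \<in> {0..n}"
    then have "i > d \<or> n - i > e" using that by auto
    then show "fps_nth f i * fps_nth g (n - i) = 0" using assms by auto
  qed
qed

lemma fps_linear_power_top_coeff:
  fixes c :: complex
  shows "fps_nth ((1 + fps_const c * fps_X) ^ m) m = c ^ m \<and>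
    (\<forall>n>m. fps_nth ((1 + fps_const c * fps_X) ^ m) n = 0)"
proof (induction m)
  case (Suc m)
  let ?f = "1 + fps_const c * fps_X"
  have f: "fps_nth ?f 1 = c" "\<And>n. n > 1 \<Longrightarrow> fps_nth ?f n = 0" by auto
  show ?case
    using fps_mult_top_coeff[where d = 1 and f = ?f and e = m and g = "?f ^ m"] f Suc by simp
qed auto

text \<open>\<open>Q\<close> generates the elementary symmetric functions of the numbers
  \<open>a z\<close> repeated \<open>m z\<close> times. Its logarithmic derivative is a sum of
  geometric series and generates their power sums with alternating signs.\<close>

lemma fps_prod_linear_powers:
  fixes a :: "'b \<Rightarrow> complex" and m :: "'b \<Rightarrow> nat"
  assumes "finite Z"
  defines "Q \<equiv> \<Prod>z\<in>Z. (1 + fps_const (a z) * fps_X) ^ m z"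
  shows "fps_nth Q (sum m Z) = (\<Prod>z\<in>Z. a z ^ m z)"
    and "fps_deriv Q = Q * Abs_fps (\<lambda>n. \<Sum>z\<in>Z. of_nat (m z) * a z * (- a z) ^ n)"
proof -
  have "fps_nth (\<Prod>z\<in>Z. (1 + fps_const (a z) * fps_X) ^ m z) (sum m Z) = (\<Prod>z\<in>Z. a z ^ m z) \<and>
      (\<forall>n>sum m Z. fps_nth (\<Prod>z\<in>Z. (1 + fps_const (a z) * fps_X) ^ m z) n = 0)"
    using assms(1)
  proof (induction Z rule: finite_induct)
    case (insert z Z)
    then show ?case
      using fps_mult_top_coeff[where d = "m z" and f = "(1 + fps_const (a z) * fps_X) ^ m z" and e = "sum m Z"
          and g = "\<Prod>z\<in>Z. (1 + fps_const (a z) * fps_X) ^ m z"] fps_linear_power_top_coeff[of "a z" "m z"]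
      by simp
  qed simp
  then show "fps_nth Q (sum m Z) = (\<Prod>z\<in>Z. a z ^ m z)" by (simp add: Q_def)
  have one: "fps_deriv ((1 + fps_const c * fps_X) ^ k) =
      (1 + fps_const c * fps_X) ^ k * Abs_fps (\<lambda>n. of_nat k * c * (- c) ^ n)" for c :: complex and k
  proof (cases k)
    case (Suc j)
    let ?f = "1 + fps_const c * fps_X" and ?E = "Abs_fps (\<lambda>n. of_nat k * c * (- c) ^ n)"
    have "?f * ?E = fps_const (of_nat k * c)"
    proof (rule fps_ext)
      fix n show "fps_nth (?f * ?E) n = fps_nth (fps_const (of_nat k * c)) n"
        by (cases n) (simp_all add: distrib_right mult.assoc)
    qed
    moreover have dX: "fps_deriv ?f = fps_const c" by simp
    have "fps_deriv (?f ^ k) = fps_const (of_nat k * c) * ?f ^ j"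
      unfolding Suc fps_deriv_power dX fps_const_mult diff_Suc_1 ..
    ultimately show ?thesis using Suc by (simp add: mult.commute mult.left_commute)
  qed (simp add: fps_eq_iff)
  show "fps_deriv Q = Q * Abs_fps (\<lambda>n. \<Sum>z\<in>Z. of_nat (m z) * a z * (- a z) ^ n)"
    unfolding Q_def using assms(1)
  proof (induction Z rule: finite_induct)
    case (insert z Z)
    have "Abs_fps (\<lambda>n. \<Sum>z\<in>insert z Z. of_nat (m z) * a z * (- a z) ^ n) =
        Abs_fps (\<lambda>n. of_nat (m z) * a z * (- a z) ^ n) + Abs_fps (\<lambda>n. \<Sum>z\<in>Z. of_nat (m z) * a z * (- a z) ^ n)"
      using insert(1,2) by (simp add: fps_eq_iff)
    moreover have "fps_deriv (f * g) = f * g * (E + F)" if "fps_deriv f = f * E" "fps_deriv g = g * F" for f g E F :: "complex fps"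
      by (simp add: that distrib_left mult_ac add.commute)
    ultimately show ?case
      unfolding prod.insert[OF insert(1,2)] using one insert(3) by (simp only:)
  qed (simp add: fps_eq_iff)
qed

text \<open>Comparing coefficients in the formula for \<open>fps_deriv Q\<close> reproduces the
  recursion of \<open>newton\<close>. The index \<open>sum m Z\<close> is the number of factors of
  \<open>Q\<close>, so its coefficient is the full product.\<close>

lemma newton_power_sums:
  fixes a :: "'b \<Rightarrow> complex" and m :: "'b \<Rightarrow> nat"
  assumes "finite Z"
  shows "newton (\<lambda>k. \<Sum>z\<in>Z. of_nat (m z) * a z ^ k) (sum m Z) = (\<Prod>z\<in>Z. a z ^ m z)"
proof -
  define p where "p k = (\<Sum>z\<in>Z. of_nat (m z) * a z ^ k)" for k
  define Q where "Q = (\<Prod>z\<in>Z. (1 + fps_const (a z) * fps_X) ^ m z)"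
  note Q = fps_prod_linear_powers[OF assms, where a = a and m = m, folded Q_def]
  have "fps_nth Q n = newton p n" for n
  proof (induction n rule: less_induct)
    case (less n)
    show ?case
    proof (cases n)
      case 0
      have "fps_nth Q 0 = 1"
        unfolding Q_def using assms by (induction Z rule: finite_induct) (simp_all add: fps_power_zeroth)
      then show ?thesis using 0 by simp
    next
      case (Suc k)
      have p: "(\<Sum>z\<in>Z. of_nat (m z) * a z * (- a z) ^ j) = (-1) ^ j * p (Suc j)" for j
        unfolding p_def sum_distrib_left
        by (intro sum.cong refl) (simp add: power_minus[of "a _"] mult_ac)
      have "of_nat (Suc k) * fps_nth Q (Suc k) = fps_nth (fps_deriv Q) k" by simp
      also have "\<dots> = (\<Sum>i\<le>k. fps_nth Q i * ((-1) ^ (k - i) * p (Suc (k - i))))"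
        unfolding Q(2) fps_mult_nth by (simp add: p atLeast0AtMost)
      also have "\<dots> = (\<Sum>i\<le>k. newton p i * ((-1) ^ (k - i) * p (Suc (k - i))))"
        using less Suc by (intro sum.cong) auto
      finally have "fps_nth Q (Suc k) = newton p (Suc k)" by (simp add: field_simps del: of_nat_Suc)
      then show ?thesis using Suc by simp
    qed
  qed
  then show ?thesis using Q(1) by (simp add: p_def[abs_def])
qed

section \<open>The argument principle with holomorphic parameters\<close>

definition root_mult :: "(complex \<Rightarrow> complex) \<Rightarrow> complex \<Rightarrow> nat" where
  "root_mult \<phi> \<zeta> = nat (zorder \<phi> \<zeta>)"

text \<open>Nonvanishing on the circle prevents \<phi> from being identically zero, so its zeros are
  isolated and of positive finite order; the sum is then the argument principle weighted by
  \<open>h\<close>.\<close>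

lemma
  assumes \<phi>: "\<phi> holomorphic_on ball c R" and r: "0 < r" "r < R" and nz: "\<And>\<zeta>. norm (\<zeta> - c) = r \<Longrightarrow> \<phi> \<zeta> \<noteq> 0"
  shows finite_roots_disc: "finite {\<zeta> \<in> ball c r. \<phi> \<zeta> = 0}"
    and root_mult_pos: "\<zeta> \<in> ball c r \<Longrightarrow> \<phi> \<zeta> = 0 \<Longrightarrow> root_mult \<phi> \<zeta> > 0"
    and isolated_root: "\<zeta> \<in> ball c r \<Longrightarrow> \<forall>\<^sub>F w in at \<zeta>. \<phi> w \<noteq> 0"
    and weighted_root_sum: "h holomorphic_on ball c R \<Longrightarrow>
      contour_integral (circlepath c r) (\<lambda>\<zeta>. deriv \<phi> \<zeta> * h \<zeta> / \<phi> \<zeta>) =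
        2 * pi * \<i> * (\<Sum>\<zeta> | \<zeta> \<in> ball c r \<and> \<phi> \<zeta> = 0. of_nat (root_mult \<phi> \<zeta>) * h \<zeta>)"
proof -
  \<comment> \<open>The open disc of radius \<open>R\<close> may contain infinitely many zeros, the
    compact disc of radius \<open>r'\<close> does not. Its zeros outside the circle of radius
    \<open>r\<close> have winding number 0.\<close>
  define r' where "r' = (r + R) / 2"
  have r': "r < r'" "r' < R" using r by (auto simp: r'_def)
  have ex: "\<phi> (c + of_real r) \<noteq> 0" by (rule nz) (use r in simp)
  have in_ball: "c + of_real r \<in> ball c R" "c + of_real r \<in> ball c r'" using r r' by (auto simp: dist_norm)
  have nonzero: "\<forall>\<^sub>F w in at \<zeta>. \<phi> w \<noteq> 0" if "\<zeta> \<in> ball c R" for \<zeta>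
    using non_zero_neighbour_alt[OF \<phi> open_ball connected_ball that in_ball(1) ex]
    by (rule eventually_mono) simp
  then show iso: "\<forall>\<^sub>F w in at \<zeta>. \<phi> w \<noteq> 0" if "\<zeta> \<in> ball c r" for \<zeta>
    using that r by auto
  have fin: "finite {\<zeta> \<in> cball c r'. \<phi> \<zeta> = 0}"
  proof (cases "\<exists>w\<in>ball c R. \<phi> w = 0")
    case True
    then have "\<not> \<phi> constant_on ball c R" using ex in_ball(1) unfolding constant_on_def by metis
    moreover have "cball c r' \<subseteq> ball c R" using r' by auto
    ultimately show ?thesis
      using holomorphic_compact_finite_zeros[OF \<phi> open_ball connected_ball compact_cball] by blast
  next
    case False
    then have "{\<zeta> \<in> cball c r'. \<phi> \<zeta> = 0} = {}" using r' by auto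
    then show ?thesis by (simp only: finite.emptyI)
  qed
  then show fin1: "finite {\<zeta> \<in> ball c r. \<phi> \<zeta> = 0}" by (rule finite_subset[rotated]) (use r' in auto)
  have pos: "zorder \<phi> \<zeta> > 0" if "\<zeta> \<in> ball c R" "\<phi> \<zeta> = 0" for \<zeta>
    using zorder_pos_iff[OF \<phi> open_ball that(1)] nonzero[OF that(1)] that(2)
    by (simp add: eventually_frequently)
  then show "root_mult \<phi> \<zeta> > 0" if "\<zeta> \<in> ball c r" "\<phi> \<zeta> = 0" for \<zeta>
    using that r by (auto simp: root_mult_def)
  assume h: "h holomorphic_on ball c R"
  let ?pz = "{w \<in> ball c r'. \<phi> w = 0 \<or> w \<in> {}}"
  have "contour_integral (circlepath c r) (\<lambda>x. deriv \<phi> x * h x / \<phi> x) =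
      2 * pi * \<i> * (\<Sum>p\<in>?pz. winding_number (circlepath c r) p * h p * zorder \<phi> p)"
  proof (rule argument_principle)
    show "\<phi> holomorphic_on ball c r' - {}" "h holomorphic_on ball c r'"
      using \<phi> h r' by (auto intro: holomorphic_on_subset)
    show "path_image (circlepath c r) \<subseteq> ball c r' - ?pz"
      using r r' nz by (auto simp: path_image_circlepath_nonneg dist_norm norm_minus_commute)
    show "\<forall>z. z \<notin> ball c r' \<longrightarrow> winding_number (circlepath c r) z = 0"
      using r r' by (intro allI impI winding_number_zero_outside[of _ "cball c r"]) auto
    show "finite ?pz" by (rule finite_subset[OF _ fin]) auto
  qed auto
  also have "(\<Sum>p\<in>?pz. winding_number (circlepath c r) p * h p * zorder \<phi> p) =
      (\<Sum>\<zeta> | \<zeta> \<in> ball c r \<and> \<phi> \<zeta> = 0. of_nat (root_mult \<phi> \<zeta>) * h \<zeta>)"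
  proof (rule sum.mono_neutral_cong_right)
    show "finite ?pz" by (rule finite_subset[OF _ fin]) auto
    show "{\<zeta>. \<zeta> \<in> ball c r \<and> \<phi> \<zeta> = 0} \<subseteq> ?pz" using r' by auto
    show "\<forall>i\<in>?pz - {\<zeta>. \<zeta> \<in> ball c r \<and> \<phi> \<zeta> = 0}. winding_number (circlepath c r) i * h i * zorder \<phi> i = 0"
    proof
      fix w assume w: "w \<in> ?pz - {\<zeta>. \<zeta> \<in> ball c r \<and> \<phi> \<zeta> = 0}"
      then have "w \<notin> cball c r" using nz[of w] by (auto simp: dist_norm norm_minus_commute less_le)
      then have "winding_number (circlepath c r) w = 0"
        using r by (intro winding_number_zero_outside[of _ "cball c r"]) auto
      then show "winding_number (circlepath c r) w * h w * zorder \<phi> w = 0" by simp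
    qed
    fix w assume w: "w \<in> {\<zeta>. \<zeta> \<in> ball c r \<and> \<phi> \<zeta> = 0}"
    then have "winding_number (circlepath c r) w = 1"
      by (intro winding_number_circlepath) (auto simp: dist_norm norm_minus_commute)
    moreover have "zorder \<phi> w > 0" using pos[of w] w r by auto
    ultimately show "winding_number (circlepath c r) w * h w * zorder \<phi> w = of_nat (root_mult \<phi> w) * h w"
      by (simp add: root_mult_def)
  qed
  finally show "contour_integral (circlepath c r) (\<lambda>\<zeta>. deriv \<phi> \<zeta> * h \<zeta> / \<phi> \<zeta>) =
        2 * pi * \<i> * (\<Sum>\<zeta> | \<zeta> \<in> ball c r \<and> \<phi> \<zeta> = 0. of_nat (root_mult \<phi> \<zeta>) * h \<zeta>)" .
qed

text \<open>Compactness of \<open>K\<close> gives one \<epsilon> for all \<zeta>, and translation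
  along \<open>v\<close> does not change distances.\<close>

lemma tube:
  fixes a v :: "complex^'m"
  assumes K: "compact K" and O: "open \<Omega>" "\<And>\<zeta>. \<zeta> \<in> K \<Longrightarrow> a + \<zeta> *s v \<in> \<Omega>"
  obtains \<epsilon> where "\<epsilon> > 0" "\<And>x \<zeta>. x \<in> ball a \<epsilon> \<Longrightarrow> \<zeta> \<in> K \<Longrightarrow> x + \<zeta> *s v \<in> \<Omega>"
proof -
  have "compact ((\<lambda>\<zeta>. a + \<zeta> *s v) ` K)"
    by (intro compact_continuous_image K continuous_intros)
  moreover have "(\<lambda>\<zeta>. a + \<zeta> *s v) ` K \<subseteq> \<Omega>" using O(2) by auto
  ultimately obtain \<epsilon> where \<epsilon>: "\<epsilon> > 0" "(\<Union>y\<in>(\<lambda>\<zeta>. a + \<zeta> *s v) ` K. ball y \<epsilon>) \<subseteq> \<Omega>"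
    using compact_subset_open_imp_ball_epsilon_subset[OF _ O(1)] by metis
  show ?thesis
  proof (rule that[OF \<epsilon>(1)])
    fix x \<zeta> assume "x \<in> ball a \<epsilon>" "\<zeta> \<in> K"
    then have "x + \<zeta> *s v \<in> ball (a + \<zeta> *s v) \<epsilon>" by (simp add: dist_norm)
    then show "x + \<zeta> *s v \<in> \<Omega>" using \<epsilon>(2) \<open>\<zeta> \<in> K\<close> by blast
  qed
qed

definition disc_roots :: "(complex \<Rightarrow> complex) \<Rightarrow> complex \<Rightarrow> real \<Rightarrow> complex set" where
  "disc_roots \<phi> c r = {\<zeta> \<in> ball c r. \<phi> \<zeta> = 0}"

text \<open>The argument principle rewrites the sum over moving roots as an integral over a fixed
  circle on which \<open>f\<close> has no zero, so the integrand is holomorphic in \<open>x\<close>.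
  The factor \<open>k\<close> is 1 for power sums of values of \<open>g\<close> and the identity for
  the mean of the roots.\<close>

lemma weighted_root_sum_holomorphic:
  fixes f g :: "complex^'k \<Rightarrow> complex" and A :: "complex^'m \<Rightarrow> complex^'k"
  assumes A: "clinear_map A" and f: "holomorphic_fun_on f \<Omega>" and g: "holomorphic_fun_on g \<Omega>" and \<Omega>: "open \<Omega>"
    and U: "open U" and r: "0 < r" "r < R"
    and sub: "\<And>x \<zeta>. x \<in> U \<Longrightarrow> \<zeta> \<in> ball c R \<Longrightarrow> A x + \<zeta> *s v \<in> \<Omega>"
    and nz: "\<And>x \<zeta>. x \<in> U \<Longrightarrow> norm (\<zeta> - c) = r \<Longrightarrow> f (A x + \<zeta> *s v) \<noteq> 0"
    and k: "k holomorphic_on UNIV"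
  shows "holomorphic_fun_on (\<lambda>x. \<Sum>\<zeta>\<in>disc_roots (\<lambda>\<zeta>. f (A x + \<zeta> *s v)) c r.
    of_nat (root_mult (\<lambda>\<zeta>. f (A x + \<zeta> *s v)) \<zeta>) * (g (A x + \<zeta> *s v) * k \<zeta>)) U"
proof -
  let ?\<phi> = "\<lambda>x \<zeta>. f (A x + \<zeta> *s v)"
  let ?\<Omega> = "{z \<in> \<Omega>. f z \<noteq> 0}"
  define G where "G z = frechet_derivative f (at z) v * g z / f z" for z
  define \<kappa> where "\<kappa> t = k (circlepath c r t) * (2 * pi * \<i> * r * exp (2 * of_real pi * \<i> * t)) / (2 * pi * \<i>)" for t
  have "?\<Omega> = \<Omega> \<inter> f -` (- {0})" by auto
  then have \<Omega>': "open ?\<Omega>"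
    using continuous_open_preimage[OF holomorphic_fun_on_imp_continuous_on[OF f] \<Omega>, of "- {0}"] by auto
  have G: "holomorphic_fun_on G ?\<Omega>"
    unfolding G_def
    by (intro holomorphic_fun_on_divide holomorphic_fun_on_mult
        holomorphic_fun_on_subset[OF holomorphic_fun_on_directional_derivative[OF f \<Omega>]]
        holomorphic_fun_on_subset[OF f] holomorphic_fun_on_subset[OF g]) auto
  have circ: "norm (circlepath c r t - c) = r" for t using r by (simp add: circlepath norm_mult)
  have in_ball: "circlepath c r t \<in> ball c R" for t using circ[of t] r by (simp add: dist_norm norm_minus_commute)
  have contk: "continuous_on UNIV k" using k by (rule holomorphic_on_imp_continuous_on)
  have "holomorphic_fun_on (\<lambda>x. integral {0..1} (\<lambda>t. G (A x + circlepath c r t *s v) * \<kappa> t)) U"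
  proof (rule holomorphic_fun_on_integral[OF A G \<Omega>' U])
    show "A x + circlepath c r t *s v \<in> ?\<Omega>" if "x \<in> U" for x t
      using sub[OF that in_ball] nz[OF that circ] by simp
    show "continuous_on {0..1} \<kappa>"
      unfolding \<kappa>_def by (intro continuous_intros continuous_on_compose2[OF contk] continuous_on_circlepath) auto
  qed (rule continuous_on_circlepath)
  then show ?thesis
  proof (rule holomorphic_fun_on_cong[OF _ U])
    fix x assume x: "x \<in> U"
    have hol: "(\<lambda>\<zeta>. h (A x + \<zeta> *s v)) holomorphic_on ball c R" if "holomorphic_fun_on h \<Omega>" for h
      by (rule holomorphic_fun_on_line[OF that]) (use sub x in auto)
    have "(\<lambda>\<zeta>. g (A x + \<zeta> *s v) * k \<zeta>) holomorphic_on ball c R"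
      by (intro holomorphic_intros hol[OF g] holomorphic_on_subset[OF k]) auto
    from weighted_root_sum[OF hol[OF f] r nz[OF x] this]
    have "(\<Sum>\<zeta>\<in>disc_roots (?\<phi> x) c r. of_nat (root_mult (?\<phi> x) \<zeta>) * (g (A x + \<zeta> *s v) * k \<zeta>)) =
        contour_integral (circlepath c r) (\<lambda>\<zeta>. deriv (?\<phi> x) \<zeta> * (g (A x + \<zeta> *s v) * k \<zeta>) / ?\<phi> x \<zeta>) / (2 * pi * \<i>)"
      by (simp add: disc_roots_def)
    also have "\<dots> = integral {0..1} (\<lambda>t. G (A x + circlepath c r t *s v) * \<kappa> t)"
      unfolding contour_integral_integral integral_divide[symmetric] vector_derivative_circlepath
    proof (intro integral_cong)
      fix t
      have assoc: "d * (a * b) / f * e / q = d * a / f * (b * e / q)" for d a b f e q :: complex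
        by (simp add: mult_ac)
      have "deriv (?\<phi> x) (circlepath c r t) = frechet_derivative f (at (A x + circlepath c r t *s v)) v"
        by (rule DERIV_imp_deriv[OF holomorphic_fun_on_line_deriv[OF f sub[OF x in_ball]]])
      then show "deriv (?\<phi> x) (circlepath c r t) * (g (A x + circlepath c r t *s v) * k (circlepath c r t)) /
          ?\<phi> x (circlepath c r t) * (2 * pi * \<i> * r * exp (2 * of_real pi * \<i> * t)) / (2 * pi * \<i>) =
          G (A x + circlepath c r t *s v) * \<kappa> t"
        unfolding G_def \<kappa>_def assoc by (simp only:)
    qed
    finally show "(\<Sum>\<zeta>\<in>disc_roots (?\<phi> x) c r. of_nat (root_mult (?\<phi> x) \<zeta>) * (g (A x + \<zeta> *s v) * k \<zeta>)) =
        integral {0..1} (\<lambda>t. G (A x + circlepath c r t *s v) * \<kappa> t)" .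
  qed
qed

text \<open>The count with multiplicities is a root sum with weight 1, hence continuous; being
  integer-valued, it is constant on a connected set.\<close>

lemma root_count_constant:
  fixes f :: "complex^'k \<Rightarrow> complex" and A :: "complex^'m \<Rightarrow> complex^'k"
  assumes A: "clinear_map A" and f: "holomorphic_fun_on f \<Omega>" and \<Omega>: "open \<Omega>"
    and U: "open U" "connected U" and r: "0 < r" "r < R"
    and sub: "\<And>x \<zeta>. x \<in> U \<Longrightarrow> \<zeta> \<in> ball c R \<Longrightarrow> A x + \<zeta> *s v \<in> \<Omega>"
    and nz: "\<And>x \<zeta>. x \<in> U \<Longrightarrow> norm (\<zeta> - c) = r \<Longrightarrow> f (A x + \<zeta> *s v) \<noteq> 0"
  obtains N :: nat where "\<And>x. x \<in> U \<Longrightarrow> (\<Sum>\<zeta>\<in>disc_roots (\<lambda>\<zeta>. f (A x + \<zeta> *s v)) c r.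
    root_mult (\<lambda>\<zeta>. f (A x + \<zeta> *s v)) \<zeta>) = N"
proof -
  define n where "n x = (\<Sum>\<zeta>\<in>disc_roots (\<lambda>\<zeta>. f (A x + \<zeta> *s v)) c r. root_mult (\<lambda>\<zeta>. f (A x + \<zeta> *s v)) \<zeta>)" for x
  have "holomorphic_fun_on (\<lambda>x. of_nat (n x)) U"
    using weighted_root_sum_holomorphic[OF A f holomorphic_fun_on_const[of 1] \<Omega> U(1) r sub nz holomorphic_on_const[of 1]]
    by (simp add: n_def)
  then have cont: "continuous_on U (\<lambda>x. of_nat (n x) :: complex)" by (rule holomorphic_fun_on_imp_continuous_on)
  have "(\<lambda>x. of_nat (n x) :: complex) constant_on U"
  proof (rule continuous_discrete_range_constant[OF U(2) cont])
    fix x assume "x \<in> U"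
    show "\<exists>e>0. \<forall>y. y \<in> U \<and> complex_of_nat (n y) \<noteq> of_nat (n x) \<longrightarrow> e \<le> norm (complex_of_nat (n y) - of_nat (n x))"
    proof (intro exI[of _ 1] conjI allI impI)
      fix y assume "y \<in> U \<and> complex_of_nat (n y) \<noteq> of_nat (n x)"
      then have "\<bar>int (n y) - int (n x)\<bar> \<ge> 1" by auto
      moreover have "norm (complex_of_nat (n y) - of_nat (n x)) = real_of_int \<bar>int (n y) - int (n x)\<bar>"
        by (metis norm_of_int of_int_abs of_int_diff of_int_of_nat_eq)
      ultimately show "1 \<le> norm (complex_of_nat (n y) - of_nat (n x))" by linarith
    qed simp
  qed
  then obtain a where "\<And>x. x \<in> U \<Longrightarrow> complex_of_nat (n x) = a" unfolding constant_on_def by auto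
  then have "n x = n y" if "x \<in> U" "y \<in> U" for x y using that by (metis of_nat_eq_iff)
  then have "n x = n (SOME y. y \<in> U)" if "x \<in> U" for x using that by (metis someI)
  then show ?thesis using that by (auto simp: n_def)
qed

text \<open>Regard \<open>a z\<close> as the coefficients of a polynomial \<open>P z\<close> in the
  parameter \<tau>. If no \<open>P z\<close> were zero, their product would be a nonzero polynomial
  of degree at most \<open>D * n\<close> with the \<open>D * n + 1\<close> roots 0, ...,
  \<open>D * n\<close>.\<close>

lemma common_root_criterion:
  fixes a :: "'b \<Rightarrow> nat \<Rightarrow> complex"
  assumes Z: "finite Z" "card Z \<le> D"
    and ex: "\<And>\<tau>. \<tau> \<le> D * n \<Longrightarrow> \<exists>z\<in>Z. (\<Sum>i<n. of_nat \<tau> ^ i * a z i) = 0"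
  shows "\<exists>z\<in>Z. \<forall>i<n. a z i = 0"
proof (rule ccontr)
  assume neg: "\<not> ?thesis"
  define P where "P z = (\<Sum>i<n. monom (a z i) i)" for z
  have evalP: "poly (P z) t = (\<Sum>i<n. t ^ i * a z i)" for z t
    by (simp add: P_def poly_sum poly_monom mult.commute)
  have coeffP: "coeff (P z) i = a z i" if "i < n" for z i
    using that by (simp add: P_def coeff_sum)
  have P0: "P z \<noteq> 0" if "z \<in> Z" for z
  proof
    assume "P z = 0"
    then have "a z i = 0" if "i < n" for i using coeffP[OF that, of z] by simp
    then show False using neg \<open>z \<in> Z\<close> by blast
  qed
  have degP: "degree (P z) \<le> n" for z
    unfolding P_def by (intro degree_sum_le) (auto intro: order_trans[OF degree_monom_le])
  let ?Q = "\<Prod>z\<in>Z. P z"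
  have Q0: "?Q \<noteq> 0" using P0 Z(1) by simp
  have "degree ?Q \<le> (\<Sum>z\<in>Z. degree (P z))" using degree_prod_sum_le[OF Z(1), of P] by (simp add: o_def)
  also have "\<dots> \<le> card Z * n" using sum_bounded_above[of Z "\<lambda>z. degree (P z)" n] degP by simp
  also have "\<dots> \<le> D * n" using Z(2) by simp
  finally have deg: "degree ?Q \<le> D * n" .
  have "of_nat ` {..D * n} \<subseteq> {t::complex. poly ?Q t = 0}"
  proof
    fix t :: complex assume "t \<in> of_nat ` {..D * n}"
    then obtain \<tau> where \<tau>: "t = of_nat \<tau>" "\<tau> \<le> D * n" by auto
    obtain z where "z \<in> Z" "poly (P z) t = 0" using ex[OF \<tau>(2)] \<tau>(1) evalP by auto
    then show "t \<in> {t. poly ?Q t = 0}" using Z(1) by (auto simp: poly_prod)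
  qed
  then have "card (of_nat ` {..D * n} :: complex set) \<le> card {t::complex. poly ?Q t = 0}"
    by (rule card_mono[OF poly_roots_finite[OF Q0]])
  also have "\<dots> \<le> degree ?Q" by (rule card_poly_roots_bound[OF Q0])
  finally have "Suc (D * n) \<le> degree ?Q" by (simp add: card_image inj_on_def)
  then show False using deg by simp
qed

text \<open>The equations \<open>e j\<close> are the norms \<open>\<Prod> u (A x + \<zeta> v)\<close>, over the roots \<open>\<zeta>\<close> of \<open>f\<close>, of the combinations
  \<open>u = \<Sum> j\<^sup>i h i\<close>; these norms are polynomials in power sums over the roots, by Newton's identities.\<close>

lemma elimination:
  fixes f :: "complex^'k \<Rightarrow> complex" and A :: "complex^'m \<Rightarrow> complex^'k" and h :: "nat \<Rightarrow> complex^'k \<Rightarrow> complex"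
  assumes A: "clinear_map A" and f: "holomorphic_fun_on f \<Omega>" and \<Omega>: "open \<Omega>"
    and h: "\<And>i. i < n \<Longrightarrow> holomorphic_fun_on (h i) \<Omega>"
    and U: "open U" "connected U" and r: "0 < r" "r < R"
    and sub: "\<And>x \<zeta>. x \<in> U \<Longrightarrow> \<zeta> \<in> ball c R \<Longrightarrow> A x + \<zeta> *s v \<in> \<Omega>"
    and nz: "\<And>x \<zeta>. x \<in> U \<Longrightarrow> norm (\<zeta> - c) = r \<Longrightarrow> f (A x + \<zeta> *s v) \<noteq> 0"
  obtains n' :: nat and e :: "nat \<Rightarrow> complex^'m \<Rightarrow> complex" where "\<And>j. j < n' \<Longrightarrow> holomorphic_fun_on (e j) U"
    "\<And>x x' j. A x = A x' \<Longrightarrow> e j x = e j x'"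
    "\<And>x. x \<in> U \<Longrightarrow> (\<exists>\<zeta>\<in>disc_roots (\<lambda>\<zeta>. f (A x + \<zeta> *s v)) c r. \<forall>i<n. h i (A x + \<zeta> *s v) = 0) \<longleftrightarrow> (\<forall>j<n'. e j x = 0)"
proof -
  let ?Z = "\<lambda>x. disc_roots (\<lambda>\<zeta>. f (A x + \<zeta> *s v)) c r"
  let ?\<mu> = "\<lambda>x. root_mult (\<lambda>\<zeta>. f (A x + \<zeta> *s v))"
  obtain D where D: "\<And>x. x \<in> U \<Longrightarrow> sum (?\<mu> x) (?Z x) = D"
    by (rule root_count_constant[OF A f \<Omega> U r sub nz]) blast+
  define u where "u \<tau> z = (\<Sum>i<n. of_nat \<tau> ^ i * h i z)" for \<tau> z
  have holu: "holomorphic_fun_on (u \<tau>) \<Omega>" for \<tau>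
    unfolding u_def by (intro holomorphic_fun_on_sum holomorphic_fun_on_mult holomorphic_fun_on_const h) auto
  define p where "p \<tau> x k = (\<Sum>\<zeta>\<in>?Z x. of_nat (?\<mu> x \<zeta>) * u \<tau> (A x + \<zeta> *s v) ^ k)" for \<tau> x k
  have holp: "holomorphic_fun_on (\<lambda>x. p \<tau> x k) U" for \<tau> k
  proof -
    have "holomorphic_fun_on (\<lambda>z. u \<tau> z ^ k) \<Omega>" by (rule holomorphic_fun_on_power[OF holu])
    from weighted_root_sum_holomorphic[OF A f this \<Omega> U(1) r sub nz holomorphic_on_const[of 1]]
    show ?thesis by (simp add: p_def)
  qed
  define e where "e \<tau> x = newton (p \<tau> x) D" for \<tau> x
  have Zx: "finite (?Z x)" "\<And>\<zeta>. \<zeta> \<in> ?Z x \<Longrightarrow> ?\<mu> x \<zeta> > 0" if x: "x \<in> U" for x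
  proof -
    have hol: "(\<lambda>\<zeta>. f (A x + \<zeta> *s v)) holomorphic_on ball c R"
      by (rule holomorphic_fun_on_line[OF f]) (use sub x in auto)
    show "finite (?Z x)" using finite_roots_disc[OF hol r nz[OF x]] by (simp add: disc_roots_def)
    show "?\<mu> x \<zeta> > 0" if "\<zeta> \<in> ?Z x" for \<zeta>
      using root_mult_pos[OF hol r nz[OF x]] that by (simp add: disc_roots_def)
  qed
  have e: "e \<tau> x = 0 \<longleftrightarrow> (\<exists>\<zeta>\<in>?Z x. u \<tau> (A x + \<zeta> *s v) = 0)" if x: "x \<in> U" for \<tau> x
  proof -
    have "e \<tau> x = (\<Prod>\<zeta>\<in>?Z x. u \<tau> (A x + \<zeta> *s v) ^ ?\<mu> x \<zeta>)"
      using newton_power_sums[OF Zx(1)[OF x], of "?\<mu> x" "\<lambda>\<zeta>. u \<tau> (A x + \<zeta> *s v)"]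
      by (simp add: e_def D[OF x] p_def[abs_def])
    then show ?thesis using Zx[OF x] by auto
  qed
  have card: "card (?Z x) \<le> D" if x: "x \<in> U" for x
    using sum_mono[of "?Z x" "\<lambda>_. 1" "?\<mu> x"] Zx(2)[OF x] D[OF x] by (simp add: Suc_le_eq)
  \<comment> \<open>The number of equations is the number of parameters \<tau> demanded by
    \<open>common_root_criterion\<close>.\<close>
  show ?thesis
  proof (rule that[of "Suc (D * n)" e])
    show "holomorphic_fun_on (e j) U" for j
      unfolding e_def by (rule holomorphic_fun_on_newton[OF holp])
    show "e j x = e j x'" if "A x = A x'" for x x' j
      unfolding e_def p_def that ..
    fix x assume x: "x \<in> U"
    show "(\<exists>\<zeta>\<in>?Z x. \<forall>i<n. h i (A x + \<zeta> *s v) = 0) \<longleftrightarrow> (\<forall>j<Suc (D * n). e j x = 0)"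
    proof
      assume "\<exists>\<zeta>\<in>?Z x. \<forall>i<n. h i (A x + \<zeta> *s v) = 0"
      then obtain \<zeta> where \<zeta>: "\<zeta> \<in> ?Z x" "\<forall>i<n. h i (A x + \<zeta> *s v) = 0" by blast
      from \<zeta>(2) have "u \<tau> (A x + \<zeta> *s v) = 0" for \<tau> by (simp add: u_def)
      then show "\<forall>j<Suc (D * n). e j x = 0" unfolding e[OF x] using \<zeta>(1) by blast
    next
      assume *: "\<forall>j<Suc (D * n). e j x = 0"
      show "\<exists>\<zeta>\<in>?Z x. \<forall>i<n. h i (A x + \<zeta> *s v) = 0"
      proof (rule common_root_criterion[OF Zx(1)[OF x] card[OF x]])
        fix \<tau> assume "\<tau> \<le> D * n"
        then show "\<exists>\<zeta>\<in>?Z x. (\<Sum>i<n. of_nat \<tau> ^ i * h i (A x + \<zeta> *s v)) = 0"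
          using * e[OF x, of \<tau>] by (auto simp: u_def)
      qed
    qed
  qed
qed

text \<open>Near \<open>x0\<close>, the multiplicity-weighted mean of the roots close to \<open>\<zeta>0\<close> is holomorphic; it is the
  root itself wherever there is only one.\<close>

lemma local_root_function:
  fixes f :: "complex^'m \<Rightarrow> complex" and A :: "complex^'m \<Rightarrow> complex^'m"
  assumes A: "clinear_map A" and f: "holomorphic_fun_on f \<Omega>" and \<Omega>: "open \<Omega>"
    and \<eta>: "0 < \<eta>" "\<eta> < \<eta>'" and sub: "\<And>\<zeta>. \<zeta> \<in> cball \<zeta>0 \<eta>' \<Longrightarrow> A x0 + \<zeta> *s v \<in> \<Omega>"
    and root: "f (A x0 + \<zeta>0 *s v) = 0" and nz: "\<And>\<zeta>. norm (\<zeta> - \<zeta>0) = \<eta> \<Longrightarrow> f (A x0 + \<zeta> *s v) \<noteq> 0"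
  obtains \<epsilon> y where "\<epsilon> > 0" "holomorphic_fun_on y {x. A x \<in> ball (A x0) \<epsilon>}"
    "\<And>x x'. A x = A x' \<Longrightarrow> y x = y x'"
    "\<And>x. A x \<in> ball (A x0) \<epsilon> \<Longrightarrow> disc_roots (\<lambda>\<zeta>. f (A x + \<zeta> *s v)) \<zeta>0 \<eta> \<noteq> {}"
    "\<And>x \<zeta>. A x \<in> ball (A x0) \<epsilon> \<Longrightarrow> disc_roots (\<lambda>\<zeta>. f (A x + \<zeta> *s v)) \<zeta>0 \<eta> = {\<zeta>} \<Longrightarrow> y x = \<zeta>"
proof -
  let ?Z = "\<lambda>x. disc_roots (\<lambda>\<zeta>. f (A x + \<zeta> *s v)) \<zeta>0 \<eta>"
  let ?\<mu> = "\<lambda>x. root_mult (\<lambda>\<zeta>. f (A x + \<zeta> *s v))"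
  let ?\<Omega> = "\<Omega> \<inter> f -` (- {0})"
  have \<Omega>': "open ?\<Omega>"
    by (rule continuous_open_preimage[OF holomorphic_fun_on_imp_continuous_on[OF f] \<Omega>]) auto
  obtain \<epsilon>1 where \<epsilon>1: "\<epsilon>1 > 0" "\<And>x \<zeta>. x \<in> ball (A x0) \<epsilon>1 \<Longrightarrow> \<zeta> \<in> cball \<zeta>0 \<eta>' \<Longrightarrow> x + \<zeta> *s v \<in> \<Omega>"
    using tube[OF compact_cball \<Omega> sub] by blast
  have "A x0 + \<zeta> *s v \<in> ?\<Omega>" if "\<zeta> \<in> sphere \<zeta>0 \<eta>" for \<zeta>
    using sub[of \<zeta>] nz[of \<zeta>] that \<eta> by (auto simp: dist_norm norm_minus_commute)
  from tube[OF compact_sphere \<Omega>' this]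
  obtain \<epsilon>2 where \<epsilon>2: "\<epsilon>2 > 0" "\<And>x \<zeta>. x \<in> ball (A x0) \<epsilon>2 \<Longrightarrow> \<zeta> \<in> sphere \<zeta>0 \<eta> \<Longrightarrow> x + \<zeta> *s v \<in> ?\<Omega>"
    by blast
  define \<epsilon> where "\<epsilon> = min \<epsilon>1 \<epsilon>2"
  have \<epsilon>: "\<epsilon> > 0" using \<epsilon>1 \<epsilon>2 by (simp add: \<epsilon>_def)
  let ?V = "{x. A x \<in> ball (A x0) \<epsilon>}"
  have V_eq: "?V = A -` ball (A x0) \<epsilon>" by auto
  have V: "open ?V" "connected ?V"
    unfolding V_eq using clinear_mapD(7)[OF A, of UNIV] clinear_mapD(1)[OF A]
    by (auto intro!: open_vimage convex_connected convex_linear_vimage)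
  have subV: "A x + \<zeta> *s v \<in> \<Omega>" if "x \<in> ?V" "\<zeta> \<in> ball \<zeta>0 \<eta>'" for x \<zeta>
    using \<epsilon>1(2)[of "A x" \<zeta>] that by (auto simp: \<epsilon>_def)
  have nzV: "f (A x + \<zeta> *s v) \<noteq> 0" if "x \<in> ?V" "norm (\<zeta> - \<zeta>0) = \<eta>" for x \<zeta>
    using \<epsilon>2(2)[of "A x" \<zeta>] that by (auto simp: \<epsilon>_def dist_norm norm_minus_commute)
  have hol: "(\<lambda>\<zeta>. f (A x + \<zeta> *s v)) holomorphic_on ball \<zeta>0 \<eta>'" if "x \<in> ?V" for x
    by (rule holomorphic_fun_on_line[OF f]) (use subV that in auto)
  have Zx: "finite (?Z x)" "\<And>\<zeta>. \<zeta> \<in> ?Z x \<Longrightarrow> ?\<mu> x \<zeta> > 0" if x: "x \<in> ?V" for x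
    using finite_roots_disc[OF hol[OF x] \<eta> nzV[OF x]] root_mult_pos[OF hol[OF x] \<eta> nzV[OF x]]
    by (simp_all add: disc_roots_def)
  obtain N where N: "\<And>x. x \<in> ?V \<Longrightarrow> sum (?\<mu> x) (?Z x) = N"
    by (rule root_count_constant[OF A f \<Omega> V \<eta> subV nzV]) blast+
  have x0: "x0 \<in> ?V" "\<zeta>0 \<in> ?Z x0" using \<epsilon> \<eta> root by (auto simp: disc_roots_def)
  \<comment> \<open>As \<zeta>0 is a root over \<open>x0\<close>, the constant \<open>N\<close> is
    positive; hence roots persist over all of \<open>?V\<close>, and division by \<open>N\<close>
    makes sense.\<close>
  have "?\<mu> x0 \<zeta>0 \<le> sum (?\<mu> x0) (?Z x0)" by (rule member_le_sum[OF x0(2)]) (use Zx[OF x0(1)] in auto)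
  then have N0: "N > 0" using N[OF x0(1)] Zx(2)[OF x0] by linarith
  define y where "y x = (\<Sum>\<zeta>\<in>?Z x. of_nat (?\<mu> x \<zeta>) * \<zeta>) / of_nat N" for x
  show ?thesis
  proof (rule that[OF \<epsilon>])
    have "holomorphic_fun_on (\<lambda>x. \<Sum>\<zeta>\<in>?Z x. of_nat (?\<mu> x \<zeta>) * \<zeta>) ?V"
      using weighted_root_sum_holomorphic[OF A f holomorphic_fun_on_const[of 1] \<Omega> V(1) \<eta> subV nzV holomorphic_on_ident] by simp
    then show "holomorphic_fun_on y ?V"
      unfolding y_def using N0 by (intro holomorphic_fun_on_divide holomorphic_fun_on_const) auto
    show "y x = y x'" if "A x = A x'" for x x' unfolding y_def that ..
    show "?Z x \<noteq> {}" if "A x \<in> ball (A x0) \<epsilon>" for x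
      using N[of x] N0 that by auto
    show "y x = \<zeta>" if "A x \<in> ball (A x0) \<epsilon>" "?Z x = {\<zeta>}" for x \<zeta>
      using N[of x] N0 that by (simp add: y_def)
  qed
qed

text \<open>Each root has multiplicity at least 1, so the constant count with multiplicities bounds
  the number of distinct roots.\<close>

lemma disc_roots_card_bound:
  fixes f :: "complex^'k \<Rightarrow> complex" and A :: "complex^'m \<Rightarrow> complex^'k"
  assumes A: "clinear_map A" and f: "holomorphic_fun_on f \<Omega>" and \<Omega>: "open \<Omega>"
    and U: "open U" "connected U" and r: "0 < r" "r < R"
    and sub: "\<And>x \<zeta>. x \<in> U \<Longrightarrow> \<zeta> \<in> ball c R \<Longrightarrow> A x + \<zeta> *s v \<in> \<Omega>"
    and nz: "\<And>x \<zeta>. x \<in> U \<Longrightarrow> norm (\<zeta> - c) = r \<Longrightarrow> f (A x + \<zeta> *s v) \<noteq> 0"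
  obtains D where "\<And>x. x \<in> U \<Longrightarrow> finite (disc_roots (\<lambda>\<zeta>. f (A x + \<zeta> *s v)) c r)"
    "\<And>x. x \<in> U \<Longrightarrow> card (disc_roots (\<lambda>\<zeta>. f (A x + \<zeta> *s v)) c r) \<le> D"
proof -
  let ?Z = "\<lambda>x. disc_roots (\<lambda>\<zeta>. f (A x + \<zeta> *s v)) c r"
  let ?\<mu> = "\<lambda>x. root_mult (\<lambda>\<zeta>. f (A x + \<zeta> *s v))"
  obtain D where D: "\<And>x. x \<in> U \<Longrightarrow> sum (?\<mu> x) (?Z x) = D"
    by (rule root_count_constant[OF A f \<Omega> U r sub nz]) blast+
  have Zx: "finite (?Z x)" "\<And>\<zeta>. \<zeta> \<in> ?Z x \<Longrightarrow> ?\<mu> x \<zeta> > 0" if x: "x \<in> U" for x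
  proof -
    have hol: "(\<lambda>\<zeta>. f (A x + \<zeta> *s v)) holomorphic_on ball c R"
      by (rule holomorphic_fun_on_line[OF f]) (use sub x in auto)
    show "finite (?Z x)" using finite_roots_disc[OF hol r nz[OF x]] by (simp add: disc_roots_def)
    show "?\<mu> x \<zeta> > 0" if "\<zeta> \<in> ?Z x" for \<zeta>
      using root_mult_pos[OF hol r nz[OF x]] that by (simp add: disc_roots_def)
  qed
  have "card (?Z x) \<le> D" if x: "x \<in> U" for x
    using sum_mono[of "?Z x" "\<lambda>_. 1" "?\<mu> x"] Zx(2)[OF x] D[OF x] by (simp add: Suc_le_eq)
  then show ?thesis using that Zx(1) by blast
qed

lemma finite_positive_lower_bound:
  assumes "finite S" "\<And>s. s \<in> S \<Longrightarrow> s > (0::real)"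
  obtains \<eta> where "\<eta> > 0" "\<And>s. s \<in> S \<Longrightarrow> 2 * \<eta> < s"
proof -
  \<comment> \<open>Inserting 1 covers the empty set; a third of the minimum leaves room for the
    factor 2.\<close>
  let ?\<eta> = "Min (insert 1 S) / 3"
  have "Min (insert 1 S) > 0" using assms by (subst Min_gr_iff) auto
  moreover have "Min (insert 1 S) \<le> s" if "s \<in> S" for s using assms that by (intro Min_le) auto
  ultimately show ?thesis by (intro that[of ?\<eta>]) fastforce+
qed

text \<open>Where the number of roots is maximal on \<open>T\<close>, the roots are holomorphic functions \<open>Y \<zeta>\<close> of
  \<open>x \<in> T\<close>; where moreover the number of common roots is minimal, the set of those \<open>\<zeta>\<close> for which
  \<open>Y \<zeta>\<close> is a common root is locally constant.\<close>

lemma common_root_branch: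
  fixes f :: "complex^'m \<Rightarrow> complex" and A :: "complex^'m \<Rightarrow> complex^'m"
  assumes A: "clinear_map A" and f: "holomorphic_fun_on f \<Omega>" and \<Omega>: "open \<Omega>"
    and g: "\<And>i. i < k \<Longrightarrow> holomorphic_fun_on (g i) \<Omega>"
    and U: "open U" "\<And>x. A x \<in> U \<longleftrightarrow> x \<in> U" and AA: "\<And>x. A (A x) = A x"
    and sub: "\<And>x \<zeta>. x \<in> U \<Longrightarrow> \<zeta> \<in> ball c r \<Longrightarrow> A x + \<zeta> *s v \<in> \<Omega>"
    and bound: "\<And>x. x \<in> U \<Longrightarrow> finite (disc_roots (\<lambda>\<zeta>. f (A x + \<zeta> *s v)) c r)"
      "\<And>x. x \<in> U \<Longrightarrow> card (disc_roots (\<lambda>\<zeta>. f (A x + \<zeta> *s v)) c r) \<le> N"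
    and T: "T = {x \<in> U. \<exists>\<zeta>\<in>disc_roots (\<lambda>\<zeta>. f (A x + \<zeta> *s v)) c r. \<forall>i<k. g i (A x + \<zeta> *s v) = 0}" "T \<noteq> {}"
  obtains x0 V y \<zeta>0 \<eta> where "x0 \<in> T" "open V" "x0 \<in> V" "V \<subseteq> U" "\<And>x. A x \<in> V \<longleftrightarrow> x \<in> V"
    "holomorphic_fun_on y V" "\<And>x x'. A x = A x' \<Longrightarrow> y x = y x'" "ball \<zeta>0 \<eta> \<subseteq> ball c r"
    "\<And>x. x \<in> V \<Longrightarrow> x \<in> T \<Longrightarrow> y x \<in> ball \<zeta>0 \<eta>"
    "\<And>x i. x \<in> V \<Longrightarrow> x \<in> T \<Longrightarrow> i < k \<Longrightarrow> g i (A x + y x *s v) = 0"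
    "\<And>x \<zeta>. x \<in> V \<Longrightarrow> x \<in> T \<Longrightarrow> \<zeta> \<in> ball \<zeta>0 \<eta> \<Longrightarrow> f (A x + \<zeta> *s v) = 0 \<Longrightarrow> \<zeta> = y x"
proof -
  let ?Z = "\<lambda>x. disc_roots (\<lambda>\<zeta>. f (A x + \<zeta> *s v)) c r"
  have TU: "T \<subseteq> U" using T by auto
  obtain x1 where x1: "x1 \<in> T" "\<And>x. x \<in> T \<Longrightarrow> card (?Z x) \<le> card (?Z x1)"
  proof -
    obtain x where "x \<in> T" using T by auto
    moreover have "\<forall>x. x \<in> T \<longrightarrow> card (?Z x) < Suc N" using bound(2) TU by (auto simp: less_Suc_eq_le)
    ultimately show ?thesis using ex_has_greatest_nat[of "\<lambda>x. x \<in> T" x "\<lambda>x. card (?Z x)" "Suc N"] that by blast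
  qed
  have x1U: "x1 \<in> U" using x1 TU by blast
  define Z1 where "Z1 = ?Z x1"
  have finZ1: "finite Z1" using bound(1)[OF x1U] by (simp add: Z1_def)
  have Z1: "\<zeta> \<in> ball c r" "f (A x1 + \<zeta> *s v) = 0" if "\<zeta> \<in> Z1" for \<zeta>
    using that by (auto simp: Z1_def disc_roots_def)
  \<comment> \<open>Gaps to the boundary of the disc and mutual distances of the roots. With 2
    \<eta> below all of them, the discs of radius \<eta> around the roots are disjoint, and even
    those of radius 2 \<eta> lie in \<open>ball c r\<close>.\<close>
  let ?S = "(\<lambda>\<zeta>. r - dist c \<zeta>) ` Z1 \<union> (\<lambda>(\<zeta>, \<zeta>'). dist \<zeta> \<zeta>') ` {(\<zeta>, \<zeta>') \<in> Z1 \<times> Z1. \<zeta> \<noteq> \<zeta>'}"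
  have "finite {(\<zeta>, \<zeta>') \<in> Z1 \<times> Z1. \<zeta> \<noteq> \<zeta>'}"
    by (rule finite_subset[of _ "Z1 \<times> Z1"]) (use finZ1 in auto)
  then have "finite ?S" using finZ1 by auto
  moreover have "s > 0" if "s \<in> ?S" for s using that Z1(1) by auto
  ultimately obtain \<eta> where \<eta>: "\<eta> > 0" and \<eta>S: "\<And>s. s \<in> ?S \<Longrightarrow> 2 * \<eta> < s"
    using finite_positive_lower_bound[of ?S] by blast
  have \<eta>1: "2 * \<eta> < r - dist c \<zeta>" if "\<zeta> \<in> Z1" for \<zeta> using \<eta>S that by blast
  have \<eta>2: "2 * \<eta> < dist \<zeta> \<zeta>'" if "\<zeta> \<in> Z1" "\<zeta>' \<in> Z1" "\<zeta> \<noteq> \<zeta>'" for \<zeta> \<zeta>'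
    by (rule \<eta>S, rule UnI2, rule image_eqI[of _ _ "(\<zeta>, \<zeta>')"]) (use that in auto)
  have disc: "w \<in> ball c r" if "\<zeta> \<in> Z1" "dist \<zeta> w \<le> 2 * \<eta>" for \<zeta> w
    using \<eta>1[OF that(1)] that(2) dist_triangle[of c w \<zeta>] by simp
  have disj: "\<zeta> = \<zeta>'" if "\<zeta> \<in> Z1" "\<zeta>' \<in> Z1" "w \<in> ball \<zeta> \<eta>" "w \<in> ball \<zeta>' \<eta>" for \<zeta> \<zeta>' w
  proof (rule ccontr)
    assume "\<zeta> \<noteq> \<zeta>'"
    from \<eta>2[OF that(1,2) this] dist_triangle2[of \<zeta> \<zeta>' w] that(3,4) show False by simp
  qed
  define branch where "branch \<zeta> \<epsilon> y \<longleftrightarrow> \<epsilon> > 0 \<and> holomorphic_fun_on y {x. A x \<in> ball (A x1) \<epsilon>} \<and>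
      (\<forall>x x'. A x = A x' \<longrightarrow> y x = y x') \<and>
      (\<forall>x. A x \<in> ball (A x1) \<epsilon> \<longrightarrow> disc_roots (\<lambda>\<zeta>. f (A x + \<zeta> *s v)) \<zeta> \<eta> \<noteq> {}) \<and>
      (\<forall>x \<xi>. A x \<in> ball (A x1) \<epsilon> \<longrightarrow> disc_roots (\<lambda>\<zeta>. f (A x + \<zeta> *s v)) \<zeta> \<eta> = {\<xi>} \<longrightarrow> y x = \<xi>)"
    for \<zeta> \<epsilon> y
  have "\<forall>\<zeta>\<in>Z1. \<exists>\<epsilon> y. branch \<zeta> \<epsilon> y"
  proof
    fix \<zeta> assume \<zeta>: "\<zeta> \<in> Z1"
    have sub': "A x1 + w *s v \<in> \<Omega>" if "w \<in> cball \<zeta> (2 * \<eta>)" for w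
      using sub[OF x1U disc[OF \<zeta>]] that by simp
    have nz': "f (A x1 + w *s v) \<noteq> 0" if w: "norm (w - \<zeta>) = \<eta>" for w
    proof
      assume "f (A x1 + w *s v) = 0"
      moreover have "w \<in> ball c r" by (rule disc[OF \<zeta>]) (use w \<eta> in \<open>simp add: dist_norm norm_minus_commute\<close>)
      ultimately have "w \<in> Z1" by (simp add: Z1_def disc_roots_def)
      then show False using \<eta>2[OF \<zeta>, of w] w \<eta> by (cases "w = \<zeta>") (auto simp: dist_norm norm_minus_commute)
    qed
    have \<eta>\<eta>: "\<eta> < 2 * \<eta>" using \<eta> by simp
    show "\<exists>\<epsilon> y. branch \<zeta> \<epsilon> y"
      unfolding branch_def
      by (rule local_root_function[OF A f \<Omega> \<eta> \<eta>\<eta> sub' Z1(2)[OF \<zeta>] nz']) blast+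
  qed
  from bchoice[OF this] obtain E where "\<forall>\<zeta>\<in>Z1. \<exists>y. branch \<zeta> (E \<zeta>) y" ..
  from bchoice[OF this] obtain Y where "\<forall>\<zeta>\<in>Z1. branch \<zeta> (E \<zeta>) (Y \<zeta>)" ..
  note EY = this[unfolded branch_def, rule_format]
  define V1 where "V1 = U \<inter> (\<Inter>\<zeta>\<in>Z1. A -` ball (A x1) (E \<zeta>))"
  have openV1: "open V1"
    unfolding V1_def using clinear_mapD(7)[OF A, of UNIV]
    by (intro open_Int U open_INT finZ1 ballI open_vimage) auto
  have x1V1: "x1 \<in> V1" using x1U EY by (auto simp: V1_def)
  have AV1: "A x \<in> V1 \<longleftrightarrow> x \<in> V1" for x by (auto simp: V1_def U AA)
  have holY: "holomorphic_fun_on (Y \<zeta>) V1" if "\<zeta> \<in> Z1" for \<zeta>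
    by (rule holomorphic_fun_on_subset[of _ "{x. A x \<in> ball (A x1) (E \<zeta>)}"]) (use EY that in \<open>auto simp: V1_def\<close>)
  have AY: "Y \<zeta> x = Y \<zeta> x'" if "\<zeta> \<in> Z1" "A x = A x'" for \<zeta> x x' using EY that by blast
  \<comment> \<open>Each of the disjoint small discs keeps at least one root near \<open>x1\<close>.
    The number of roots over points of \<open>T\<close> is maximal at \<open>x1\<close>, so each
    disc contains exactly one and there are no others.\<close>
  have single: "disc_roots (\<lambda>\<zeta>. f (A x + \<zeta> *s v)) \<zeta> \<eta> = {Y \<zeta> x}" and all: "?Z x = (\<lambda>\<zeta>. Y \<zeta> x) ` Z1"
    if x: "x \<in> V1" "x \<in> T" and \<zeta>: "\<zeta> \<in> Z1" for x \<zeta>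
  proof -
    let ?d = "\<lambda>\<zeta>. disc_roots (\<lambda>\<zeta>. f (A x + \<zeta> *s v)) \<zeta> \<eta>"
    have xb: "A x \<in> ball (A x1) (E \<zeta>)" if "\<zeta> \<in> Z1" for \<zeta> using x that by (auto simp: V1_def)
    have "\<forall>\<zeta>\<in>Z1. \<exists>\<xi>. \<xi> \<in> ?d \<zeta>" using EY xb by blast
    from bchoice[OF this] obtain G where G: "\<And>\<zeta>. \<zeta> \<in> Z1 \<Longrightarrow> G \<zeta> \<in> ?d \<zeta>" by blast
    have Gb: "G \<zeta> \<in> ball \<zeta> \<eta>" if "\<zeta> \<in> Z1" for \<zeta> using G[OF that] by (simp add: disc_roots_def)
    have dZ: "?d \<zeta> \<subseteq> ?Z x" if "\<zeta> \<in> Z1" for \<zeta>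
      using disc[OF that] \<eta> by (auto simp: disc_roots_def)
    have inj: "inj_on G Z1"
    proof (rule inj_onI)
      fix \<zeta> \<zeta>' assume *: "\<zeta> \<in> Z1" "\<zeta>' \<in> Z1" "G \<zeta> = G \<zeta>'"
      show "\<zeta> = \<zeta>'" by (rule disj[OF *(1,2) Gb[OF *(1)]]) (use Gb[OF *(2)] *(3) in simp)
    qed
    have "G ` Z1 = ?Z x"
    proof (rule card_subset_eq)
      show "finite (?Z x)" using bound(1) TU x by blast
      show "G ` Z1 \<subseteq> ?Z x" using G dZ by blast
      then have "card (G ` Z1) \<le> card (?Z x)" using \<open>finite (?Z x)\<close> card_mono by blast
      moreover have "card (?Z x) \<le> card (G ` Z1)" using x1(2)[OF x(2)] card_image[OF inj] by (simp add: Z1_def)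
      ultimately show "card (G ` Z1) = card (?Z x)" by simp
    qed
    have d: "?d \<zeta> = {G \<zeta>}" if mem: "\<zeta> \<in> Z1" for \<zeta>
    proof
      show "{G \<zeta>} \<subseteq> ?d \<zeta>" using G[OF that] by simp
      show "?d \<zeta> \<subseteq> {G \<zeta>}"
      proof
        fix \<xi> assume \<xi>: "\<xi> \<in> ?d \<zeta>"
        then obtain \<zeta>' where \<zeta>': "\<zeta>' \<in> Z1" "\<xi> = G \<zeta>'" using dZ[OF mem] \<open>G ` Z1 = ?Z x\<close> by blast
        have "\<xi> \<in> ball \<zeta> \<eta>" using \<xi> by (simp add: disc_roots_def)
        then have "\<zeta> = \<zeta>'" using disj[OF that \<zeta>'(1), of \<xi>] Gb[OF \<zeta>'(1)] \<zeta>'(2) by simp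
        then show "\<xi> \<in> {G \<zeta>}" using \<zeta>' by simp
      qed
    qed
    have YG: "Y \<zeta> x = G \<zeta>" if "\<zeta> \<in> Z1" for \<zeta> using EY[OF that] xb[OF that] d[OF that] by blast
    show "?d \<zeta> = {Y \<zeta> x}" using d YG \<zeta> by simp
    show "?Z x = (\<lambda>\<zeta>. Y \<zeta> x) ` Z1" unfolding \<open>G ` Z1 = ?Z x\<close>[symmetric] by (rule image_cong) (simp_all add: YG)
  qed
  define a where "a x = {\<zeta> \<in> Z1. \<forall>i<k. g i (A x + Y \<zeta> x *s v) = 0}" for x
  \<comment> \<open>Minimality is the right choice because failing to be a common root is an open
    condition: near \<open>x0\<close> the set \<open>a x\<close> can only shrink, and minimality
    then forbids that.\<close>
  obtain x0 where x0: "x0 \<in> V1" "x0 \<in> T" "\<And>x. x \<in> V1 \<Longrightarrow> x \<in> T \<Longrightarrow> card (a x0) \<le> card (a x)"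
    using ex_has_least_nat[of "\<lambda>x. x \<in> V1 \<and> x \<in> T" x1 "\<lambda>x. card (a x)"] x1V1 x1(1) by blast
  have Yball: "Y \<zeta> x \<in> ball \<zeta> \<eta>" if "x \<in> V1" "x \<in> T" "\<zeta> \<in> Z1" for x \<zeta>
    using single[OF that] by (auto simp: disc_roots_def)
  have "\<forall>\<zeta>\<in>Z1 - a x0. \<exists>i<k. g i (A x0 + Y \<zeta> x0 *s v) \<noteq> 0" by (auto simp: a_def)
  from bchoice[OF this] obtain I where I: "\<And>\<zeta>. \<zeta> \<in> Z1 - a x0 \<Longrightarrow> I \<zeta> < k \<and> g (I \<zeta>) (A x0 + Y \<zeta> x0 *s v) \<noteq> 0"
    by blast
  \<comment> \<open>Off \<open>T\<close> the branch \<open>Y \<zeta>\<close> is only a mean of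
    roots. Restricting it to the disc around \<zeta> keeps \<open>A x + Y \<zeta> x *s v\<close> in
    the domain of \<open>g\<close>.\<close>
  define V2 where "V2 \<zeta> = V1 \<inter> Y \<zeta> -` ball \<zeta> \<eta>" for \<zeta>
  have openV2: "open (V2 \<zeta>)" if "\<zeta> \<in> Z1" for \<zeta>
    unfolding V2_def by (rule continuous_open_preimage[OF holomorphic_fun_on_imp_continuous_on[OF holY[OF that]] openV1 open_ball])
  define V3 where "V3 \<zeta> = V2 \<zeta> \<inter> (\<lambda>x. g (I \<zeta>) (A x + Y \<zeta> x *s v)) -` (- {0})" for \<zeta>
  have openV3: "open (V3 \<zeta>)" if \<zeta>: "\<zeta> \<in> Z1 - a x0" for \<zeta>
    unfolding V3_def
  proof (rule continuous_open_preimage[OF _ openV2])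
    show "continuous_on (V2 \<zeta>) (\<lambda>x. g (I \<zeta>) (A x + Y \<zeta> x *s v))"
    proof (rule continuous_on_compose2[OF holomorphic_fun_on_imp_continuous_on[OF g]])
      show "I \<zeta> < k" using I[OF \<zeta>] by blast
      show "continuous_on (V2 \<zeta>) (\<lambda>x. A x + Y \<zeta> x *s v)"
        by (intro continuous_intros clinear_mapD(7)[OF A] continuous_on_subset[OF holomorphic_fun_on_imp_continuous_on[OF holY]])
          (use \<zeta> in \<open>auto simp: V2_def\<close>)
      show "(\<lambda>x. A x + Y \<zeta> x *s v) ` V2 \<zeta> \<subseteq> \<Omega>"
      proof
        fix z assume "z \<in> (\<lambda>x. A x + Y \<zeta> x *s v) ` V2 \<zeta>"
        then obtain x where x: "x \<in> V1" "Y \<zeta> x \<in> ball \<zeta> \<eta>" "z = A x + Y \<zeta> x *s v" by (auto simp: V2_def)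
        have "Y \<zeta> x \<in> ball c r" by (rule disc[of \<zeta>]) (use \<zeta> x \<eta> in auto)
        moreover have "x \<in> U" using x by (simp add: V1_def)
        ultimately show "z \<in> \<Omega>" using sub x(3) by blast
      qed
    qed
  qed (use \<zeta> in auto)
  define V where "V = V1 \<inter> (\<Inter>\<zeta>\<in>Z1 - a x0. V3 \<zeta>)"
  have openV: "open V" unfolding V_def by (intro open_Int openV1 open_INT openV3 ballI finite_Diff finZ1)
  have x0V: "x0 \<in> V" using x0 I Yball by (auto simp: V_def V3_def V2_def)
  have AV: "A x \<in> V \<longleftrightarrow> x \<in> V" for x
  proof -
    have "Y \<zeta> (A x) = Y \<zeta> x" if "\<zeta> \<in> Z1" for \<zeta> by (rule AY[OF that AA])
    then show ?thesis by (auto simp: V_def V3_def V2_def AV1 AA)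
  qed
  have a_eq: "a x = a x0" if x: "x \<in> V" "x \<in> T" for x
  proof (rule card_seteq)
    show "finite (a x0)" using finZ1 by (simp add: a_def)
    show "a x \<subseteq> a x0"
    proof
      fix \<zeta> assume \<zeta>: "\<zeta> \<in> a x"
      show "\<zeta> \<in> a x0"
      proof (rule ccontr)
        assume "\<zeta> \<notin> a x0"
        then have "\<zeta> \<in> Z1 - a x0" using \<zeta> by (simp add: a_def)
        then have "x \<in> V3 \<zeta>" "I \<zeta> < k" using x(1) I by (auto simp: V_def)
        then show False using \<zeta> by (auto simp: V3_def a_def)
      qed
    qed
    show "card (a x0) \<le> card (a x)" using x0(3)[of x] x by (simp add: V_def)
  qed
  \<comment> \<open>A common root over \<open>x0\<close> exists because \<open>x0 \<in> T\<close>,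
    and every root over \<open>x0\<close> lies on one of the branches.\<close>
  have "a x0 \<noteq> {}"
  proof -
    obtain \<xi> where \<xi>: "\<xi> \<in> ?Z x0" "\<forall>i<k. g i (A x0 + \<xi> *s v) = 0" using x0(2) T(1) by blast
    have "Z1 \<noteq> {}" using x1(1) T(1) by (auto simp: Z1_def)
    then have "?Z x0 = (\<lambda>\<zeta>. Y \<zeta> x0) ` Z1" using all[OF x0(1,2)] by blast
    then show ?thesis using \<xi> by (auto simp: a_def)
  qed
  then obtain \<zeta>0 where \<zeta>0: "\<zeta>0 \<in> a x0" by blast
  have \<zeta>0Z: "\<zeta>0 \<in> Z1" using \<zeta>0 by (simp add: a_def)
  show ?thesis
  proof (rule that[of x0 V "Y \<zeta>0" \<zeta>0 \<eta>])
    show "V \<subseteq> U" by (auto simp: V_def V1_def)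
    show "holomorphic_fun_on (Y \<zeta>0) V" by (rule holomorphic_fun_on_subset[OF holY[OF \<zeta>0Z]]) (auto simp: V_def)
    show "ball \<zeta>0 \<eta> \<subseteq> ball c r" using disc[OF \<zeta>0Z] \<eta> by auto
    show "g i (A x + Y \<zeta>0 x *s v) = 0" if "x \<in> V" "x \<in> T" "i < k" for x i
      using a_eq[OF that(1,2)] \<zeta>0 that(3) by (auto simp: a_def)
    show "\<zeta> = Y \<zeta>0 x" if "x \<in> V" "x \<in> T" "\<zeta> \<in> ball \<zeta>0 \<eta>" "f (A x + \<zeta> *s v) = 0" for x \<zeta>
      using single[of x \<zeta>0] that \<zeta>0Z by (auto simp: V_def disc_roots_def)
    show "Y \<zeta>0 x \<in> ball \<zeta>0 \<eta>" if "x \<in> V" "x \<in> T" for x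
      using Yball[OF _ that(2) \<zeta>0Z] that(1) by (simp add: V_def)
    show "x0 \<in> T" "open V" "x0 \<in> V" by (rule x0(2) openV x0V)+
    show "A x \<in> V \<longleftrightarrow> x \<in> V" for x by (rule AV)
    show "Y \<zeta>0 x = Y \<zeta>0 x'" if "A x = A x'" for x x' by (rule AY[OF \<zeta>0Z that])
  qed
qed

section \<open>Regular points of analytic sets\<close>

lemma derivative_zero_of_invariant:
  fixes h :: "complex^'m \<Rightarrow> complex"
  assumes h: "(h has_derivative h') (at z)" and inv: "\<And>t::real. h (z + t *\<^sub>R u) = h z"
  shows "h' u = 0"
proof -
  have "((\<lambda>t::real. z + t *\<^sub>R u) has_derivative (\<lambda>t. t *\<^sub>R u)) (at 0)"
    by (auto intro!: derivative_eq_intros)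
  from has_derivative_compose[OF this, of h h'] h
  have "((\<lambda>t::real. h (z + t *\<^sub>R u)) has_derivative (\<lambda>t. h' (t *\<^sub>R u))) (at 0)" by simp
  then have "((\<lambda>t::real. h z) has_derivative (\<lambda>t. h' (t *\<^sub>R u))) (at 0)" by (simp only: inv)
  from fun_cong[OF has_derivative_unique[OF this has_derivative_const], of 1] show ?thesis by simp
qed

lemma frechet_derivative_zero_of_invariant:
  fixes h :: "complex^'m \<Rightarrow> complex"
  assumes h: "holomorphic_fun_on h U" "z \<in> U" and U: "\<And>z. P z \<in> U \<longleftrightarrow> z \<in> U" and P: "clinear_map P"
    and inv: "\<And>z z'. z \<in> U \<Longrightarrow> P z = P z' \<Longrightarrow> h z = h z'" and u: "P u = 0"
  shows "frechet_derivative h (at z) u = 0"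
proof (rule derivative_zero_of_invariant[OF holomorphic_fun_on_frechet(1)[OF h]])
  fix t :: real
  have "P (z + t *\<^sub>R u) = P z"
    using u clinear_mapD(3)[OF P] linear_scale[OF clinear_mapD(1)[OF P]] by simp
  then show "h (z + t *\<^sub>R u) = h z" using inv[OF h(2), of "z + t *\<^sub>R u"] by simp
qed

text \<open>An injective derivative at one point embeds the tangent space into
  \<open>range P\<close>, and real dimensions are compared. If the derivative is injective nowhere,
  a flow box yields points different from \<open>q\<close>, arbitrarily near it, in one
  fibre.\<close>

lemma discrete_fibres_dim:
  fixes H :: "complex^'m \<Rightarrow> complex^'k" and P :: "complex^'k \<Rightarrow> complex^'k"
  assumes P: "clinear_map P" "dim (range P) = 2 * c"
    and W: "open W" "W \<noteq> {}" and H: "holomorphic_map_on H W" "\<And>w. w \<in> W \<Longrightarrow> P (H w) = H w"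
    and disc: "\<And>w. w \<in> W \<Longrightarrow> \<forall>\<^sub>F w' in at w. H w' \<noteq> H w"
  shows "CARD('m) \<le> c"
proof (cases "\<exists>w\<in>W. \<forall>u. map_deriv H w u = 0 \<longrightarrow> u = 0")
  case True
  then obtain w where w: "w \<in> W" "\<And>u. map_deriv H w u = 0 \<Longrightarrow> u = 0" by blast
  note D = holomorphic_map_on_map_deriv[OF H(1) w(1)]
  have inj: "inj (map_deriv H w)"
    using w(2) linear_injective_0[OF D(3)] by blast
  have "((\<lambda>w. P (H w)) has_derivative (\<lambda>u. P (map_deriv H w u))) (at w)"
    by (rule has_derivative_compose[OF D(1) bounded_linear_imp_has_derivative[OF clinear_mapD(6)[OF P(1)]]])
  then have "(H has_derivative (\<lambda>u. P (map_deriv H w u))) (at w)"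
    by (rule has_derivative_transform_within_open[OF _ W(1) w(1)]) (use H(2) in auto)
  from fun_cong[OF has_derivative_unique[OF this D(1)]]
  have fixed: "P (map_deriv H w u) = map_deriv H w u" for u .
  have "range (map_deriv H w) \<subseteq> range P"
  proof
    fix y assume "y \<in> range (map_deriv H w)"
    then have "y = P y" using fixed by auto
    then show "y \<in> range P" by (rule range_eqI)
  qed
  then have "dim (range (map_deriv H w)) \<le> 2 * c" using P(2) dim_subset[of "range (map_deriv H w)" "range P"] by simp
  moreover have "dim (range (map_deriv H w)) = dim (UNIV :: (complex^'m) set)"
    by (rule dim_image_eq[OF D(3)]) (use inj in simp)
  ultimately show ?thesis by simp
next
  case False
  then have sing: "\<And>w. w \<in> W \<Longrightarrow> \<exists>u. u \<noteq> 0 \<and> map_deriv H w u = 0" by blast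
  show ?thesis
  proof (rule constant_rank_flow[OF H(1) W sing], assumption)
    fix D a
    assume "\<exists>z\<in>W. D z \<noteq> 0"
    then obtain q where q: "q \<in> W" "D q \<noteq> 0" by blast
    assume "\<And>q. q \<in> W \<Longrightarrow> D q \<noteq> 0 \<Longrightarrow> \<exists>V \<gamma> \<epsilon>. flow_box H W (a q) q V \<gamma> \<epsilon>"
    from this[OF q] obtain V and \<gamma> :: "complex^'m \<Rightarrow> complex \<Rightarrow> complex^'m" and \<epsilon> where
      V: "q \<in> V" "\<epsilon> > 0" "\<forall>z\<in>V. \<forall>t\<in>ball 0 \<epsilon>. \<gamma> z t \<in> W \<and> H (\<gamma> z t) = H z"
      "\<gamma> q 0 = q" "\<forall>t\<in>ball 0 \<epsilon>. t \<noteq> 0 \<longrightarrow> \<gamma> q t \<noteq> q" "((\<gamma> q) has_derivative (\<lambda>t. t *s a q)) (at 0)"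
      unfolding flow_box_def by blast
    have ev: "\<forall>\<^sub>F t in at 0. t \<in> ball (0::complex) \<epsilon> \<and> t \<noteq> 0"
      using V(2) by (auto simp: eventually_at intro!: exI[of _ \<epsilon>] simp: dist_commute)
    have "filterlim (\<gamma> q) (at q) (at 0)"
      unfolding filterlim_at
    proof
      show "(\<gamma> q \<longlongrightarrow> q) (at 0)"
        using has_derivative_continuous[OF V(6)] V(4) by (simp add: continuous_at)
      show "\<forall>\<^sub>F t in at 0. \<gamma> q t \<in> UNIV \<and> \<gamma> q t \<noteq> q"
        using ev by (rule eventually_mono) (use V(5) in blast)
    qed
    then have "\<forall>\<^sub>F t in at 0. H (\<gamma> q t) \<noteq> H q" using disc[OF q(1)] unfolding filterlim_iff by blast
    then have "\<forall>\<^sub>F t in at (0::complex). False" using ev by eventually_elim (use V in blast)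
    then show ?thesis by simp
  qed
qed

text \<open>The functional \<open>l\<close> reads off a coordinate in which \<open>v\<close> is
  nonzero, normalised by \<open>l v = 1\<close>, and \<open>P'\<close> is \<open>P\<close> minus its
  \<open>v\<close>-component. This is the passage to complex dimension \<open>c - 1\<close> in the
  induction.\<close>

lemma split_line_off_projection:
  fixes P :: "complex^'k \<Rightarrow> complex^'k"
  assumes P: "clinear_map P" "\<And>z. P (P z) = P z" and v: "P v = v" "v \<noteq> 0"
  obtains l P' where "holomorphic_fun_on l UNIV" "\<And>x y. l (x + y) = l x + l y" "\<And>c x. l (c *s x) = c * l x"
    "l v = 1" "\<And>z. l (P z) = l z" "clinear_map P'" "\<And>z. P' (P' z) = P' z" "\<And>z. P' (P z) = P' z" "P' v = 0"
    "\<And>z. l (P' z) = 0" "\<And>z. P z = P' z + l z *s v" "dim (range P) = dim (range P') + 2"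
proof -
  obtain j where j: "v $ j \<noteq> 0" using v(2) by (auto simp: vec_eq_iff)
  define l where "l z = P z $ j / v $ j" for z
  define P' where "P' z = P z - l z *s v" for z
  note Pl = clinear_mapD[OF P(1)]
  have hol: "holomorphic_fun_on l UNIV"
    unfolding l_def using clinear_map_holomorphic[OF P(1), of UNIV] j
    by (intro holomorphic_fun_on_divide holomorphic_fun_on_const) (auto simp: holomorphic_map_on_def)
  have add: "l (x + y) = l x + l y" and scale: "l (c *s x) = c * l x" and lv: "l v = 1" and lP: "l (P z) = l z" for x y c z
    using j v(1) by (simp_all add: l_def Pl(2,3) P(2) add_divide_distrib)
  have P'_add: "P' (x + y) = P' x + P' y" and P'_scale: "P' (c *s x) = c *s P' x" for x y c
    by (simp_all add: P'_def Pl(2,3) add scale vec_eq_iff algebra_simps)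
  have P': "clinear_map P'"
    unfolding clinear_map_def linear_iff by (simp add: P'_add P'_scale scaleR_eq_scale_vec)
  have P'v: "P' v = 0" by (simp add: P'_def v lv)
  have P'P: "P' (P z) = P' z" for z by (simp add: P'_def P(2) lP)
  have dec: "P z = P' z + l z *s v" for z by (simp add: P'_def)
  have P'P': "P' (P' z) = P' z" for z
  proof -
    have "P' (P z) = P' (P' z) + l z *s P' v" by (subst dec) (simp add: P'_add P'_scale)
    then show ?thesis by (simp add: P'P P'v)
  qed
  have lP': "l (P' z) = 0" for z
  proof -
    have "l (P z) = l (P' z) + l z * l v" by (subst dec) (simp add: add scale)
    then show ?thesis by (simp add: lP lv)
  qed
  have sub': "subspace (range P')" using linear_subspace_image[OF clinear_mapD(1)[OF P'] subspace_UNIV] .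
  have sub: "subspace (range P)" using linear_subspace_image[OF Pl(1) subspace_UNIV] .
  have kernel: "x = 0" if mem: "x \<in> range P'" "P' x = 0" for x
  proof -
    obtain z where "x = P' z" using mem(1) by blast
    then show ?thesis using mem(2) P'P'[of z] by simp
  qed
  have scale_zero: "c = 0" if "c *s v = 0" for c
    using arg_cong[OF that, of norm] v(2) by (simp add: norm_scale_vec)
  have iv: "\<i> *s v \<notin> range P'"
  proof
    assume "\<i> *s v \<in> range P'"
    from scale_zero[OF kernel[OF this]] show False by (simp add: P'_scale P'v)
  qed
  \<comment> \<open>\<open>P'\<close> fixes its range and kills complex multiples of
    \<open>v\<close>. Hence \<open>v\<close> and \<open>\<i> *s v\<close> contribute two further
    real dimensions.\<close>
  have "v \<notin> span (insert (\<i> *s v) (range P'))"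
  proof
    assume "v \<in> span (insert (\<i> *s v) (range P'))"
    then obtain k where "v - k *\<^sub>R (\<i> *s v) \<in> span (range P')" unfolding span_insert by blast
    then have "v - k *\<^sub>R (\<i> *s v) \<in> range P'" using sub' span_eq_iff by blast
    moreover have eq: "v - k *\<^sub>R (\<i> *s v) = (1 - of_real k * \<i>) *s v"
      by (simp add: scaleR_eq_scale_vec vec_eq_iff algebra_simps)
    ultimately have "(1 - of_real k * \<i>) *s v \<in> range P'" by (simp only:)
    then have "(1 - of_real k * \<i>) *s v = 0" by (rule kernel) (simp only: P'_scale P'v vector_smult_rzero)
    then have "1 - of_real k * \<i> = 0" by (rule scale_zero)
    then show False by (simp add: complex_eq_iff)
  qed
  moreover have "range P = span (insert v (insert (\<i> *s v) (range P')))"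
  proof
    show "range P \<subseteq> span (insert v (insert (\<i> *s v) (range P')))"
    proof
      fix y assume "y \<in> range P"
      then obtain z where z: "y = P z" by blast
      have "l z *s v = Re (l z) *\<^sub>R v + Im (l z) *\<^sub>R (\<i> *s v)"
        unfolding scaleR_eq_scale_vec by (simp add: vec_eq_iff complex_eq_iff)
      then have "y = P' z + (Re (l z) *\<^sub>R v + Im (l z) *\<^sub>R (\<i> *s v))" using z dec by simp
      then show "y \<in> span (insert v (insert (\<i> *s v) (range P')))"
        by (auto intro!: span_add span_scale intro: span_base)
    qed
    have "P' z \<in> range P" for z by (rule range_eqI[of _ _ "P' z"]) (simp add: dec[of "P' z"] P'P' lP')
    moreover have "\<i> *s v \<in> range P" by (rule range_eqI[of _ _ "\<i> *s v"]) (simp add: Pl(2) v(1))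
    moreover have "v \<in> range P" by (rule range_eqI[of _ _ v]) (simp add: v(1))
    ultimately have "insert v (insert (\<i> *s v) (range P')) \<subseteq> range P" by blast
    then show "span (insert v (insert (\<i> *s v) (range P'))) \<subseteq> range P" using sub by (rule span_minimal)
  qed
  ultimately have "dim (range P) = dim (range P') + 2"
    using iv sub' by (simp add: dim_insert span_eq_iff[THEN iffD2])
  then show ?thesis
    by (rule that[OF hol add scale lv lP P' P'P' P'P P'v lP' dec])
qed

text \<open>Independence is witnessed by constant vectors dual to the differentials, a form that survives adding
  the equation of a graph.\<close>

definition straight_equations :: "nat \<Rightarrow> (nat \<Rightarrow> complex^'k \<Rightarrow> complex) \<Rightarrow> (nat \<Rightarrow> complex^'k) \<Rightarrow> (complex^'k) set \<Rightarrow> bool" where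
  "straight_equations r h s U \<longleftrightarrow> (\<forall>l<r. holomorphic_fun_on (h l) U) \<and>
     (\<forall>z\<in>U. \<forall>l<r. \<forall>l'<r. frechet_derivative (h l) (at z) (s l') = (if l = l' then 1 else 0))"

text \<open>The last equation \<open>l z = y z\<close> is composed with \<open>G\<close>, which is the identity on the common zeros of the
  other equations and whose derivative kills their dual vectors.\<close>

lemma straight_equations_graph:
  fixes P P' :: "complex^'k \<Rightarrow> complex^'k" and l y :: "complex^'k \<Rightarrow> complex"
  assumes eqs: "straight_equations r h s U" and U: "open U" "\<And>z. P' z \<in> U \<longleftrightarrow> z \<in> U"
    and h_inv: "\<And>j z. j < r \<Longrightarrow> z \<in> U \<Longrightarrow> h j (P' z) = h j z"
    and P': "clinear_map P'" "\<And>z. P' (P' z) = P' z" "P' v = 0" and P: "\<And>z. P' (P z) = P' z"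
    and l: "holomorphic_fun_on l UNIV" "\<And>x y. l (x + y) = l x + l y" "\<And>c x. l (c *s x) = c * l x" "l v = 1" "\<And>z. l (P z) = l z"
    and V: "open V" "V \<subseteq> U" "\<And>z. P' z \<in> V \<longleftrightarrow> z \<in> V"
    and y: "holomorphic_fun_on y V" "\<And>z z'. P' z = P' z' \<Longrightarrow> y z = y z'"
    and B: "open B"
  obtains U1 h1 s1 where "open U1" "U1 \<subseteq> V" "\<And>z. z \<in> U1 \<Longrightarrow> l z \<in> B"
    "\<And>z. P z \<in> U1 \<longleftrightarrow> z \<in> U1" "straight_equations (Suc r) h1 s1 U1" "\<And>j z. j < Suc r \<Longrightarrow> z \<in> U1 \<Longrightarrow> h1 j (P z) = h1 j z"
    "\<And>z. z \<in> U1 \<Longrightarrow> (\<forall>j<Suc r. h1 j z = 0) \<longleftrightarrow> (\<forall>j<r. h j z = 0) \<and> l z = y z"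
    "\<And>z. z \<in> V \<Longrightarrow> l z \<in> B \<Longrightarrow> (\<forall>j<r. h j z = 0) \<Longrightarrow> z \<in> U1"
proof -
  \<comment> \<open>The dual vectors are moved into the kernel of \<open>l\<close>. They remain
    dual, since the old equations are \<open>P'\<close>-invariant and thus have zero derivative
    along \<open>v\<close>.\<close>
  define s' where "s' j = s j - l (s j) *s v" for j
  define G where "G z = z - (\<Sum>j<r. h j z *s s' j)" for z
  define h1 where "h1 j = (if j < r then h j else (\<lambda>z. l z - y (G z)))" for j
  define s1 where "s1 j = (if j < r then s' j else v)" for j
  \<comment> \<open>The preimage under \<open>G\<close> ensures that \<open>y (G z)\<close> is
    evaluated where \<open>y\<close> is holomorphic.\<close>
  define U1 where "U1 = (V \<inter> G -` V) \<inter> l -` B"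
  have P'l: "P' (x + y) = P' x + P' y" "P' (c *s x) = c *s P' x" "P' (x - y) = P' x - P' y" for x y c
    using clinear_mapD[OF P'(1)] by auto
  have l_diff: "l (x - y) = l x - l y" for x y
    using l(2)[of "x - y" y] by simp
  have ls': "l (s' j) = 0" for j by (simp add: s'_def l_diff l(3,4))
  have holh: "holomorphic_fun_on (h j) U" if "j < r" for j using eqs that by (auto simp: straight_equations_def)
  have h_inv': "h j z = h j z'" if "j < r" "z \<in> U" "P' z = P' z'" for j z z'
  proof -
    have "z' \<in> U" using that(2,3) U(2)[of z] U(2)[of z'] by simp
    then show ?thesis using h_inv[OF that(1,2)] h_inv[OF that(1), of z'] that(3) by simp
  qed
  have Dh_ker: "frechet_derivative (h j) (at z) u = 0" if "j < r" "z \<in> U" "P' u = 0" for j z u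
    by (rule frechet_derivative_zero_of_invariant[OF holh[OF that(1)] that(2) U(2) P'(1) h_inv'[OF that(1)] that(3)])
  have Dh_s: "frechet_derivative (h j) (at z) (s' i) = (if j = i then 1 else 0)" if "j < r" "i < r" "z \<in> U" for j i z
  proof -
    have lin: "linear (frechet_derivative (h j) (at z))" by (rule holomorphic_fun_on_frechet(3)[OF holh[OF that(1)] that(3)])
    have "frechet_derivative (h j) (at z) (s' i) = frechet_derivative (h j) (at z) (s i) - frechet_derivative (h j) (at z) (l (s i) *s v)"
      unfolding s'_def by (rule linear_diff[OF lin])
    also have "frechet_derivative (h j) (at z) (l (s i) *s v) = 0"
      by (rule Dh_ker[OF that(1,3)]) (simp add: P'l P'(3))
    finally show ?thesis using eqs that by (simp add: straight_equations_def)
  qed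
  have holG: "holomorphic_map_on G U"
    unfolding holomorphic_map_on_def
  proof
    fix i
    have "holomorphic_fun_on (\<lambda>z. z $ i - (\<Sum>j<r. h j z * s' j $ i)) U"
      by (intro holomorphic_fun_on_diff holomorphic_fun_on_nth holomorphic_fun_on_sum holomorphic_fun_on_mult
          holomorphic_fun_on_const holh) auto
    then show "holomorphic_fun_on (\<lambda>z. G z $ i) U" by (simp add: G_def)
  qed
  have contG: "continuous_on V G" using holomorphic_map_on_imp_continuous_on[OF holG] V(2) continuous_on_subset by blast
  have DG: "(G has_derivative (\<lambda>u. u - (\<Sum>j<r. frechet_derivative (h j) (at z) u *s s' j))) (at z)" if "z \<in> U" for z
    unfolding G_def
    by (intro has_derivative_diff has_derivative_ident has_derivative_sum has_derivative_scale_vec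
        holomorphic_fun_on_frechet(1)[OF holh that]) auto
  have V_inv: "z' \<in> V" if "z \<in> V" "P' z = P' z'" for z z'
    using that V(3)[of z] V(3)[of z'] by simp
  have G_inv: "P' (G z) = P' (G z')" if "z \<in> U" "P' z = P' z'" for z z'
  proof -
    have "P' (G z) = P' z - P' (\<Sum>j<r. h j z *s s' j)" "P' (G z') = P' z' - P' (\<Sum>j<r. h j z' *s s' j)"
      by (simp_all add: G_def P'l)
    moreover have "(\<Sum>j<r. h j z *s s' j) = (\<Sum>j<r. h j z' *s s' j)"
      using h_inv'[OF _ that] by (intro sum.cong) auto
    ultimately show ?thesis using that(2) by simp
  qed
  have G_id: "G z = z" if "\<forall>j<r. h j z = 0" for z using that by (simp add: G_def)
  have PV: "P' (P z) = P' z" for z by (rule P)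
  have PU1: "P z \<in> U1 \<longleftrightarrow> z \<in> U1" for z
  proof -
    have 1: "P z \<in> V \<longleftrightarrow> z \<in> V" using V(3)[of z] V(3)[of "P z"] PV[of z] by simp
    have 2: "G (P z) \<in> V \<longleftrightarrow> G z \<in> V" if "z \<in> V"
    proof -
      have "P' (G z) = P' (G (P z))" using that V(2) PV[of z] by (intro G_inv) auto
      then show ?thesis using V(3)[of "G z"] V(3)[of "G (P z)"] by simp
    qed
    show ?thesis using 1 2 l(5) by (auto simp: U1_def)
  qed
  have U1V: "U1 \<subseteq> V" by (auto simp: U1_def)
  show ?thesis
  proof (rule that[of U1 h1 s1])
    show "open U1"
      unfolding U1_def
      by (intro open_Int continuous_open_preimage[OF contG V(1) V(1)] open_vimage B holomorphic_fun_on_imp_continuous_on[OF l(1)])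
    show "U1 \<subseteq> V" by (rule U1V)
    show "l z \<in> B" if "z \<in> U1" for z using that by (simp add: U1_def)
    show "P z \<in> U1 \<longleftrightarrow> z \<in> U1" for z by (rule PU1)
    show "h1 j (P z) = h1 j z" if "j < Suc r" "z \<in> U1" for j z
    proof -
      have zU: "z \<in> U" using that U1V V(2) by blast
      show ?thesis
      proof (cases "j < r")
        case True
        then show ?thesis using h_inv'[OF True zU PV[symmetric]] by (simp add: h1_def)
      next
        case False
        then show ?thesis using y(2)[OF G_inv[OF zU PV[symmetric]]] l(5) by (simp add: h1_def)
      qed
    qed
    show "(\<forall>j<Suc r. h1 j z = 0) \<longleftrightarrow> (\<forall>j<r. h j z = 0) \<and> l z = y z" if "z \<in> U1" for z
      unfolding All_less_Suc h1_def using G_id[of z] by auto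
    show "z \<in> U1" if "z \<in> V" "l z \<in> B" "\<forall>j<r. h j z = 0" for z
      using that G_id[OF that(3)] by (simp add: U1_def)
    show "straight_equations (Suc r) h1 s1 U1"
      unfolding straight_equations_def
    proof (intro conjI allI impI ballI)
      fix j assume j: "j < Suc r"
      show "holomorphic_fun_on (h1 j) U1"
      proof (cases "j < r")
        case True
        then show ?thesis using holomorphic_fun_on_subset[OF holh[OF True]] U1V V(2) by (auto simp: h1_def)
      next
        case False
        have "holomorphic_fun_on (\<lambda>z. y (G z)) U1"
          by (rule holomorphic_fun_on_compose[OF holomorphic_map_on_subset[OF holG] y(1)]) (use U1V V(2) in \<open>auto simp: U1_def\<close>)
        then show ?thesis
          using holomorphic_fun_on_diff[OF holomorphic_fun_on_subset[OF l(1)]] False by (simp add: h1_def)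
      qed
    next
      fix z i j assume z: "z \<in> U1" and i: "i < Suc r" and j: "j < Suc r"
      have zU: "z \<in> U" "G z \<in> V" using z V(2) by (auto simp: U1_def)
      show "frechet_derivative (h1 i) (at z) (s1 j) = (if i = j then 1 else 0)"
      proof (cases "i < r")
        case True
        then show ?thesis using Dh_s[OF True _ zU(1), of j] Dh_ker[OF True zU(1) P'(3)] j
          by (auto simp: h1_def s1_def less_Suc_eq)
      next
        case False
        then have i: "i = r" using i by simp
        let ?Dy = "frechet_derivative y (at (G z))"
        have blin_l: "(l has_derivative l) (at z)"
        proof (rule bounded_linear_imp_has_derivative)
          have "linear l" unfolding linear_iff by (simp add: l(2,3) scaleR_eq_scale_vec scaleR_conv_of_real)
          then show "bounded_linear l" using linear_conv_bounded_linear by blast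
        qed
        have Dy: "(y has_derivative ?Dy) (at (G z))" "linear ?Dy"
          using holomorphic_fun_on_frechet[OF y(1) zU(2)] by auto
        have Dy_ker: "?Dy v = 0"
          by (rule frechet_derivative_zero_of_invariant[OF y(1) zU(2) V(3) P'(1) y(2) P'(3)])
        have "((\<lambda>z. l z - y (G z)) has_derivative (\<lambda>u. l u - ?Dy (u - (\<Sum>j<r. frechet_derivative (h j) (at z) u *s s' j)))) (at z)"
          by (intro has_derivative_diff blin_l has_derivative_compose[OF DG[OF zU(1)] Dy(1)])
        from frechet_derivative_at[OF this]
        have D: "frechet_derivative (h1 i) (at z) u = l u - ?Dy (u - (\<Sum>j<r. frechet_derivative (h j) (at z) u *s s' j))" for u
          using i by (simp add: h1_def fun_eq_iff)
        show ?thesis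
        proof (cases "j < r")
          case True
          have "(\<Sum>k<r. frechet_derivative (h k) (at z) (s' j) *s s' k) = (\<Sum>k<r. if k = j then s' j else 0)"
            using Dh_s[OF _ True zU(1)] by (intro sum.cong) auto
          then have "(\<Sum>k<r. frechet_derivative (h k) (at z) (s' j) *s s' k) = s' j" using True by simp
          then show ?thesis using D[of "s' j"] True i ls' linear_0[OF Dy(2)] by (simp add: s1_def)
        next
          case False
          \<comment> \<open>Along \<open>v\<close> the derivative of \<open>G\<close> is the
            identity and that of \<open>y\<close> vanishes, which leaves
            \<open>l v = 1\<close>.\<close>
          have "(\<Sum>k<r. frechet_derivative (h k) (at z) v *s s' k) = 0"
            using Dh_ker[OF _ zU(1) P'(3)] by (intro sum.neutral) auto
          then show ?thesis using D[of v] False i j l(4) Dy_ker by (simp add: s1_def)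
        qed
      qed
    qed
  qed
qed

text \<open>Here \<open>c\<close> is the complex dimension of \<open>range P\<close>, and
  \<open>r\<close> the codimension in it of the regular piece found, so the last inequality says
  that this piece has dimension at least \<open>CARD('m)\<close>. Each step adds one graph equation
  to those of the projected zero set, which lives in dimension \<open>c - 1\<close>.\<close>

lemma regular_piece:
  fixes P :: "complex^'k \<Rightarrow> complex^'k" and H :: "complex^'m \<Rightarrow> complex^'k" and f :: "nat \<Rightarrow> complex^'k \<Rightarrow> complex"
  assumes "clinear_map P" "\<And>z. P (P z) = P z" "dim (range P) = 2 * c"
    and "\<And>i. i < n \<Longrightarrow> holomorphic_fun_on (f i) {z. P z \<in> ball q0 \<rho>}" "\<And>i z. f i (P z) = f i z"
    and "open W" "W \<noteq> {}" "holomorphic_map_on H W" "\<And>w. w \<in> W \<Longrightarrow> P (H w) = H w"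
    and "\<And>w. w \<in> W \<Longrightarrow> H w \<in> ball q0 \<rho>" "\<And>w i. w \<in> W \<Longrightarrow> i < n \<Longrightarrow> f i (H w) = 0"
    and "\<And>w. w \<in> W \<Longrightarrow> \<forall>\<^sub>F w' in at w. H w' \<noteq> H w"
  shows "\<exists>q U r h s. open U \<and> q \<in> U \<and> U \<subseteq> {z. P z \<in> ball q0 \<rho>} \<and> (\<forall>i<n. f i q = 0) \<and>
    (\<forall>z. P z \<in> U \<longleftrightarrow> z \<in> U) \<and> straight_equations r h s U \<and> (\<forall>l<r. \<forall>z\<in>U. h l (P z) = h l z) \<and>
    (\<forall>z\<in>U. (\<forall>i<n. f i z = 0) \<longleftrightarrow> (\<forall>l<r. h l z = 0)) \<and> r + CARD('m) \<le> c"
  using assms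
proof (induction c arbitrary: P n f q0 \<rho> H W rule: less_induct)
  case (less c)
  note P = less.prems(1-3) and f = less.prems(4,5) and W = less.prems(6,7)
    and H = less.prems(8-11) and disc = less.prems(12)
  let ?\<Omega> = "{z. P z \<in> ball q0 \<rho>}"
  have \<Omega>_eq: "?\<Omega> = P -` ball q0 \<rho>" by auto
  have \<Omega>: "open ?\<Omega>" "convex ?\<Omega>"
    unfolding \<Omega>_eq using clinear_mapD(7)[OF P(1), of UNIV] clinear_mapD(1)[OF P(1)]
    by (auto intro!: open_vimage convex_linear_vimage)
  have dimc: "CARD('m) \<le> c" by (rule discrete_fibres_dim[OF P(1,3) W H(1,2) disc])
  obtain w0 where w0: "w0 \<in> W" using W by blast
  define q1 where "q1 = H w0"
  have q1: "P q1 = q1" "q1 \<in> ?\<Omega>" "\<And>i. i < n \<Longrightarrow> f i q1 = 0" using H w0 by (auto simp: q1_def)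
  show ?case
  proof (cases "\<forall>i<n. \<forall>z\<in>?\<Omega>. f i z = 0")
    case True
    \<comment> \<open>There is no effective equation: the whole cylinder is a piece of codimension
      0, and discreteness of the fibres bounds \<open>CARD('m)\<close> by \<open>c\<close>.\<close>
    show ?thesis
      by (rule exI[of _ q1], rule exI[of _ ?\<Omega>], rule exI[of _ 0])
        (use True \<Omega> q1 dimc P(2) in \<open>auto simp: straight_equations_def\<close>)
  next
    case False
    then obtain i0 z1 where i0: "i0 < n" and z1: "z1 \<in> ?\<Omega>" "f i0 z1 \<noteq> 0" by blast
    \<comment> \<open>The line leads from a known zero to a point where \<open>f i0\<close> does not
      vanish, so \<open>f i0\<close> has an isolated zero on it at \<open>q1\<close>.\<close>
    define v where "v = P z1 - q1"
    have fi0: "holomorphic_fun_on (f i0) ?\<Omega>" by (rule f(1)[OF i0])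
    have Pv: "P v = v" using q1(1) P(2) clinear_mapD(4)[OF P(1)] by (simp add: v_def)
    have f_end: "f i0 (q1 + 1 *s v) \<noteq> 0" using z1(2) f(2) by (simp add: v_def)
    have v0: "v \<noteq> 0" using f_end q1(3)[OF i0] by auto
    let ?S = "{\<zeta>. q1 + \<zeta> *s v \<in> ?\<Omega>}"
    have S: "open ?S" "connected ?S" by (rule open_line_preimage[OF \<Omega>(1)] convex_connected[OF convex_line_preimage[OF \<Omega>(2)]])+
    have S01: "0 \<in> ?S" "1 \<in> ?S" using q1(2) z1(1) P(2) by (auto simp: v_def)
    have "(\<lambda>\<zeta>. f i0 (q1 + \<zeta> *s v)) holomorphic_on ?S"
      by (rule holomorphic_fun_on_line[OF fi0]) auto
    from isolated_zeros[OF this S S01(1) _ S01(2) f_end] obtain r0 where r0: "r0 > 0" "ball 0 r0 \<subseteq> ?S"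
      "\<And>\<zeta>. \<zeta> \<in> ball 0 r0 - {0} \<Longrightarrow> f i0 (q1 + \<zeta> *s v) \<noteq> 0"
      using q1(3)[OF i0] by auto
    \<comment> \<open>The root count needs a slightly larger disc around that of radius \<delta>;
      radius \<open>2 * \<delta>\<close> still lies within \<open>r0\<close>.\<close>
    define \<delta> where "\<delta> = r0 / 4"
    have \<delta>: "0 < \<delta>" "\<delta> < 2 * \<delta>" "2 * \<delta> < r0" using r0 by (auto simp: \<delta>_def)
    obtain l P' where l: "holomorphic_fun_on l UNIV" "\<And>x y. l (x + y) = l x + l y" "\<And>c x. l (c *s x) = c * l x"
        "l v = 1" "\<And>z. l (P z) = l z"
      and P': "clinear_map P'" "\<And>z. P' (P' z) = P' z" "\<And>z. P' (P z) = P' z" "P' v = 0"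
      and lP': "\<And>z. l (P' z) = 0" and dec: "\<And>z. P z = P' z + l z *s v" and dimP: "dim (range P) = dim (range P') + 2"
      by (rule split_line_off_projection[OF P(1,2) Pv v0]) blast
    \<comment> \<open>In the splitting by \<open>P'\<close> and \<open>l\<close>, \<open>q1\<close>
      has base point \<open>x0\<close> and fibre coordinate \<open>y0\<close>; the fibre discs are
      centred at \<open>y0\<close>.\<close>
    define y0 where "y0 = l q1"
    define x0 where "x0 = P' q1"
    have q1_dec: "q1 = x0 + y0 *s v" unfolding x0_def y0_def by (rule trans[OF q1(1)[symmetric] dec])
    have Hdec: "H w = P' (H w) + l (H w) *s v" if "w \<in> W" for w
      by (rule trans[OF H(2)[OF that, symmetric] dec])
    let ?N = "?\<Omega> \<inter> f i0 -` (- {0})"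
    have N: "open ?N"
      by (rule continuous_open_preimage[OF holomorphic_fun_on_imp_continuous_on[OF fi0] \<Omega>(1)]) auto
    have "q1 + \<zeta> *s v \<in> ?\<Omega>" if "\<zeta> \<in> cball 0 (2 * \<delta>)" for \<zeta>
    proof -
      have "\<zeta> \<in> ball 0 r0" using that \<delta> by simp
      then show ?thesis using r0(2) by blast
    qed
    from tube[OF compact_cball \<Omega>(1) this] obtain \<epsilon>1 where \<epsilon>1: "\<epsilon>1 > 0"
      "\<And>x \<zeta>. x \<in> ball q1 \<epsilon>1 \<Longrightarrow> \<zeta> \<in> cball 0 (2 * \<delta>) \<Longrightarrow> x + \<zeta> *s v \<in> ?\<Omega>" by blast
    have "q1 + \<zeta> *s v \<in> ?N" if "\<zeta> \<in> sphere 0 \<delta>" for \<zeta>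
    proof -
      have "\<zeta> \<in> ball 0 r0 - {0}" using that \<delta> by auto
      then show ?thesis using r0(2,3) by auto
    qed
    from tube[OF compact_sphere N this] obtain \<epsilon>2 where \<epsilon>2: "\<epsilon>2 > 0"
      "\<And>x \<zeta>. x \<in> ball q1 \<epsilon>2 \<Longrightarrow> \<zeta> \<in> sphere 0 \<delta> \<Longrightarrow> x + \<zeta> *s v \<in> ?N" by blast
    define \<epsilon> where "\<epsilon> = min \<epsilon>1 \<epsilon>2"
    have \<epsilon>: "\<epsilon> > 0" using \<epsilon>1 \<epsilon>2 by (simp add: \<epsilon>_def)
    define U1 where "U1 = {x. P' x \<in> ball x0 \<epsilon>}"
    have U1_eq: "U1 = P' -` ball x0 \<epsilon>" by (auto simp: U1_def)
    have U1: "open U1" "connected U1"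
      unfolding U1_eq using clinear_mapD(7)[OF P'(1), of UNIV] clinear_mapD(1)[OF P'(1)]
      by (auto intro!: open_vimage convex_connected convex_linear_vimage)
    have shift: "P' x + y0 *s v \<in> ball q1 \<epsilon>" "P' x + \<zeta> *s v = (P' x + y0 *s v) + (\<zeta> - y0) *s v" if "x \<in> U1" for x \<zeta>
      using that unfolding U1_def q1_dec by (simp_all add: dist_norm vec_eq_iff algebra_simps)
    have sub: "P' x + \<zeta> *s v \<in> ?\<Omega>" if "x \<in> U1" "\<zeta> \<in> ball y0 (2 * \<delta>)" for x \<zeta>
      by (subst shift(2)[OF that(1)], rule \<epsilon>1(2)) (use shift(1)[OF that(1)] that(2) in \<open>auto simp: \<epsilon>_def dist_norm norm_minus_commute\<close>)
    have nz: "f i0 (P' x + \<zeta> *s v) \<noteq> 0" if "x \<in> U1" "norm (\<zeta> - y0) = \<delta>" for x \<zeta>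
    proof -
      have "P' x + \<zeta> *s v \<in> ?N"
        by (subst shift(2)[OF that(1)], rule \<epsilon>2(2)) (use shift(1)[OF that(1)] that(2) in \<open>auto simp: \<epsilon>_def\<close>)
      then show ?thesis by simp
    qed
    let ?Z = "\<lambda>x. disc_roots (\<lambda>\<zeta>. f i0 (P' x + \<zeta> *s v)) y0 \<delta>"
    obtain n' :: nat and e :: "nat \<Rightarrow> complex^'k \<Rightarrow> complex" where e: "\<And>j. j < n' \<Longrightarrow> holomorphic_fun_on (e j) U1"
      "\<And>x x' j. P' x = P' x' \<Longrightarrow> e j x = e j x'"
      "\<And>x. x \<in> U1 \<Longrightarrow> (\<exists>\<zeta>\<in>?Z x. \<forall>i<n. f i (P' x + \<zeta> *s v) = 0) \<longleftrightarrow> (\<forall>j<n'. e j x = 0)"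
      by (rule elimination[OF P'(1) fi0 \<Omega>(1) f(1) U1 \<delta>(1,2) sub nz]) blast+
    obtain D where D: "\<And>x. x \<in> U1 \<Longrightarrow> finite (?Z x)" "\<And>x. x \<in> U1 \<Longrightarrow> card (?Z x) \<le> D"
      by (rule disc_roots_card_bound[OF P'(1) fi0 \<Omega>(1) U1 \<delta>(1,2) sub nz]) blast+
    have root_mem: "l z \<in> ?Z z" if "l z \<in> ball y0 \<delta>" "f i0 z = 0" for z
      using that f(2)[of i0 z] by (simp add: disc_roots_def dec)
    define H' where "H' w = P' (H w)" for w
    \<comment> \<open>On \<open>W'\<close> the base point stays in the ball over which the root
      count is controlled, and the fibre coordinate stays in the disc whose roots are
      eliminated.\<close>
    define W' where "W' = (W \<inter> (\<lambda>w. P' (H w)) -` ball x0 \<epsilon>) \<inter> (W \<inter> (\<lambda>w. l (H w)) -` ball y0 \<delta>)"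
    have contH: "continuous_on W H" by (rule holomorphic_map_on_imp_continuous_on[OF H(1)])
    have contl: "continuous_on UNIV l" by (rule holomorphic_fun_on_imp_continuous_on[OF l(1)])
    have contlH: "continuous_on W (\<lambda>w. l (H w))" by (rule continuous_on_compose2[OF contl contH]) auto
    have openW': "open W'"
      unfolding W'_def using continuous_on_compose2[OF clinear_mapD(7)[OF P'(1), of UNIV] contH] contlH
      by (intro open_Int continuous_open_preimage W(1)) auto
    have w0W': "w0 \<in> W'" using w0 \<epsilon> \<delta> by (simp add: W'_def q1_def[symmetric] x0_def y0_def)
    have W'W: "w \<in> W" and W'_l: "l (H w) \<in> ball y0 \<delta>" and W'_U1: "H w \<in> U1" if "w \<in> W'" for w
      using that by (auto simp: W'_def U1_def)
    have H'U1: "H' w \<in> U1" if "w \<in> W'" for w using W'_U1[OF that] by (simp add: U1_def H'_def P'(2))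
    have c: "c \<ge> 1" using dimP P(3) by linarith
    have IH: "\<exists>q U r h s. open U \<and> q \<in> U \<and> U \<subseteq> {z. P' z \<in> ball x0 \<epsilon>} \<and> (\<forall>i<n'. e i q = 0) \<and>
      (\<forall>z. P' z \<in> U \<longleftrightarrow> z \<in> U) \<and> straight_equations r h s U \<and> (\<forall>l<r. \<forall>z\<in>U. h l (P' z) = h l z) \<and>
      (\<forall>z\<in>U. (\<forall>i<n'. e i z = 0) \<longleftrightarrow> (\<forall>l<r. h l z = 0)) \<and> r + CARD('m) \<le> c - 1"
    proof (rule less.IH[of "c - 1" P' n' e x0 \<epsilon> W' H'])
      show "c - 1 < c" using c by simp
      show "clinear_map P'" "\<And>z. P' (P' z) = P' z" by (rule P')+
      show "dim (range P') = 2 * (c - 1)" using dimP P(3) c by simp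
      show "holomorphic_fun_on (e i) {z. P' z \<in> ball x0 \<epsilon>}" if "i < n'" for i using e(1)[OF that] by (simp add: U1_def)
      show "e i (P' z) = e i z" for i z by (rule e(2)) (rule P'(2))
      show "open W'" "W' \<noteq> {}" using openW' w0W' by auto
      show "holomorphic_map_on H' W'"
        unfolding H'_def
        by (rule holomorphic_map_on_compose[OF holomorphic_map_on_subset[OF H(1)] clinear_map_holomorphic[OF P'(1), of UNIV]])
          (use W'W in auto)
      show "P' (H' w) = H' w" for w by (simp add: H'_def P'(2))
      show "H' w \<in> ball x0 \<epsilon>" if "w \<in> W'" for w using that by (simp add: W'_def H'_def)
      show "e i (H' w) = 0" if w: "w \<in> W'" and i: "i < n'" for w i
      proof -
        have "P' (H' w) + l (H w) *s v = H w" unfolding H'_def P'(2) by (rule Hdec[OF W'W[OF w], symmetric])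
        then have "f j (P' (H' w) + l (H w) *s v) = 0" if "j < n" for j
          using H(4)[OF W'W[OF w] that] by (simp only:)
        moreover from this[OF i0] have "l (H w) \<in> ?Z (H' w)" using W'_l[OF w] by (simp add: disc_roots_def)
        ultimately show ?thesis using e(3)[OF H'U1[OF w]] i by blast
      qed
      \<comment> \<open>If \<open>H w'\<close> has the same projection as \<open>H w\<close>, its
        fibre coordinate is a root of the same \<open>?\<phi>\<close> close to
        \<open>l (H w)\<close>. That root is isolated, so \<open>H w' = H w\<close>, against
        discreteness for \<open>H\<close>.\<close>
      show "\<forall>\<^sub>F w' in at w. H' w' \<noteq> H' w" if w: "w \<in> W'" for w
      proof -
        let ?\<phi> = "\<lambda>\<zeta>. f i0 (P' (H w) + \<zeta> *s v)"
        have hol: "?\<phi> holomorphic_on ball y0 (2 * \<delta>)"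
          by (rule holomorphic_fun_on_line[OF fi0]) (use sub W'_U1[OF w] in auto)
        have "\<forall>\<^sub>F \<zeta> in at (l (H w)). ?\<phi> \<zeta> \<noteq> 0"
          by (rule isolated_root[OF hol \<delta>(1,2) nz[OF W'_U1[OF w]] W'_l[OF w]])
        then have ev: "\<forall>\<^sub>F \<zeta> in nhds (l (H w)). \<zeta> \<noteq> l (H w) \<longrightarrow> ?\<phi> \<zeta> \<noteq> 0" by (simp add: eventually_at_filter)
        have "isCont (\<lambda>w. l (H w)) w" using contlH W(1) W'W[OF w] continuous_on_eq_continuous_at by blast
        then have "((\<lambda>w. l (H w)) \<longlongrightarrow> l (H w)) (at w)" by (simp add: isCont_def)
        then have "\<forall>\<^sub>F w' in at w. l (H w') \<noteq> l (H w) \<longrightarrow> ?\<phi> (l (H w')) \<noteq> 0"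
          using ev unfolding filterlim_iff by blast
        moreover have "\<forall>\<^sub>F w' in at w. w' \<in> W" using W(1) W'W[OF w] eventually_at_topological by blast
        moreover have "\<forall>\<^sub>F w' in at w. H w' \<noteq> H w" by (rule disc[OF W'W[OF w]])
        ultimately show ?thesis
        proof eventually_elim
          case (elim w')
          show ?case
          proof
            assume eq: "H' w' = H' w"
            then have eq': "P' (H w') = P' (H w)" by (simp only: H'_def)
            have "f i0 (H w') = 0" by (rule H(4)[OF elim(2) i0])
            then have "?\<phi> (l (H w')) = 0" by (subst (asm) Hdec[OF elim(2)]) (simp only: eq')
            then have l_eq: "l (H w') = l (H w)" using elim(1) by blast
            have "H w' = P' (H w') + l (H w') *s v" by (rule Hdec[OF elim(2)])
            also have "\<dots> = P' (H w) + l (H w) *s v" by (simp only: eq' l_eq)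
            also have "\<dots> = H w" by (rule Hdec[OF W'W[OF w], symmetric])
            finally have "H w' = H w" .
            then show False using elim(3) by simp
          qed
        qed
      qed
    qed
    obtain q' U' r h s where IH': "open U' \<and> q' \<in> U' \<and> U' \<subseteq> {z. P' z \<in> ball x0 \<epsilon>} \<and> (\<forall>i<n'. e i q' = 0) \<and>
      (\<forall>z. P' z \<in> U' \<longleftrightarrow> z \<in> U') \<and> straight_equations r h s U' \<and> (\<forall>l<r. \<forall>z\<in>U'. h l (P' z) = h l z) \<and>
      (\<forall>z\<in>U'. (\<forall>i<n'. e i z = 0) \<longleftrightarrow> (\<forall>l<r. h l z = 0)) \<and> r + CARD('m) \<le> c - 1"
      by (rule exE[OF IH], elim exE) (rule that)
    have q': "open U'" "q' \<in> U'" "U' \<subseteq> U1" "\<forall>i<n'. e i q' = 0"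
      and U'inv: "\<And>z. P' z \<in> U' \<longleftrightarrow> z \<in> U'" and eqs: "straight_equations r h s U'"
      and hinv: "\<And>j z. j < r \<Longrightarrow> z \<in> U' \<Longrightarrow> h j (P' z) = h j z"
      and X': "\<And>z. z \<in> U' \<Longrightarrow> (\<forall>i<n'. e i z = 0) \<longleftrightarrow> (\<forall>j<r. h j z = 0)" and rc: "r + CARD('m) \<le> c - 1"
      using IH' unfolding U1_def by (elim conjE; blast)+
    \<comment> \<open>By elimination, \<open>T\<close> is the zero set of the equations
      \<open>e\<close> over \<open>U'\<close>, so it is cut out there by the straight equations
      \<open>h\<close>.\<close>
    define T where "T = {x \<in> U'. \<exists>\<zeta>\<in>?Z x. \<forall>i<n. f i (P' x + \<zeta> *s v) = 0}"
    have T_iff: "x \<in> T \<longleftrightarrow> (\<forall>j<r. h j x = 0)" if "x \<in> U'" for x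
    proof -
      have "x \<in> U1" using that q'(3) by blast
      then show ?thesis using e(3)[of x] X'[OF that] that by (simp add: T_def)
    qed
    have "q' \<in> T" using T_iff[OF q'(2)] X'[OF q'(2)] q'(4) by simp
    then have T_ne: "T \<noteq> {}" by blast
    have sub': "P' x + \<zeta> *s v \<in> ?\<Omega>" if "x \<in> U'" "\<zeta> \<in> ball y0 \<delta>" for x \<zeta>
      by (rule sub) (use that q'(3) \<delta> in auto)
    have fin': "finite (?Z x)" "card (?Z x) \<le> D" if "x \<in> U'" for x
      using D[of x] that q'(3) by auto
    obtain x3 V y \<zeta>0 \<eta> where x3: "x3 \<in> T" "open V" "x3 \<in> V" "V \<subseteq> U'" and Vinv: "\<And>x. P' x \<in> V \<longleftrightarrow> x \<in> V"
      and y: "holomorphic_fun_on y V" "\<And>x x'. P' x = P' x' \<Longrightarrow> y x = y x'"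
      and ballsub: "ball \<zeta>0 \<eta> \<subseteq> ball y0 \<delta>"
      and y_ball: "\<And>x. x \<in> V \<Longrightarrow> x \<in> T \<Longrightarrow> y x \<in> ball \<zeta>0 \<eta>"
      and y_root: "\<And>x i. x \<in> V \<Longrightarrow> x \<in> T \<Longrightarrow> i < n \<Longrightarrow> f i (P' x + y x *s v) = 0"
      and y_unique: "\<And>x \<zeta>. x \<in> V \<Longrightarrow> x \<in> T \<Longrightarrow> \<zeta> \<in> ball \<zeta>0 \<eta> \<Longrightarrow> f i0 (P' x + \<zeta> *s v) = 0 \<Longrightarrow> \<zeta> = y x"
      by (rule common_root_branch[OF P'(1) fi0 \<Omega>(1) f(1) q'(1) U'inv P'(2) sub' fin' T_def T_ne]) blast+
    obtain U2 h1 s1 where U2: "open U2" "U2 \<subseteq> V" "\<And>z. z \<in> U2 \<Longrightarrow> l z \<in> ball \<zeta>0 \<eta>" "\<And>z. P z \<in> U2 \<longleftrightarrow> z \<in> U2"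
      and eqs1: "straight_equations (Suc r) h1 s1 U2" "\<And>j z. j < Suc r \<Longrightarrow> z \<in> U2 \<Longrightarrow> h1 j (P z) = h1 j z"
      and h1: "\<And>z. z \<in> U2 \<Longrightarrow> (\<forall>j<Suc r. h1 j z = 0) \<longleftrightarrow> (\<forall>j<r. h j z = 0) \<and> l z = y z"
      and U2I: "\<And>z. z \<in> V \<Longrightarrow> l z \<in> ball \<zeta>0 \<eta> \<Longrightarrow> (\<forall>j<r. h j z = 0) \<Longrightarrow> z \<in> U2"
      by (rule straight_equations_graph[OF eqs q'(1) U'inv hinv P'(1,2,4,3) l x3(2,4) Vinv y open_ball]) blast+
    have zero_iff: "(\<forall>i<n. f i z = 0) \<longleftrightarrow> (\<forall>j<Suc r. h1 j z = 0)" if z: "z \<in> U2" for z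
    proof -
      have zV: "z \<in> V" "z \<in> U'" using z U2(2) x3(4) by auto
      have fz: "f i z = f i (P' z + l z *s v)" for i using f(2)[of i z] dec[of z] by simp
      show ?thesis
      proof
        assume zero: "\<forall>i<n. f i z = 0"
        then have "l z \<in> ?Z z" using U2(3)[OF z] ballsub root_mem i0 by blast
        then have "z \<in> T" using zero zV(2) fz by (auto simp: T_def)
        moreover have "l z = y z"
          by (rule y_unique[OF zV(1) \<open>z \<in> T\<close> U2(3)[OF z]]) (use zero i0 fz in auto)
        ultimately show "\<forall>j<Suc r. h1 j z = 0" using h1[OF z] T_iff[OF zV(2)] by blast
      next
        assume "\<forall>j<Suc r. h1 j z = 0"
        then have "z \<in> T" "l z = y z" using h1[OF z] T_iff[OF zV(2)] by auto
        then show "\<forall>i<n. f i z = 0" using y_root[OF zV(1)] fz by auto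
      qed
    qed
    \<comment> \<open>The point of the graph of \<open>y\<close> above \<open>x3\<close>; it is the
      zero of all \<open>f i\<close> around which the new equations hold.\<close>
    define q where "q = P' x3 + y x3 *s v"
    have P'q: "P' q = P' x3" using clinear_mapD(2,3)[OF P'(1)] P'(2,4) by (simp add: q_def)
    have lq: "l q = y x3" by (simp add: q_def l lP')
    have qV: "q \<in> V" using Vinv[of q] Vinv[of x3] P'q x3(3) by simp
    have "h j q = 0" if "j < r" for j
    proof -
      have "x3 \<in> U'" "q \<in> U'" using x3 qV by auto
      then show ?thesis using hinv[OF that, of q] hinv[OF that, of x3] P'q T_iff[of x3] x3(1) that by simp
    qed
    then have qU2: "q \<in> U2" using U2I[OF qV] lq y_ball[OF x3(3,1)] by simp
    have qz: "\<forall>i<n. f i q = 0" using y_root[OF x3(3,1)] by (simp add: q_def)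
    have U2\<Omega>: "U2 \<subseteq> ?\<Omega>"
    proof
      fix z assume z: "z \<in> U2"
      have "P z \<in> ?\<Omega>"
        unfolding dec[of z] by (rule sub') (use z U2(2,3) x3(4) ballsub in blast)+
      then show "z \<in> ?\<Omega>" by (simp add: P(2))
    qed
    show ?thesis
      by (rule exI[of _ q], rule exI[of _ U2], rule exI[of _ "Suc r"], rule exI[of _ h1], rule exI[of _ s1])
        (intro conjI ballI allI impI U2(1) qU2 U2\<Omega> eqs1 zero_iff U2(4); use qz rc c in simp)
  qed
qed

text \<open>A left inverse \<open>L\<close> of the Jacobian at \<open>z\<close> makes
  \<open>L *v H w\<close> a map between equal dimensions with identity Jacobian at \<open>z\<close>.
  Its local injectivity passes to \<open>H\<close>.\<close>

lemma immersion_locally_injective: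
  fixes H :: "complex^'m \<Rightarrow> complex^'k"
  assumes H: "holomorphic_map_on H B" "open B" and z: "z \<in> B" and inj: "\<And>u. map_deriv H z u = 0 \<Longrightarrow> u = 0"
  obtains W where "open W" "z \<in> W" "W \<subseteq> B" "inj_on H W"
proof -
  have "\<forall>u. complex_jacobian H z *v u = 0 \<longrightarrow> u = 0"
    using inj by (simp add: map_deriv_jacobian[OF H(1) z])
  then obtain L where L: "L ** complex_jacobian H z = mat 1"
    unfolding matrix_left_invertible_ker[symmetric] by blast
  define F where "F w = L *v H w" for w
  have linL: "clinear_map ((*v) L)"
    unfolding clinear_map_def linear_iff
    by (simp add: matrix_vector_mult_def vec_eq_iff algebra_simps sum.distrib sum_distrib_left scaleR_sum_right)
  have holF: "holomorphic_map_on F B"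
    unfolding F_def by (rule holomorphic_map_on_compose[OF H(1) clinear_map_holomorphic[OF linL, of UNIV]]) auto
  have "(F has_derivative (\<lambda>u. L *v map_deriv H z u)) (at z)"
    unfolding F_def
    by (rule has_derivative_compose[OF holomorphic_map_on_map_deriv(1)[OF H(1) z]
          bounded_linear_imp_has_derivative[OF clinear_mapD(6)[OF linL]]])
  from has_derivative_unique[OF holomorphic_map_on_map_deriv(1)[OF holF z] this]
  have "complex_jacobian F z *v u = u" for u
    using map_deriv_jacobian[OF holF z, of u] map_deriv_jacobian[OF H(1) z, of u] L
    by (simp add: matrix_vector_mul_assoc)
  then have "complex_jacobian F z = mat 1" by (simp add: matrix_eq)
  then have detz: "det (complex_jacobian F z) \<noteq> 0" by simp
  let ?U = "B \<inter> (\<lambda>w. det (complex_jacobian F w)) -` (- {0})"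
  have "holomorphic_fun_on (\<lambda>w. det (complex_jacobian F w)) B"
    by (rule holomorphic_fun_on_det[OF holomorphic_fun_on_jacobian[OF holF H(2)]])
  then have U: "open ?U"
    by (intro continuous_open_preimage holomorphic_fun_on_imp_continuous_on H(2)) auto
  show ?thesis
  proof (rule local_inverse_of_jacobian[OF holomorphic_map_on_subset[OF holF] U])
    show "z \<in> ?U" using z detz by simp
    fix U' V g
    assume *: "open U'" "U' \<subseteq> ?U" "z \<in> U'" "homeomorphism U' V F g"
    have "inj_on H U'"
    proof (rule inj_onI)
      fix x y assume xy: "x \<in> U'" "y \<in> U'" "H x = H y"
      then have "g (F x) = g (F y)" by (simp add: F_def)
      then show "x = y" using xy(1,2) *(4) by (simp add: homeomorphism_def)
    qed
    then show ?thesis using that[of U'] * by auto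
  qed auto
qed

text \<open>The induction starts from \<open>P\<close> the identity and \<open>c = CARD('k)\<close>.
  Local injectivity of the immersion supplies its discreteness hypothesis.\<close>

lemma immersed_dim_le_complex_dim:
  fixes H :: "complex^'m \<Rightarrow> complex^'k"
  assumes X: "complex_subvariety X" and H: "holomorphic_map_on H B" "open B" "H ` B \<subseteq> X"
    and z: "z \<in> B" and inj: "\<And>u. map_deriv H z u = 0 \<Longrightarrow> u = 0"
  shows "CARD('m) \<le> complex_dim X"
proof -
  obtain W0 where W0: "open W0" "z \<in> W0" "W0 \<subseteq> B" "inj_on H W0"
    by (rule immersion_locally_injective[OF H(1,2) z inj]) blast+
  have "H z \<in> X" using H(3) z by auto
  then obtain U n and f :: "nat \<Rightarrow> complex^'k \<Rightarrow> complex" where U: "open U" "H z \<in> U"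
    and f: "\<And>i. i < n \<Longrightarrow> holomorphic_fun_on (f i) U" and XU: "X \<inter> U = {z\<in>U. \<forall>i<n. f i z = 0}"
    using X[unfolded complex_subvariety_def, rule_format, OF \<open>H z \<in> X\<close>] by blast
  obtain \<rho> where \<rho>: "\<rho> > 0" "ball (H z) \<rho> \<subseteq> U" using U open_contains_ball by blast
  define W where "W = W0 \<inter> H -` ball (H z) \<rho>"
  have holW0: "holomorphic_map_on H W0" by (rule holomorphic_map_on_subset[OF H(1) W0(3)])
  have W: "open W" "z \<in> W"
    unfolding W_def using continuous_open_preimage[OF holomorphic_map_on_imp_continuous_on[OF holW0] W0(1) open_ball] W0(2) \<rho>(1) by auto
  have fH: "f i (H w) = 0" if "w \<in> W" "i < n" for w i
  proof -
    have "H w \<in> X" "H w \<in> U" using that(1) H(3) W0(3) \<rho>(2) by (auto simp: W_def)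
    then show ?thesis using XU that(2) by blast
  qed
  have "\<exists>q U1 r h s. open U1 \<and> q \<in> U1 \<and> U1 \<subseteq> {x. (\<lambda>x. x) x \<in> ball (H z) \<rho>} \<and> (\<forall>i<n. f i q = 0) \<and>
    (\<forall>x. (\<lambda>x. x) x \<in> U1 \<longleftrightarrow> x \<in> U1) \<and> straight_equations r h s U1 \<and> (\<forall>l<r. \<forall>x\<in>U1. h l ((\<lambda>x. x) x) = h l x) \<and>
    (\<forall>x\<in>U1. (\<forall>i<n. f i x = 0) \<longleftrightarrow> (\<forall>l<r. h l x = 0)) \<and> r + CARD('m) \<le> CARD('k)"
  proof (rule regular_piece[where P = "\<lambda>x. x" and W = W and H = H])
    show "clinear_map (\<lambda>x::complex^'k. x)" by (simp add: clinear_map_def linear_iff)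
    show "dim (range (\<lambda>x::complex^'k. x)) = 2 * CARD('k)" by simp
    show "holomorphic_fun_on (f i) {x. x \<in> ball (H z) \<rho>}" if "i < n" for i
      by (rule holomorphic_fun_on_subset[OF f[OF that]]) (use \<rho>(2) in auto)
    show "holomorphic_map_on H W" by (rule holomorphic_map_on_subset[OF holW0]) (auto simp: W_def)
    show "\<forall>\<^sub>F w' in at w. H w' \<noteq> H w" if "w \<in> W" for w
    proof -
      have "\<forall>\<^sub>F w' in at w. w' \<in> W \<and> w' \<noteq> w" using W(1) that by (auto simp: eventually_at_topological)
      then show ?thesis
        by (rule eventually_mono) (use W0(4) that in \<open>auto simp: W_def inj_on_def\<close>)
    qed
  qed (use W fH in \<open>auto simp: W_def\<close>)
  then obtain q U1 r h s where q: "open U1" "q \<in> U1" "U1 \<subseteq> {x. x \<in> ball (H z) \<rho>}" "\<forall>i<n. f i q = 0"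
    and eqs: "straight_equations r h s U1" and iff: "\<forall>x\<in>U1. (\<forall>i<n. f i x = 0) \<longleftrightarrow> (\<forall>l<r. h l x = 0)"
    and rc: "r + CARD('m) \<le> CARD('k)" by (elim exE conjE) (rule that)
  define d where "d = CARD('k) - r"
  have d: "CARD('k) - d = r" "d \<le> CARD('k)" "CARD('m) \<le> d" using rc by (auto simp: d_def)
  have U1U: "U1 \<subseteq> U" using q(3) \<rho>(2) by blast
  have XU1: "X \<inter> U1 = {x\<in>U1. \<forall>i<r. h i x = 0}" using XU iff U1U by blast
  have "regular_point_of_dim d X q"
    unfolding regular_point_of_dim_def d(1)
  proof (intro conjI exI[of _ U1] exI[of _ h] allI impI ballI)
    show "q \<in> X" using XU q U1U by blast
    show "holomorphic_fun_on (h i) U1" if "i < r" for i using eqs that by (simp add: straight_equations_def)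
    fix x i and c :: "nat \<Rightarrow> complex"
    assume x: "x \<in> U1" and c: "\<forall>v. (\<Sum>i<r. c i * frechet_derivative (h i) (at x) v) = 0" and i: "i < r"
    \<comment> \<open>Evaluating the relation on the dual vector \<open>s i\<close> isolates
      \<open>c i\<close>.\<close>
    have "(\<Sum>j<r. c j * frechet_derivative (h j) (at x) (s i)) = (\<Sum>j<r. if j = i then c i else 0)"
      using eqs x i by (intro sum.cong) (auto simp: straight_equations_def)
    also have "\<dots> = c i" using i by simp
    finally show "c i = 0" using c by simp
  qed (use q d XU1 in auto)
  then have "d \<le> Sup {d. \<exists>q. regular_point_of_dim d X q}"
    by (intro cSup_upper) (auto simp: bdd_above_def regular_point_of_dim_def)
  then show ?thesis using d(3) by (simp add: complex_dim_def)
qed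

section \<open>Transverse flows\<close>

text \<open>Tangency of a (1,0)-field is the vanishing of the real differential on both
  \<open>a\<close> and \<open>\<i> *s a\<close>; hence failure of tangency provides a real direction
  inside complex time that crosses the hypersurface.\<close>

lemma wirtinger_pairing:
  fixes \<rho> :: "complex^'m \<Rightarrow> real"
  assumes "\<rho> differentiable (at z)"
  shows "(\<Sum>j\<in>UNIV. a $ j * wirtinger j \<rho> z) =
    (of_real (frechet_derivative \<rho> (at z) a) - \<i> * of_real (frechet_derivative \<rho> (at z) (\<i> *s a))) / 2"
proof -
  let ?L = "frechet_derivative \<rho> (at z)"
  have lin: "linear ?L" by (rule linear_frechet_derivative[OF assms])
  have ax: "c *s axis j 1 = Re c *\<^sub>R axis j 1 + Im c *\<^sub>R (axis j \<i> :: complex^'m)" for c j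
    by (simp add: vec_eq_iff axis_def complex_eq_iff)
  have L: "?L v = (\<Sum>j\<in>UNIV. Re (v $ j) * ?L (axis j 1) + Im (v $ j) * ?L (axis j \<i>))" for v
  proof -
    have "?L v = ?L (\<Sum>j\<in>UNIV. v $ j *s axis j 1)" by (subst vec_expand_axis) (rule refl)
    also have "\<dots> = (\<Sum>j\<in>UNIV. ?L (v $ j *s axis j 1))" by (rule linear_sum[OF lin])
    also have "\<dots> = (\<Sum>j\<in>UNIV. Re (v $ j) * ?L (axis j 1) + Im (v $ j) * ?L (axis j \<i>))"
      unfolding ax linear_add[OF lin] linear_scale[OF lin] by simp
    finally show ?thesis .
  qed
  have "(\<Sum>j\<in>UNIV. a $ j * wirtinger j \<rho> z) =
      (\<Sum>j\<in>UNIV. (of_real (Re (a $ j) * ?L (axis j 1) + Im (a $ j) * ?L (axis j \<i>)) -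
        \<i> * of_real (Re ((\<i> *s a) $ j) * ?L (axis j 1) + Im ((\<i> *s a) $ j) * ?L (axis j \<i>))) / 2)"
    unfolding wirtinger_def by (intro sum.cong refl) (simp add: complex_eq_iff algebra_simps)
  also have "\<dots> = (of_real (?L a) - \<i> * of_real (?L (\<i> *s a))) / 2"
    unfolding L[of a] L[of "\<i> *s a"] of_real_sum sum_subtractf[symmetric] sum_distrib_left sum_divide_distrib[symmetric] ..
  finally show ?thesis .
qed

lemma sign_change_of_deriv:
  fixes \<psi> :: "real \<Rightarrow> real"
  assumes "(\<psi> has_real_derivative A) (at 0)" "A \<noteq> 0" "\<psi> 0 = 0" "e > 0"
  obtains t where "0 < t" "t < e" "\<psi> (- t) * \<psi> t < 0"
proof (cases "A > 0")
  case True
  obtain d1 where d1: "d1 > 0" "\<And>h. h > 0 \<Longrightarrow> h < d1 \<Longrightarrow> \<psi> 0 < \<psi> (0 + h)"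
    using DERIV_pos_inc_right[OF assms(1) True] by blast
  obtain d2 where d2: "d2 > 0" "\<And>h. h > 0 \<Longrightarrow> h < d2 \<Longrightarrow> \<psi> (0 - h) < \<psi> 0"
    using DERIV_pos_inc_left[OF assms(1) True] by blast
  let ?t = "min (min d1 d2) e / 2"
  have "0 < ?t" "?t < e" "?t < d1" "?t < d2" using d1(1) d2(1) assms(4) by auto
  then show ?thesis using d1(2)[of ?t] d2(2)[of ?t] assms(3) by (intro that[of ?t]) (auto simp: mult_neg_pos)
next
  case False
  then have A: "A < 0" using assms(2) by simp
  obtain d1 where d1: "d1 > 0" "\<And>h. h > 0 \<Longrightarrow> h < d1 \<Longrightarrow> \<psi> (0 + h) < \<psi> 0"
    using DERIV_neg_dec_right[OF assms(1) A] by blast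
  obtain d2 where d2: "d2 > 0" "\<And>h. h > 0 \<Longrightarrow> h < d2 \<Longrightarrow> \<psi> 0 < \<psi> (0 - h)"
    using DERIV_neg_dec_left[OF assms(1) A] by blast
  let ?t = "min (min d1 d2) e / 2"
  have "0 < ?t" "?t < e" "?t < d1" "?t < d2" using d1(1) d2(1) assms(4) by auto
  then show ?thesis using d1(2)[of ?t] d2(2)[of ?t] assms(3) by (intro that[of ?t]) (auto simp: mult_pos_neg)
qed

text \<open>If \<open>H\<close> is constant along a flow transverse to \<open>M\<close> at \<open>q\<close>, each point near \<open>q\<close> can be moved along
  the flow onto \<open>M\<close>, by the intermediate value theorem.\<close>

lemma flow_to_hypersurface:
  fixes \<rho> :: "complex^'m \<Rightarrow> real"
  assumes M: "open U" "continuous_on U \<rho>" "M \<inter> U = {x\<in>U. \<rho> x = 0}" "\<rho> differentiable (at q)" "q \<in> M" "q \<in> U"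
    and trans: "(\<Sum>j\<in>UNIV. a $ j * wirtinger j \<rho> q) \<noteq> 0"
    and V: "open V" "q \<in> V" "\<epsilon> > 0" "continuous_on (V \<times> ball 0 \<epsilon>) (\<lambda>(z, t). \<gamma> z t)"
    and \<gamma>: "\<gamma> q 0 = q" "((\<gamma> q) has_derivative (\<lambda>t. t *s a)) (at (0::complex))"
  obtains V' where "open V'" "q \<in> V'" "V' \<subseteq> V" "\<And>z. z \<in> V' \<Longrightarrow> \<exists>t\<in>ball 0 \<epsilon>. \<gamma> z t \<in> M"
proof -
  let ?L = "frechet_derivative \<rho> (at q)"
  have "?L a \<noteq> 0 \<or> ?L (\<i> *s a) \<noteq> 0" using trans unfolding wirtinger_pairing[OF M(4)] by auto
  \<comment> \<open>Here \<tau> is 1 or \<open>\<i>\<close>; the flow is followed only for real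
    multiples of this complex time.\<close>
  then obtain \<tau> where \<tau>: "norm \<tau> = 1" "?L (\<tau> *s a) \<noteq> 0"
    by (metis norm_one norm_ii vector_smult_lid)
  let ?O = "(V \<times> ball 0 \<epsilon>) \<inter> (\<lambda>(z, t). \<gamma> z t) -` U"
  have "open ?O" by (rule continuous_open_preimage[OF V(4) _ M(1)]) (intro open_Times V(1) open_ball)
  moreover have "(q, 0) \<in> ?O" using V M \<gamma> by simp
  ultimately obtain V1 T where V1: "open V1" "open T" "(q, 0) \<in> V1 \<times> T" "V1 \<times> T \<subseteq> ?O"
    by (rule open_prod_elim)
  obtain e where e: "e > 0" "ball 0 e \<subseteq> T" using V1(2,3) open_contains_ball by blast
  define \<psi> where "\<psi> z t = \<rho> (\<gamma> z (of_real t * \<tau>))" for z and t :: real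
  have "((\<lambda>t::real. of_real t * \<tau>) has_derivative (\<lambda>h. of_real h * \<tau>)) (at 0)"
    by (auto intro!: derivative_eq_intros)
  from has_derivative_compose[OF this, of "\<gamma> q" "\<lambda>t. t *s a"] \<gamma>(2)
  have "((\<lambda>t::real. \<gamma> q (of_real t * \<tau>)) has_derivative (\<lambda>h. (of_real h * \<tau>) *s a)) (at 0)" by simp
  from has_derivative_compose[OF this, of \<rho> ?L] M(4) \<gamma>(1)
  have "(\<psi> q has_derivative (\<lambda>h. ?L ((of_real h * \<tau>) *s a))) (at 0)"
    by (simp add: \<psi>_def[abs_def] frechet_derivative_works)
  moreover have "?L ((of_real h * \<tau>) *s a) = ?L (\<tau> *s a) * h" for h :: real
  proof -
    have "(of_real h * \<tau>) *s a = h *\<^sub>R (\<tau> *s a)" by (simp add: scaleR_eq_scale_vec)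
    then show ?thesis using linear_scale[OF linear_frechet_derivative[OF M(4)]] by simp
  qed
  ultimately have "(\<psi> q has_real_derivative ?L (\<tau> *s a)) (at 0)" by (simp add: has_field_derivative_def)
  moreover have "\<psi> q 0 = 0" using M(3,5,6) \<gamma>(1) by (auto simp: \<psi>_def)
  \<comment> \<open>The sign change is fixed at \<open>q\<close> for one \<open>t\<close>;
    continuity in \<open>z\<close> at the two times \<open>- t\<close> and \<open>t\<close> then
    preserves it on \<open>V'\<close>.\<close>
  ultimately obtain t where t: "0 < t" "t < e" "\<psi> q (- t) * \<psi> q t < 0"
    using sign_change_of_deriv[OF _ \<tau>(2) _ e(1)] by blast
  have in_T: "of_real s * \<tau> \<in> T" if "\<bar>s\<bar> \<le> t" for s
    using that t e(2) \<tau>(1) by (auto simp: norm_mult)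
  have img: "(\<lambda>p. (fst p, of_real (snd p) * \<tau>)) ` (V1 \<times> {-t..t}) \<subseteq> ?O"
  proof
    fix x assume "x \<in> (\<lambda>p. (fst p, of_real (snd p) * \<tau>)) ` (V1 \<times> {-t..t})"
    then obtain z s where zs: "z \<in> V1" "s \<in> {-t..t}" "x = (z, of_real s * \<tau>)" by auto
    have "of_real s * \<tau> \<in> T" by (rule in_T) (use zs(2) in \<open>auto simp: abs_le_iff\<close>)
    then show "x \<in> ?O" using V1(4) zs(1,3) by blast
  qed
  have pair: "continuous_on (V1 \<times> {-t..t}) (\<lambda>p. (fst p, complex_of_real (snd p) * \<tau>))"
    by (intro continuous_intros)
  have cont\<gamma>: "continuous_on (V1 \<times> {-t..t}) (\<lambda>p. case (fst p, of_real (snd p) * \<tau>) of (z, t) \<Rightarrow> \<gamma> z t)"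
    by (rule continuous_on_compose2[OF V(4) pair]) (use img in blast)
  have cont: "continuous_on (V1 \<times> {-t..t}) (\<lambda>p. \<psi> (fst p) (snd p))"
    unfolding \<psi>_def
  proof (rule continuous_on_compose2[OF M(2)])
    show "continuous_on (V1 \<times> {-t..t}) (\<lambda>p. \<gamma> (fst p) (of_real (snd p) * \<tau>))"
      using cont\<gamma> by simp
    show "(\<lambda>p. \<gamma> (fst p) (of_real (snd p) * \<tau>)) ` (V1 \<times> {-t..t}) \<subseteq> U"
    proof
      fix x assume "x \<in> (\<lambda>p. \<gamma> (fst p) (of_real (snd p) * \<tau>)) ` (V1 \<times> {-t..t})"
      then obtain p where p: "p \<in> V1 \<times> {-t..t}" "x = \<gamma> (fst p) (of_real (snd p) * \<tau>)" by blast
      have "(fst p, of_real (snd p) * \<tau>) \<in> ?O" using img p(1) by blast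
      then show "x \<in> U" using p(2) by simp
    qed
  qed
  have cont1: "continuous_on V1 (\<lambda>z. \<psi> z s)" if "\<bar>s\<bar> \<le> t" for s
  proof -
    have "continuous_on V1 (\<lambda>z. (z, s))" by (rule continuous_on_Pair[OF continuous_on_id continuous_on_const])
    moreover have "- t \<le> s" "s \<le> t" using that by linarith+
    then have "(\<lambda>z. (z, s)) ` V1 \<subseteq> V1 \<times> {-t..t}" by auto
    ultimately show ?thesis using continuous_on_compose2[OF cont] by fastforce
  qed
  have cont2: "continuous_on {-t..t} (\<psi> z)" if "z \<in> V1" for z
  proof -
    have "continuous_on {-t..t} (\<lambda>s. (z, s))" by (rule continuous_on_Pair[OF continuous_on_const continuous_on_id])
    from continuous_on_compose2[OF cont this] that show ?thesis by auto
  qed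
  define V' where "V' = V1 \<inter> (\<lambda>z. \<psi> z (- t) * \<psi> z t) -` {..<0}"
  show ?thesis
  proof (rule that[of V'])
    show "open V'" unfolding V'_def
      by (rule continuous_open_preimage[OF continuous_on_mult[OF cont1 cont1] V1(1)]) (use t in auto)
    show "q \<in> V'" using V1(3) t by (simp add: V'_def)
    show "V' \<subseteq> V" using V1(3,4) by (auto simp: V'_def)
    fix z assume z: "z \<in> V'"
    then have zV1: "z \<in> V1" by (simp add: V'_def)
    have "\<psi> z (- t) * \<psi> z t < 0" using z by (simp add: V'_def)
    then obtain s where s: "- t \<le> s" "s \<le> t" "\<psi> z s = 0"
      using IVT_sign_change[of "- t" t "\<psi> z"] cont2[OF zV1] t by auto
    then have "(z, of_real s * \<tau>) \<in> ?O" using V1(4) zV1 in_T[of s] by (auto simp: abs_le_iff)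
    then show "\<exists>t\<in>ball 0 \<epsilon>. \<gamma> z t \<in> M" using M(3) s(3) by (auto simp: \<psi>_def)
  qed
qed

theorem corollary5p3:
  fixes n d :: nat
    and M :: "(complex^'m) set" and p :: "complex^'m"
    and M' X :: "(complex^'N) set" and p' :: "complex^'N"
    and H :: "complex^'m \<Rightarrow> complex^'N" and U :: "(complex^'m) set"
  assumes dim: "CARD('m) = n + 1"
    and M: "holomorphically_nondegenerate M" "p \<in> M"
    and M': "real_analytic_submanifold d M'" "p' \<in> M'"
    and H: "open U" "p \<in> U" "holomorphic_map_on H U" "H p = p'"
    and X: "complex_subvariety X" "complex_dim X \<le> n" "p' \<in> X"
    and incl: "\<forall>\<^sub>F z in nhds p. z \<in> M \<longrightarrow> H z \<in> X \<inter> M'"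
  shows "\<forall>\<^sub>F z in nhds p. H z \<in> M'"
proof -
  have hyp: "real_analytic_hypersurface M" and nondeg: "\<And>q. q \<in> M \<Longrightarrow> \<not> tangent_holomorphic_field_at M q"
    using M(1) by (auto simp: holomorphically_nondegenerate_def)
  obtain U' \<rho>' where U': "p' \<in> U'" "real_analytic_defining d \<rho>' U' M'"
    using M' unfolding real_analytic_submanifold_def by blast
  have \<rho>': "open U'" "\<And>i. i < d \<Longrightarrow> real_analytic_on (\<rho>' i) U'" "M' \<inter> U' = {x\<in>U'. \<forall>i<d. \<rho>' i x = 0}"
    using U'(2) unfolding real_analytic_defining_def by blast+
  obtain UX k and f :: "nat \<Rightarrow> complex^'N \<Rightarrow> complex" where UX: "open UX" "p' \<in> UX"
    and f: "\<And>i. i < k \<Longrightarrow> holomorphic_fun_on (f i) UX" and XU: "X \<inter> UX = {z\<in>UX. \<forall>i<k. f i z = 0}"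
    using X(1)[unfolded complex_subvariety_def, rule_format, OF X(3)] by blast
  have "open (U \<inter> H -` (U' \<inter> UX))"
    by (intro continuous_open_preimage holomorphic_map_on_imp_continuous_on H open_Int \<rho>'(1) UX(1))
  moreover have "p \<in> U \<inter> H -` (U' \<inter> UX)" using H(2,4) U'(1) UX(2) by simp
  ultimately obtain r1 where r1: "r1 > 0" "ball p r1 \<subseteq> U \<inter> H -` (U' \<inter> UX)" using open_contains_ball by blast
  obtain r2 where r2: "r2 > 0" "\<And>z. dist z p < r2 \<Longrightarrow> z \<in> M \<Longrightarrow> H z \<in> X \<inter> M'"
    using incl unfolding eventually_nhds_metric by blast
  \<comment> \<open>One radius realises all germs at once: \<open>H\<close> is holomorphic with
    values where \<open>M'\<close> and \<open>X\<close> have their equations, and the inclusion on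
    \<open>M\<close> holds.\<close>
  define r where "r = min r1 r2"
  define B where "B = ball p r"
  have r: "r > 0" using r1 r2 by (simp add: r_def)
  have B: "open B" "convex B" "p \<in> B" "B \<noteq> {}" using r by (auto simp: B_def)
  have BH: "H z \<in> U'" "H z \<in> UX" "z \<in> U" if "z \<in> B" for z
    using r1(2) that by (auto simp: B_def r_def)
  have BM: "H z \<in> X" "H z \<in> M'" if "z \<in> B" "z \<in> M" for z
    using r2(2)[of z] that by (auto simp: B_def r_def dist_commute)
  have holH: "holomorphic_map_on H B" by (rule holomorphic_map_on_subset[OF H(3)]) (use BH in blast)
  have unique: "g z = 0" if "holomorphic_fun_on g B" "\<And>z. z \<in> M \<Longrightarrow> z \<in> B \<Longrightarrow> g z = 0" "z \<in> B" for g z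
    using hypersurface_uniqueness[OF hyp M(2) r, of g z] that unfolding B_def by blast
  have HX: "H ` B \<subseteq> X"
  proof
    fix x assume "x \<in> H ` B"
    then obtain z where z: "z \<in> B" "x = H z" by blast
    have "f i (H z) = 0" if i: "i < k" for i
    proof (rule unique[OF _ _ z(1)])
      show "holomorphic_fun_on (\<lambda>z. f i (H z)) B"
        by (rule holomorphic_fun_on_compose[OF holH f[OF i]]) (use BH in blast)
      show "f i (H w) = 0" if "w \<in> M" "w \<in> B" for w
        using BM[OF that(2,1)] BH[OF that(2)] XU i by blast
    qed
    then show "x \<in> X" using XU BH[OF z(1)] z(2) by blast
  qed
  \<comment> \<open>An injective derivative would force \<open>X\<close> to have dimension at least
    \<open>n + 1\<close>.\<close>
  have sing: "\<exists>u. u \<noteq> 0 \<and> map_deriv H z u = 0" if z: "z \<in> B" for z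
  proof (rule ccontr)
    assume "\<not> ?thesis"
    then have "CARD('m) \<le> complex_dim X"
      by (intro immersed_dim_le_complex_dim[OF X(1) holH B(1) HX z]) blast
    then show False using dim X(2) by simp
  qed
  have open_piece: "\<exists>V. open V \<and> V \<noteq> {} \<and> V \<subseteq> B \<and> (\<forall>z\<in>V. H z \<in> M')"
  proof (rule constant_rank_flow[OF holH B(1,4) sing], assumption)
    fix D a
    assume D: "holomorphic_fun_on D B" "\<exists>z\<in>B. D z \<noteq> 0" and a: "holomorphic_map_on a {z \<in> B. D z \<noteq> 0}"
      and a0: "\<And>q. q \<in> B \<Longrightarrow> D q \<noteq> 0 \<Longrightarrow> a q \<noteq> 0"
      and flow: "\<And>q. q \<in> B \<Longrightarrow> D q \<noteq> 0 \<Longrightarrow> \<exists>V \<gamma> \<epsilon>. flow_box H B (a q) q V \<gamma> \<epsilon>"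
    let ?D = "{z \<in> B. D z \<noteq> 0}"
    have "?D = B \<inter> D -` (- {0})" by blast
    then have openD: "open ?D"
      using continuous_open_preimage[OF holomorphic_fun_on_imp_continuous_on[OF D(1)] B(1), of "- {0}"] by auto
    \<comment> \<open>If \<open>D\<close> vanished on \<open>M \<inter> B\<close>, uniqueness on
      \<open>M\<close> would make it vanish on \<open>B\<close>.\<close>
    obtain q where q: "q \<in> M" "q \<in> ?D" using unique[OF D(1)] D(2) by blast
    obtain U0 \<rho>s where U0: "q \<in> U0" "real_analytic_defining 1 \<rho>s U0 M"
      using hyp q(1) unfolding real_analytic_submanifold_def by blast
    define \<rho> where "\<rho> = \<rho>s 0"
    \<comment> \<open>Shrinking to the set where \<open>D\<close> is nonzero makes \<open>a\<close>
      holomorphic on the whole domain of the defining function, as the definition of a tangent field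
      requires.\<close>
    define U1 where "U1 = U0 \<inter> ?D"
    note h0 = real_analytic_defining_hypersurfaceD[OF U0(2), folded \<rho>_def]
    have defU1: "real_analytic_defining 1 (\<lambda>_. \<rho>) U1 M"
      using U0(2) openD unfolding real_analytic_defining_def U1_def \<rho>_def real_analytic_on_def by auto
    note h1 = real_analytic_defining_hypersurfaceD[OF defU1]
    have "holomorphic_map_on a U1" by (rule holomorphic_map_on_subset[OF a]) (auto simp: U1_def)
    moreover have "\<not> (\<forall>\<^sub>F z in nhds q. a z = 0)" using a0[of q] q(2) eventually_nhds_x_imp_x by fastforce
    moreover have "q \<in> U1" using q U0(1) by (simp add: U1_def)
    \<comment> \<open>The germ of \<open>a\<close> at \<open>q\<close> is nontrivial because
      \<open>a q \<noteq> 0\<close>, so nondegeneracy at \<open>q\<close> denies its tangency.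
      Transversality may occur only at another point \<open>z\<close> of \<open>M\<close> in
      \<open>U1\<close>.\<close>
    ultimately obtain z where z: "z \<in> M" "z \<in> U1" "(\<Sum>j\<in>UNIV. a z $ j * wirtinger j \<rho> z) \<noteq> 0"
      using nondeg[OF q(1)] defU1 unfolding tangent_holomorphic_field_at_def by blast
    have zB: "z \<in> B" "D z \<noteq> 0" using z(2) by (auto simp: U1_def)
    from flow[OF this] obtain V and \<gamma> :: "complex^'m \<Rightarrow> complex \<Rightarrow> complex^'m" and \<epsilon> where
      V: "open V" "z \<in> V" "\<epsilon> > 0" "continuous_on (V \<times> ball 0 \<epsilon>) (\<lambda>(z, t). \<gamma> z t)"
      and const: "\<forall>z\<in>V. \<forall>t\<in>ball 0 \<epsilon>. \<gamma> z t \<in> B \<and> H (\<gamma> z t) = H z"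
      and \<gamma>: "\<gamma> z 0 = z" "((\<gamma> z) has_derivative (\<lambda>t. t *s a z)) (at 0)"
      unfolding flow_box_def by (elim exE conjE)
    have diff: "\<rho> differentiable (at z)" by (rule real_analytic_on_differentiable[OF h1(3) z(2)])
    obtain V' where V': "open V'" "z \<in> V'" "V' \<subseteq> V" "\<And>w. w \<in> V' \<Longrightarrow> \<exists>t\<in>ball 0 \<epsilon>. \<gamma> w t \<in> M"
      by (rule flow_to_hypersurface[OF h1(1,6,2) diff z V \<gamma>]) blast
    have "H w \<in> M'" if w: "w \<in> V'" for w
    proof -
      obtain t where t: "t \<in> ball 0 \<epsilon>" "\<gamma> w t \<in> M" using V'(4)[OF w] by blast
      have "\<gamma> w t \<in> B" "H (\<gamma> w t) = H w" using const V'(3) w t(1) by blast+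
      then show ?thesis using BM(2)[OF _ t(2)] by simp
    qed
    then show ?thesis using V'(1,2) zB(1) B(1) by (intro exI[of _ "V' \<inter> B"]) auto
  qed
  then obtain V where V: "open V" "V \<noteq> {}" "V \<subseteq> B" "\<And>z. z \<in> V \<Longrightarrow> H z \<in> M'" by blast
  \<comment> \<open>Analytic continuation is done for each defining function of \<open>M'\<close>
    separately, from the open piece \<open>V\<close> to the ball around \<open>p\<close>.\<close>
  have "\<rho>' i (H z) = 0" if "i < d" "z \<in> B" for i z
  proof (rule real_analytic_compose_identity[OF \<rho>'(2)[OF that(1)] holH B(1,2) _ V(1,3,2) _ that(2)])
    show "H ` B \<subseteq> U'" using BH by blast
    show "\<rho>' i (H w) = 0" if "w \<in> V" for w
      using V(4)[OF that] V(3) that BH(1)[of w] \<rho>'(3) \<open>i < d\<close> by blast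
  qed
  then have "H z \<in> M'" if "z \<in> B" for z using \<rho>'(3) BH(1)[OF that] that by blast
  then show ?thesis using B(1,3) unfolding eventually_nhds by blast
qed

end
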